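(* Let $\mathcal{X}$ be a permanental point process on $\Lambda$ (with reference measure $\mu$) with kernel $$K(x,y)=\sum_{k=1}^{n}\lambda_k\,\phi_k(x)\overline{\phi_k(y)},$$ where $n\in\{1,2,\dots\}\cup\{\infty\}$, the $\phi_k$ are orthonormal in $L^2(\Lambda,\mu)$ (normalized eigenfunctions of the integral operator with kernel $K$), the eigenvalues satisfy $\lambda_k\ge0$, and the operator is trace class, i.e. $\sum_k\lambda_k<\infty$. For $\vec{\alpha}=(\alpha_1,\dots,\alpha_n)$ with $\alpha_i$ non-negative integers such that $\ell=\ell(\vec{\alpha})=\alpha_1+\cdots+\alpha_n<\infty$, let $Z^{\vec{\alpha}}=(Z^{\vec\alpha}_1,\dots,Z^{\vec\alpha}_\ell)$ be the random vector in $\Lambda^\ell$ with density, with respect to $\mu^{\ell}$, $$p(z_1,\dots,z_\ell)=\frac{1}{\ell!\,\alpha_1!\cdots\alpha_n!}\,\big|\operatorname{per}M_{\vec{\alpha}}(z_1,\dots,z_\ell)\big|^2,$$ where $M_{\vec{\alpha}}(z_1,\dots,z_\ell)$ is the $\ell\times\ell$ matrix in which, for each $i$, the row $(\phi_i(z_1),\dots,\phi_i(z_\ell))$ is repeated $\alpha_i$ times (and does not occur if $\alpha_i=0$). Let $\mathcal{X}_{\vec{\alpha}}$ be the point process determined by $Z^{\vec{\alpha}}$, i.e. $\mathcal{X}_{\vec{\alpha}}(D)$ is the number of $j\le\ell$ such that $Z^{\vec{\alpha}}_j\in D$. Let $\gamma_1,\dots,\gamma_n$ be independent geometric random variables with $$\mathbf{P}(\gamma_k=s)=\Big(\frac{\lambda_k}{\lambda_k+1}\Big)^s\frac{1}{\lambda_k+1},\qquad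 s=0,1,2,\dots$$ Then $$\mathcal{X}\stackrel{d}{=}\mathcal{X}_{\vec{\gamma}},\qquad \vec{\gamma}=(\gamma_1,\dots,\gamma_n),$$ where $\mathcal{X}_{\vec{\gamma}}$ is obtained by first sampling $\vec{\gamma}$ and then, given $\vec\gamma=\vec\alpha$, sampling $\mathcal{X}_{\vec{\alpha}}$. In particular, $\mathcal{X}(\Lambda)$ has the distribution of the sum of the independent geometric random variables $\gamma_k$.
   Context: $\Lambda$ is a locally compact Polish space with a Radon (reference) measure $\mu$. A point process on $\Lambda$ is a random integer-valued positive Radon measure $\mathcal{X}$ on $\Lambda$ (multiple points allowed). Its joint intensities with respect to $\mu$ are functions $\rho_k:\Lambda^k\to[0,\infty)$, $k\ge1$, such that for mutually disjoint Borel sets $D_1,\dots,D_r$ and $k=\sum_i k_i$ (integers $k_i\ge1$), $\mathbf{E}\big[\prod_{i=1}^r\binom{\mathcal{X}(D_i)}{k_i}k_i!\big]=\int_{\prod_i D_i^{k_i}}\rho_k(x_1,\dots,x_k)\,d\mu(x_1)\cdots d\mu(x_k)$. The permanent of an $m\times m$ matrix $M$ is $\operatorname{per}(M)=\sum_{\pi\in S_m}\prod_{i=1}^m M_{i,\pi(i)}$. A point process is permanental with kernel $K$ if its joint intensities are $\rho_k(x_1,\dots,x_k)=\operatorname{per}(K(x_i,x_j))_{1\le i,j\le k}$ for every $k\ge1$. Kernels are interpreted pointwise, $\mu$-almost everywhere in each variable, through their eigenfunction expansion. For $\ell=0$ the process $\mathcal{X}_{\vec{\alpha}}$ is the empty process.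 *)

theory Defs
  imports "HOL-Probability.Probability"
begin

text \<open>
  The state space is a type of class \<open>polish_space\<close> whose topology is locally compact.
  On such a space a Borel measure that is finite on compact sets is automatically regular,
  so finiteness on compact sets is all that the Radon property requires.
\<close>

definition radon_measure :: "'a::topological_space measure \<Rightarrow> bool" where
  "radon_measure m \<longleftrightarrow> sets m = sets borel \<and> (\<forall>C. compact C \<longrightarrow> emeasure m C < \<infinity>)"

definition configurations :: "'a::topological_space measure set" where
  "configurations =
     {m. radon_measure m \<and> (\<forall>D\<in>sets borel. emeasure m D = \<infinity> \<or> (\<exists>j::nat. emeasure m D = of_nat j))}"

text \<open>
  The sigma-algebra on configurations is the one generated by the evaluations
  \<open>m \<mapsto> m(D)\<close>, \<open>D\<close> Borel, built in the same way as \<open>subprob_algebra\<close>. A point process is a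
  measurable map into this space; equality in distribution is equality of the image measures.
\<close>

definition config_space :: "'a::topological_space measure measure" where
  "config_space = (SUP D\<in>sets borel. vimage_algebra configurations (\<lambda>m. emeasure m D) borel)"

lemma space_config_space: "space config_space = configurations"
  unfolding config_space_def by (subst space_Sup_eq_UN) auto

lemma measurable_config_space:
  assumes "\<And>\<omega>. \<omega> \<in> space P \<Longrightarrow> X \<omega> \<in> configurations"
    and "\<And>D. D \<in> sets borel \<Longrightarrow> (\<lambda>\<omega>. emeasure (X \<omega>) D) \<in> borel_measurable P"
  shows "X \<in> measurable P config_space"
  unfolding config_space_def
  by (rule measurable_Sup2) (auto intro!: measurable_vimage_algebra2 assms)

lemma measurable_emeasure_config:
  "D \<in> sets borel \<Longrightarrow> (\<lambda>m. emeasure m D) \<in> borel_measurable config_space"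
  unfolding config_space_def
  by (auto intro!: measurable_Sup1 measurable_vimage_algebra1)

definition point_process :: "'w measure \<Rightarrow> ('w \<Rightarrow> 'a::topological_space measure) \<Rightarrow> bool" where
  "point_process P X \<longleftrightarrow> prob_space P \<and> X \<in> measurable P config_space"

text \<open>
  \<open>falling x k\<close> is \<open>(x choose k) * k!\<close> for \<open>x\<close> a natural number or infinity. Subtraction on
  \<open>ennreal\<close> is truncated, so a factor vanishes if \<open>x\<close> is a natural number below \<open>k\<close>,
  and \<open>falling \<infinity> k = \<infinity>\<close> for \<open>k > 0\<close>.
\<close>

definition falling :: "ennreal \<Rightarrow> nat \<Rightarrow> ennreal" where
  "falling x k = (\<Prod>j<k. x - of_nat j)"

text \<open>
  Points of the \<open>k\<close>-fold product are functions on \<open>{..<k}\<close>. The list \<open>blocks r D ks\<close>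
  consists of \<open>ks 0\<close> copies of \<open>D 0\<close>, then \<open>ks 1\<close> copies of \<open>D 1\<close>, and so on up to
  \<open>D (r - 1)\<close>; the product of its entries is the set \<open>\<Prod>i D\<^sub>i^k\<^sub>i\<close>.
\<close>

definition blocks :: "nat \<Rightarrow> (nat \<Rightarrow> 'a set) \<Rightarrow> (nat \<Rightarrow> nat) \<Rightarrow> 'a set list" where
  "blocks r D ks = concat (map (\<lambda>i. replicate (ks i) (D i)) [0..<r])"

definition joint_intensities ::
  "'w measure \<Rightarrow> ('w \<Rightarrow> 'a::topological_space measure) \<Rightarrow> 'a measure
    \<Rightarrow> (nat \<Rightarrow> (nat \<Rightarrow> 'a) \<Rightarrow> real) \<Rightarrow> bool" where
  "joint_intensities P X \<mu> \<rho> \<longleftrightarrow>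
     (\<forall>k\<ge>1. \<rho> k \<in> borel_measurable (Pi\<^sub>M {..<k} (\<lambda>_. \<mu>)) \<and> (\<forall>x. 0 \<le> \<rho> k x)) \<and>
     (\<forall>r\<ge>1. \<forall>D ks k.
        (\<forall>i<r. D i \<in> sets borel) \<and> disjoint_family_on D {..<r} \<and>
        (\<forall>i<r. 1 \<le> ks i) \<and> k = (\<Sum>i<r. ks i) \<longrightarrow>
        (\<integral>\<^sup>+\<omega>. (\<Prod>i<r. falling (emeasure (X \<omega>) (D i)) (ks i)) \<partial>P) =
        (\<integral>\<^sup>+x. ennreal (\<rho> k x) * indicator (Pi\<^sub>E {..<k} (\<lambda>j. blocks r D ks ! j)) x
           \<partial>(Pi\<^sub>M {..<k} (\<lambda>_. \<mu>))))"

definition per :: "nat \<Rightarrow> (nat \<Rightarrow> nat \<Rightarrow> 'c::comm_ring_1) \<Rightarrow> 'c" where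
  "per m M = (\<Sum>\<pi> | \<pi> permutes {..<m}. \<Prod>i<m. M i (\<pi> i))"

text \<open>
  Kernels are only meaningful almost everywhere, so the joint intensities are compared with
  the permanents almost everywhere with respect to the product measure.
\<close>

definition permanental_process ::
  "'w measure \<Rightarrow> ('w \<Rightarrow> 'a::topological_space measure) \<Rightarrow> 'a measure
    \<Rightarrow> ('a \<Rightarrow> 'a \<Rightarrow> complex) \<Rightarrow> bool" where
  "permanental_process P X \<mu> K \<longleftrightarrow>
     point_process P X \<and>
     (\<exists>\<rho>. joint_intensities P X \<mu> \<rho> \<and>
          (\<forall>k\<ge>1. AE x in Pi\<^sub>M {..<k} (\<lambda>_. \<mu>).
             complex_of_real (\<rho> k x) = per k (\<lambda>i j. K (x i) (x j))))"

definition idx :: "enat \<Rightarrow> nat set" where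
  "idx n = {k. 1 \<le> k \<and> enat k \<le> n}"

definition orthonormal_L2 :: "'a measure \<Rightarrow> nat set \<Rightarrow> (nat \<Rightarrow> 'a \<Rightarrow> complex) \<Rightarrow> bool" where
  "orthonormal_L2 \<mu> I \<phi> \<longleftrightarrow>
     (\<forall>k\<in>I. \<phi> k \<in> borel_measurable \<mu> \<and> integrable \<mu> (\<lambda>x. (cmod (\<phi> k x))\<^sup>2)) \<and>
     (\<forall>i\<in>I. \<forall>j\<in>I. (LINT x|\<mu>. \<phi> i x * cnj (\<phi> j x)) = (if i = j then 1 else 0))"

text \<open>
  If the \<open>\<phi> k\<close> are orthonormal and the nonnegative \<open>lam k\<close> are summable, then the expansion
  converges absolutely for all \<open>x\<close>, \<open>y\<close> outside a fixed null set; \<open>infsum\<close> takes the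
  value 0 where it does not converge.
\<close>

definition eigen_kernel ::
  "nat set \<Rightarrow> (nat \<Rightarrow> real) \<Rightarrow> (nat \<Rightarrow> 'a \<Rightarrow> complex) \<Rightarrow> 'a \<Rightarrow> 'a \<Rightarrow> complex" where
  "eigen_kernel I lam \<phi> x y = (\<Sum>\<^sub>\<infinity>k\<in>I. complex_of_real (lam k) * \<phi> k x * cnj (\<phi> k y))"

definition supp :: "nat set \<Rightarrow> (nat \<Rightarrow> nat) \<Rightarrow> nat set" where
  "supp I \<alpha> = {k\<in>I. \<alpha> k \<noteq> 0}"

definition total :: "nat set \<Rightarrow> (nat \<Rightarrow> nat) \<Rightarrow> nat" where
  "total I \<alpha> = (\<Sum>k\<in>supp I \<alpha>. \<alpha> k)"

text \<open>
  The list of row labels contains each \<open>k\<close> exactly \<open>\<alpha> k\<close> times, in increasing order;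
  row \<open>i\<close> of the matrix is \<open>\<phi> k\<close> evaluated at the points, for \<open>k\<close> the \<open>i\<close>-th label.
\<close>

definition row_labels :: "nat set \<Rightarrow> (nat \<Rightarrow> nat) \<Rightarrow> nat list" where
  "row_labels I \<alpha> = concat (map (\<lambda>k. replicate (\<alpha> k) k) (sorted_list_of_set (supp I \<alpha>)))"

definition occupation_matrix ::
  "nat set \<Rightarrow> (nat \<Rightarrow> 'a \<Rightarrow> complex) \<Rightarrow> (nat \<Rightarrow> nat) \<Rightarrow> (nat \<Rightarrow> 'a) \<Rightarrow> nat \<Rightarrow> nat \<Rightarrow> complex" where
  "occupation_matrix I \<phi> \<alpha> z i j = \<phi> (row_labels I \<alpha> ! i) (z j)"

definition occupation_density ::
  "nat set \<Rightarrow> (nat \<Rightarrow> 'a \<Rightarrow> complex) \<Rightarrow> (nat \<Rightarrow> nat) \<Rightarrow> (nat \<Rightarrow> 'a) \<Rightarrow> real" where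
  "occupation_density I \<phi> \<alpha> z =
     1 / (fact (total I \<alpha>) * (\<Prod>k\<in>supp I \<alpha>. fact (\<alpha> k))) *
     (cmod (per (total I \<alpha>) (occupation_matrix I \<phi> \<alpha> z)))\<^sup>2"

definition Z_law ::
  "'a measure \<Rightarrow> nat set \<Rightarrow> (nat \<Rightarrow> 'a \<Rightarrow> complex) \<Rightarrow> (nat \<Rightarrow> nat) \<Rightarrow> (nat \<Rightarrow> 'a) measure" where
  "Z_law \<mu> I \<phi> \<alpha> =
     density (Pi\<^sub>M {..<total I \<alpha>} (\<lambda>_. \<mu>)) (\<lambda>z. ennreal (occupation_density I \<phi> \<alpha> z))"

text \<open>
  The image of the counting measure on \<open>{..<l}\<close> under \<open>z\<close>: its value at \<open>D\<close> is
  the number of \<open>j < l\<close> with \<open>z j \<in> D\<close>.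
\<close>

definition config_of :: "nat \<Rightarrow> (nat \<Rightarrow> 'a::topological_space) \<Rightarrow> 'a measure" where
  "config_of l z = distr (count_space {..<l}) borel z"

lemma emeasure_config_of:
  assumes "D \<in> sets borel"
  shows "emeasure (config_of l z) D = of_nat (card {j. j < l \<and> z j \<in> D})"
proof -
  have "z -` D \<inter> {..<l} = {j. j < l \<and> z j \<in> D}" by auto
  moreover have "{j. j < l \<and> z j \<in> D} \<subseteq> {..<l}" by auto
  ultimately show ?thesis using assms
    unfolding config_of_def by (simp add: emeasure_distr emeasure_count_space)
qed

lemma config_of_in_configurations: "config_of l (z :: nat \<Rightarrow> 'a::t2_space) \<in> configurations"
  unfolding configurations_def radon_measure_def
  by (auto simp: emeasure_config_of compact_imp_closed) (auto simp: config_of_def of_nat_less_top)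

text \<open>
  The law of the process with occupation numbers \<open>\<alpha>\<close>. If \<open>\<alpha>\<close> has infinite support on \<open>I\<close>,
  it is set to the law of the empty process; for independent geometric occupation numbers with
  summable means this happens with probability zero.
\<close>

definition occupation_law ::
  "'a::topological_space measure \<Rightarrow> nat set \<Rightarrow> (nat \<Rightarrow> 'a \<Rightarrow> complex) \<Rightarrow> (nat \<Rightarrow> nat)
    \<Rightarrow> 'a measure measure" where
  "occupation_law \<mu> I \<phi> \<alpha> =
     (if finite (supp I \<alpha>)
      then distr (Z_law \<mu> I \<phi> \<alpha>) config_space (config_of (total I \<alpha>))
      else return config_space (null_measure borel))"

end

theory Submission
  imports Defs "HOL-Combinatorics.Permutations" "HOL-Complex_Analysis.Complex_Analysis"
begin

text \<open>
  Two point processes with finite expected number of points have the same law if their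
  factorial moments over disjoint sets agree and those of the total number of points do not
  grow too fast (\<open>config_law_eqI\<close>). So it suffices to compare factorial moments. Both sides
  turn out to be equal: if \<open>k\<close> is the total multiplicity, the moment is \<open>1/k!\<close> times the
  series \<open>box_moment\<close>, the sum over all labellings \<open>g\<close> of \<open>k\<close> points by eigenfunctions
  of \<open>\<Prod>i. lam (g i)\<close> times the integral of \<open>|per (\<phi> (g i) (x j))|\<^sup>2\<close> over a
  box.

  For the permanental process this is the Cauchy--Binet formula for the permanent of the kernel
  (\<open>kernel_permanent_expansion\<close>).

  For the mixture, fix the occupation numbers \<open>\<alpha>\<close> first. The permanent in the density is a
  multiple of a sum of tensor products of eigenfunctions, taken over all labellings of the points
  with multiplicities \<open>\<alpha>\<close> (\<open>per_arrangement\<close>). By orthogonality, integrating out a point amounts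
  to removing a particle chosen uniformly at random. Hence the \<open>k\<close>-point intensity is a sum over
  selections of \<open>k\<close> particles (\<open>occupation_marginal\<close>): a labelling \<open>g\<close> with multiplicities
  \<open>\<beta>\<close> gets the coefficient \<open>\<Prod>a. (\<alpha> a choose \<beta> a)\<close>. A geometric variable with mean
  \<open>t\<close> satisfies \<open>E (\<gamma> choose b) = t\<^sup>b\<close>, so averaging over independent geometric occupation
  numbers replaces the coefficient by \<open>\<Prod>i. lam (g i)\<close> (\<open>nn_integral_sub_choose\<close>).

  The moments determine the law because the kernel is of trace class: the \<open>k\<close>-th factorial moment
  of the total number \<open>N\<close> of points is at most \<open>k!\<close> times the \<open>k\<close>-th power of the trace
  (\<open>box_moment_le\<close>), so \<open>E (1 + \<delta>)\<^sup>N\<close> is finite for some \<open>\<delta> > 0\<close>. Probability generating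
  functions of counts are then analytic beyond the unit disc and determined by their
  Taylor coefficients at \<open>1\<close>, which are the binomial moments.
\<close>

section \<open>Labellings with prescribed multiplicities\<close>

text \<open>
  A labelling gives each of \<open>l\<close> points a label in \<open>A\<close>, and \<open>\<alpha> a\<close> points have the
  label \<open>a\<close>. Summing the tensors \<open>\<Prod>i. \<phi> (g i) (z i)\<close> over all of them gives a symmetric
  function; up to a factor these are the permanents with repeated rows.
\<close>

definition arrangements :: "nat set \<Rightarrow> nat \<Rightarrow> (nat \<Rightarrow> nat) \<Rightarrow> (nat \<Rightarrow> nat) set" where
  "arrangements A l \<alpha> = {g \<in> {..<l} \<rightarrow>\<^sub>E A. \<forall>a\<in>A. card {i\<in>{..<l}. g i = a} = \<alpha> a}"

lemma finite_arrangements: "finite A \<Longrightarrow> finite (arrangements A l \<alpha>)"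
  unfolding arrangements_def by (rule finite_subset[of _ "{..<l} \<rightarrow>\<^sub>E A"]) (auto intro: finite_PiE)

lemma fibre_card_upd:
  "card {i\<in>{..<Suc l}. (f(l := b)) i = a} = card {i\<in>{..<l}. f i = a} + (if a = b then 1 else 0)"
proof -
  have "{i\<in>{..<Suc l}. (f(l := b)) i = a} = {i\<in>{..<l}. f i = a} \<union> (if a = b then {l} else {})"
    by (auto simp: less_Suc_eq)
  thus ?thesis by auto
qed

text \<open>
  Splitting off the label of the last point. The multinomial count and the one-point
  marginals of the occupation densities both rest on this recursion.
\<close>

lemma sum_arrangements_Suc:
  assumes A: "finite A"
  shows "(\<Sum>g\<in>arrangements A (Suc l) \<alpha>. h g) =
    (\<Sum>a | a \<in> A \<and> 0 < \<alpha> a. \<Sum>f\<in>arrangements A l (\<alpha>(a := \<alpha> a - 1)). h (f(l := a)))"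
proof -
  have fin: "finite {a. a \<in> A \<and> 0 < \<alpha> a}" using A by auto
  have *: "(restrict g {..<l})(l := g l) = g" if "g \<in> {..<Suc l} \<rightarrow>\<^sub>E A" for g
    using that by (fastforce simp: PiE_iff restrict_def extensional_def)
  have **: "f(l := a) \<in> {..<Suc l} \<rightarrow>\<^sub>E A" if "f \<in> {..<l} \<rightarrow>\<^sub>E A" "a \<in> A" for f a
    using that by (auto simp: PiE_iff extensional_def)
  have r: "restrict (f(l := a)) {..<l} = f" if "f \<in> {..<l} \<rightarrow>\<^sub>E A" for f a
    using that by (fastforce simp: PiE_iff extensional_def restrict_def)
  have c: "card {i\<in>{..<l}. restrict g {..<l} i = a} + (if a = g l then 1 else 0) = \<alpha> a"
    if "g \<in> arrangements A (Suc l) \<alpha>" "a \<in> A" for g a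
  proof -
    have "card {i\<in>{..<Suc l}. g i = a} = \<alpha> a" "g \<in> {..<Suc l} \<rightarrow>\<^sub>E A"
      using that by (auto simp: arrangements_def)
    with fibre_card_upd[of l "restrict g {..<l}" "g l" a, unfolded *[OF this(2)]]
    show ?thesis by (simp only:)
  qed
  have "(\<Sum>a | a \<in> A \<and> 0 < \<alpha> a. \<Sum>f\<in>arrangements A l (\<alpha>(a := \<alpha> a - 1)). h (f(l := a))) =
    (\<Sum>(a,f)\<in>(SIGMA a:{a. a \<in> A \<and> 0 < \<alpha> a}. arrangements A l (\<alpha>(a := \<alpha> a - 1))). h (f(l := a)))"
    by (rule sum.Sigma) (auto simp: fin A finite_arrangements)
  also have "\<dots> = (\<Sum>g\<in>arrangements A (Suc l) \<alpha>. h g)"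
  proof (rule sum.reindex_bij_witness[of _ "\<lambda>g. (g l, restrict g {..<l})" "\<lambda>(a,f). f(l := a)"], goal_cases)
    case (1 p) then show ?case by (auto simp: arrangements_def r)
  next
    case (2 p)
    obtain a f where p: "p = (a, f)" by (cases p)
    have a: "a \<in> A" "0 < \<alpha> a" and f: "f \<in> {..<l} \<rightarrow>\<^sub>E A"
      and fc: "\<And>b. b \<in> A \<Longrightarrow> card {i\<in>{..<l}. f i = b} = (\<alpha>(a := \<alpha> a - 1)) b"
      using 2 by (auto simp: p arrangements_def)
    have "\<forall>b\<in>A. card {i\<in>{..<Suc l}. (f(l := a)) i = b} = \<alpha> b"
    proof
      fix b assume "b \<in> A"
      thus "card {i\<in>{..<Suc l}. (f(l := a)) i = b} = \<alpha> b"
        unfolding fibre_card_upd using fc[of b] a by auto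
    qed
    thus ?case using **[OF f a(1)] by (simp add: p arrangements_def del: mem_Collect_eq fun_upd_apply) simp
  next
    case (3 g)
    hence "g \<in> {..<Suc l} \<rightarrow>\<^sub>E A" by (auto simp: arrangements_def)
    from *[OF this] show ?case by (simp only: prod.case)
  next
    case (4 g)
    have "g l \<in> A" "restrict g {..<l} \<in> {..<l} \<rightarrow>\<^sub>E A" using 4 by (auto simp: arrangements_def PiE_iff)
    moreover have "0 < \<alpha> (g l)" using c[OF 4 \<open>g l \<in> A\<close>] by simp
    moreover have "card {i\<in>{..<l}. restrict g {..<l} i = b} = (\<alpha>(g l := \<alpha> (g l) - 1)) b" if "b \<in> A" for b
      using c[OF 4 that] by (cases "b = g l") (auto simp only: fun_upd_same fun_upd_other split: if_splits)
    ultimately show ?case unfolding arrangements_def by blast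
  qed auto
  finally show ?thesis ..
qed

lemma prod_fact_decrement:
  assumes "finite A" "a \<in> A" "0 < \<alpha> a"
  shows "(\<Prod>b\<in>A. fact (\<alpha> b)) = \<alpha> a * (\<Prod>b\<in>A. fact ((\<alpha>(a := \<alpha> a - 1)) b) :: nat)"
proof -
  have "(\<Prod>b\<in>A. fact (\<alpha> b) :: nat) = fact (\<alpha> a) * (\<Prod>b\<in>A-{a}. fact (\<alpha> b))"
    using assms by (simp add: prod.remove)
  also have "(fact (\<alpha> a) :: nat) = \<alpha> a * fact (\<alpha> a - 1)" using assms by (simp add: fact_reduce)
  also have "(\<Prod>b\<in>A-{a}. fact (\<alpha> b) :: nat) = (\<Prod>b\<in>A-{a}. fact ((\<alpha>(a := \<alpha> a - 1)) b))"
    by (intro prod.cong) auto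
  finally show ?thesis using assms by (simp add: prod.remove[where x=a])
qed

lemma sum_decrement:
  fixes \<alpha> :: "'b \<Rightarrow> nat"
  assumes "finite A" "a \<in> A" "0 < \<alpha> a"
  shows "(\<Sum>b\<in>A. (\<alpha>(a := \<alpha> a - 1)) b) = (\<Sum>b\<in>A. \<alpha> b) - 1"
proof -
  have "(\<Sum>b\<in>A. (\<alpha>(a := \<alpha> a - 1)) b) = \<alpha> a - 1 + (\<Sum>b\<in>A-{a}. \<alpha> b)"
    using assms by (simp add: sum.remove[where x=a])
  moreover have "(\<Sum>b\<in>A. \<alpha> b) = \<alpha> a + (\<Sum>b\<in>A-{a}. \<alpha> b)"
    using assms by (simp add: sum.remove[where x=a])
  ultimately show ?thesis using assms by simp
qed

text \<open>
  The multinomial coefficient, multiplied out to avoid division.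
\<close>

lemma card_arrangements:
  assumes A: "finite A"
  shows "(\<Sum>a\<in>A. \<alpha> a) = l \<Longrightarrow> card (arrangements A l \<alpha>) * (\<Prod>a\<in>A. fact (\<alpha> a)) = (fact l :: nat)"
proof (induction l arbitrary: \<alpha>)
  case 0
  hence "\<forall>a\<in>A. \<alpha> a = 0" using A by auto
  moreover from this have "arrangements A 0 \<alpha> = {\<lambda>_. undefined}" by (auto simp: arrangements_def)
  ultimately show ?case by simp
next
  case (Suc l)
  have "card (arrangements A (Suc l) \<alpha>) * (\<Prod>a\<in>A. fact (\<alpha> a)) =
     (\<Sum>a | a \<in> A \<and> 0 < \<alpha> a. card (arrangements A l (\<alpha>(a := \<alpha> a - 1)))) * (\<Prod>b\<in>A. fact (\<alpha> b))"
    using sum_arrangements_Suc[OF A, of "\<lambda>_. 1::nat" l \<alpha>] by simp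
  also have "\<dots> = (\<Sum>a | a \<in> A \<and> 0 < \<alpha> a. \<alpha> a * fact l)"
    unfolding sum_distrib_right
  proof (intro sum.cong refl)
    fix a assume "a \<in> {a. a \<in> A \<and> 0 < \<alpha> a}"
    hence a: "a \<in> A" "0 < \<alpha> a" by auto
    show "card (arrangements A l (\<alpha>(a := \<alpha> a - 1))) * (\<Prod>b\<in>A. fact (\<alpha> b)) = \<alpha> a * fact l"
      unfolding prod_fact_decrement[of A a \<alpha>, OF A a]
      using Suc.IH[of "\<alpha>(a := \<alpha> a - 1)"] sum_decrement[of A a \<alpha>, OF A a] Suc.prems diff_Suc_1 by (metis mult.left_commute)
  qed
  also have "\<dots> = (\<Sum>a\<in>A. \<alpha> a) * fact l"
    unfolding sum_distrib_right by (rule sum.mono_neutral_left) (auto simp: A)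
  finally show ?case using Suc.prems by simp
qed

lemma sum_fibre_card:
  assumes "finite A" "g \<in> {..<l} \<rightarrow>\<^sub>E A"
  shows "(\<Sum>a\<in>A. card {i\<in>{..<l}. g i = a}) = l"
proof -
  have "l = (\<Sum>i\<in>{..<l}. 1)" by simp
  also have "\<dots> = (\<Sum>a\<in>A. \<Sum>i | i \<in> {..<l} \<and> g i = a. 1)"
    by (rule sum.group[symmetric]) (use assms in \<open>auto simp: PiE_iff\<close>)
  finally show ?thesis by simp
qed

lemma arrangements_permute:
  assumes "g \<in> arrangements A l \<alpha>" "\<pi> permutes {..<l}"
  shows "g \<circ> \<pi> \<in> arrangements A l \<alpha>"
proof -
  have g: "g \<in> {..<l} \<rightarrow>\<^sub>E A" using assms by (auto simp: arrangements_def)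
  have 1: "g \<circ> \<pi> \<in> {..<l} \<rightarrow>\<^sub>E A"
    using g permutes_in_image[OF assms(2)] permutes_not_in[OF assms(2)]
    by (auto simp: PiE_iff extensional_def)
  have "card {i\<in>{..<l}. (g \<circ> \<pi>) i = a} = card {i\<in>{..<l}. g i = a}" for a
  proof (rule bij_betw_same_card[of \<pi>], rule bij_betwI[of _ _ _ "inv \<pi>"])
    show "\<pi> \<in> {i \<in> {..<l}. (g \<circ> \<pi>) i = a} \<rightarrow> {i \<in> {..<l}. g i = a}"
      using permutes_in_image[OF assms(2)] by auto
    show "inv \<pi> \<in> {i \<in> {..<l}. g i = a} \<rightarrow> {i \<in> {..<l}. (g \<circ> \<pi>) i = a}"
      using permutes_in_image[OF permutes_inv[OF assms(2)]] permutes_inverses[OF assms(2)] by auto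
  qed (simp_all add: permutes_inverses[OF assms(2)])
  with 1 assms(1) show ?thesis by (auto simp: arrangements_def)
qed

lemma arrangements_transitive:
  assumes "g \<in> arrangements A l \<alpha>" "f \<in> arrangements A l \<alpha>"
  obtains p where "p permutes {..<l}" "g \<circ> p = f"
proof -
  have "image_mset f (mset_set {..<l}) = image_mset g (mset_set {..<l})"
  proof (rule multiset_eqI)
    fix a
    have "count (image_mset h (mset_set {..<l})) a = card {i\<in>{..<l}. h i = a}" for h :: "nat \<Rightarrow> nat"
      by (simp add: count_image_mset Int_def vimage_def conj_commute)
    moreover have "card {i\<in>{..<l}. f i = a} = card {i\<in>{..<l}. g i = a}"
    proof (cases "a \<in> A")
      case False
      hence "{i\<in>{..<l}. f i = a} = {}" "{i\<in>{..<l}. g i = a} = {}"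
        using assms by (auto simp: arrangements_def PiE_iff)
      thus ?thesis by (simp only:)
    qed (use assms in \<open>auto simp: arrangements_def\<close>)
    ultimately show "count (image_mset f (mset_set {..<l})) a = count (image_mset g (mset_set {..<l})) a"
      by simp
  qed
  from image_mset_eq_implies_permutes[OF finite_lessThan this]
  obtain p where p: "p permutes {..<l}" "\<forall>x\<in>{..<l}. f x = g (p x)" by auto
  have "g \<circ> p = f"
  proof
    fix x
    show "(g \<circ> p) x = f x"
      using p permutes_not_in[OF p(1)] assms
      by (cases "x < l") (auto simp: arrangements_def PiE_iff extensional_def)
  qed
  with p that show ?thesis by blast
qed

text \<open>
  Permutations of the points act transitively on the labellings with given multiplicities,
  so these sets are cosets of the stabiliser of \<open>g\<close> and have the same size for every \<open>f\<close>.
  Together they exhaust the \<open>l!\<close> permutations, so the multinomial count gives the size.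
\<close>

lemma card_permutations_to:
  assumes A: "finite A" and g: "g \<in> arrangements A l \<alpha>" and f: "f \<in> arrangements A l \<alpha>"
  shows "card {\<pi>. \<pi> permutes {..<l} \<and> g \<circ> \<pi> = f} = (\<Prod>a\<in>A. fact (\<alpha> a))"
proof -
  define s where "s = card {\<pi>. \<pi> permutes {..<l} \<and> g \<circ> \<pi> = g}"
  have const: "card {\<pi>. \<pi> permutes {..<l} \<and> g \<circ> \<pi> = f} = s" if f: "f \<in> arrangements A l \<alpha>" for f
  proof -
    obtain p where p: "p permutes {..<l}" "g \<circ> p = f" using arrangements_transitive[OF g f] .
    have inv: "p \<circ> inv p = id" "inv p \<circ> p = id" using permutes_inv_o[OF p(1)] by auto
    show ?thesis unfolding s_def
    proof (rule bij_betw_same_card[of "\<lambda>\<sigma>. \<sigma> \<circ> inv p"], rule bij_betwI[of _ _ _ "\<lambda>\<sigma>. \<sigma> \<circ> p"])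
      have "(g \<circ> p) \<circ> inv p = g" using inv by (simp add: o_assoc[symmetric])
      thus "(\<lambda>\<sigma>. \<sigma> \<circ> inv p) \<in> {\<pi>. \<pi> permutes {..<l} \<and> g \<circ> \<pi> = f} \<rightarrow> {\<pi>. \<pi> permutes {..<l} \<and> g \<circ> \<pi> = g}"
        using p by (auto intro!: permutes_compose permutes_inv simp: o_assoc)
      show "(\<lambda>\<sigma>. \<sigma> \<circ> p) \<in> {\<pi>. \<pi> permutes {..<l} \<and> g \<circ> \<pi> = g} \<rightarrow> {\<pi>. \<pi> permutes {..<l} \<and> g \<circ> \<pi> = f}"
        using p by (auto intro!: permutes_compose simp: o_assoc)
    qed (simp_all add: o_assoc[symmetric] inv)
  qed
  have fl: "(\<Sum>a\<in>A. \<alpha> a) = l"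
    using g sum_fibre_card[OF A, of g l] by (auto simp: arrangements_def)
  have "fact l = (\<Sum>\<pi> | \<pi> permutes {..<l}. 1::nat)" by (simp add: card_permutations[of "{..<l}" l])
  also have "\<dots> = (\<Sum>f\<in>arrangements A l \<alpha>. \<Sum>\<pi> | \<pi> \<in> {\<pi>. \<pi> permutes {..<l}} \<and> g \<circ> \<pi> = f. 1)"
    by (rule sum.group[symmetric])
       (auto simp: finite_permutations finite_arrangements A intro!: arrangements_permute g)
  also have "\<dots> = card (arrangements A l \<alpha>) * s" by (simp add: const)
  finally have "card (arrangements A l \<alpha>) * s = card (arrangements A l \<alpha>) * (\<Prod>a\<in>A. fact (\<alpha> a))"
    using card_arrangements[OF A fl] by (simp only:)
  moreover have "card (arrangements A l \<alpha>) \<noteq> 0" using g finite_arrangements[OF A] by auto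
  ultimately show ?thesis using const[OF f] by simp
qed

section \<open>Permanents with repeated rows\<close>

lemma per_alt: "per k M = (\<Sum>\<pi> | \<pi> permutes {..<k}. \<Prod>j<k. M (\<pi> j) j)"
proof -
  have "per k M = (\<Sum>\<pi> | \<pi> permutes {..<k}. \<Prod>i<k. M i (inv \<pi> i))"
    unfolding per_def by (rule sum_permutations_inverse)
  also have "\<dots> = (\<Sum>\<pi> | \<pi> permutes {..<k}. \<Prod>j<k. M (\<pi> j) j)"
  proof (intro sum.cong refl)
    fix \<pi> assume "\<pi> \<in> {\<pi>. \<pi> permutes {..<k}}"
    hence p: "\<pi> permutes {..<k}" by simp
    show "(\<Prod>i<k. M i (inv \<pi> i)) = (\<Prod>j<k. M (\<pi> j) j)"
      using prod.permute[OF p, of "\<lambda>i. M i (inv \<pi> i)"] permutes_inverses[OF p] by (simp add: o_def)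
  qed
  finally show ?thesis .
qed

lemma per_cong: "(\<And>i j. i < k \<Longrightarrow> j < k \<Longrightarrow> M i j = N i j) \<Longrightarrow> per k M = per k N"
  unfolding per_alt by (intro sum.cong prod.cong refl) (auto dest: permutes_in_image)

text \<open>
  The sum over permutations runs through the orbit of \<open>g\<close>, and it meets each labelling as
  often as the stabiliser is large.
\<close>

lemma per_arrangement:
  assumes A: "finite A" and g: "g \<in> arrangements A l \<alpha>"
  shows "per l (\<lambda>i j. M (g i) j) =
    of_nat (\<Prod>a\<in>A. fact (\<alpha> a)) * (\<Sum>f\<in>arrangements A l \<alpha>. \<Prod>i<l. M (f i) i)"
proof -
  have "per l (\<lambda>i j. M (g i) j) = (\<Sum>\<pi> | \<pi> permutes {..<l}. \<Prod>j<l. M ((g \<circ> \<pi>) j) j)"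
    by (simp add: per_alt)
  also have "\<dots> = (\<Sum>f\<in>arrangements A l \<alpha>. \<Sum>\<pi> | \<pi> \<in> {\<pi>. \<pi> permutes {..<l}} \<and> g \<circ> \<pi> = f. \<Prod>j<l. M ((g \<circ> \<pi>) j) j)"
    by (rule sum.group[symmetric])
       (auto simp: finite_permutations finite_arrangements A intro!: arrangements_permute g)
  also have "\<dots> = (\<Sum>f\<in>arrangements A l \<alpha>. of_nat (card {\<pi>. \<pi> permutes {..<l} \<and> g \<circ> \<pi> = f}) * (\<Prod>j<l. M (f j) j))"
  proof (intro sum.cong refl, goal_cases)
    case (1 f)
    have "(\<Sum>\<pi> | \<pi> \<in> {\<pi>. \<pi> permutes {..<l}} \<and> g \<circ> \<pi> = f. \<Prod>j<l. M ((g \<circ> \<pi>) j) j) =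
       (\<Sum>\<pi> | \<pi> \<in> {\<pi>. \<pi> permutes {..<l}} \<and> g \<circ> \<pi> = f. \<Prod>j<l. M (f j) j)"
      by (intro sum.cong refl) auto
    thus ?case by simp
  qed
  also have "\<dots> = (\<Sum>f\<in>arrangements A l \<alpha>. of_nat (\<Prod>a\<in>A. fact (\<alpha> a)) * (\<Prod>j<l. M (f j) j))"
    by (intro sum.cong refl) (simp only: card_permutations_to[OF A g])
  finally show ?thesis by (simp add: sum_distrib_left)
qed

definition occupation_sum :: "(nat \<Rightarrow> 'a \<Rightarrow> complex) \<Rightarrow> nat set \<Rightarrow> nat \<Rightarrow> (nat \<Rightarrow> nat) \<Rightarrow> (nat \<Rightarrow> 'a) \<Rightarrow> complex" where
  "occupation_sum \<phi> A l \<alpha> z = (\<Sum>f\<in>arrangements A l \<alpha>. \<Prod>i<l. \<phi> (f i) (z i))"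

lemma row_labels_arrangement:
  assumes fin: "finite (supp I \<alpha>)"
  shows "restrict (\<lambda>i. row_labels I \<alpha> ! i) {..<total I \<alpha>} \<in> arrangements (supp I \<alpha>) (total I \<alpha>) \<alpha>"
proof -
  define xs where "xs = sorted_list_of_set (supp I \<alpha>)"
  have xs: "distinct xs" "set xs = supp I \<alpha>" using fin by (auto simp: xs_def)
  have len: "length (row_labels I \<alpha>) = total I \<alpha>"
    using xs unfolding row_labels_def xs_def[symmetric]
    by (simp add: length_concat o_def total_def sum_list_distinct_conv_sum_set)
  have set: "set (row_labels I \<alpha>) \<subseteq> supp I \<alpha>" using fin by (auto simp: row_labels_def)
  have cnt: "count_list (concat (map (\<lambda>k. replicate (\<alpha> k) k) ys)) a = (if a \<in> set ys then \<alpha> a else 0)"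
    if "distinct ys" for ys a
  proof -
    have "count_list (replicate m b) a = (if a = b then m else 0)" for m b
      by (induction m) auto
    thus ?thesis using that by (induction ys) (auto simp: count_list_append)
  qed
  have "card {i. i < total I \<alpha> \<and> row_labels I \<alpha> ! i = a} = \<alpha> a" if "a \<in> supp I \<alpha>" for a
    using cnt[OF xs(1), of a] that xs unfolding xs_def row_labels_def[symmetric]
    by (simp add: count_list_eq_length_filter length_filter_conv_card len eq_commute)
  moreover have "{i \<in> {..<total I \<alpha>}. restrict (\<lambda>i. row_labels I \<alpha> ! i) {..<total I \<alpha>} i = a}
       = {i. i < total I \<alpha> \<and> row_labels I \<alpha> ! i = a}" for a by auto
  ultimately show ?thesis using set len
    by (auto simp: arrangements_def PiE_iff simp del: restrict_apply) (auto dest: nth_mem)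
qed

text \<open>
  The permanent contributes the square of \<open>\<Prod>k. \<alpha> k!\<close>, of which the normalisation
  cancels one factor.
\<close>

lemma occupation_density_eq:
  assumes fin: "finite (supp I \<alpha>)"
  shows "occupation_density I \<phi> \<alpha> z = (\<Prod>k\<in>supp I \<alpha>. fact (\<alpha> k)) / fact (total I \<alpha>) *
     (cmod (occupation_sum \<phi> (supp I \<alpha>) (total I \<alpha>) \<alpha> z))\<^sup>2"
proof -
  let ?c = "(\<Prod>k\<in>supp I \<alpha>. fact (\<alpha> k)) :: real"
  have "per (total I \<alpha>) (occupation_matrix I \<phi> \<alpha> z)
     = per (total I \<alpha>) (\<lambda>i j. \<phi> (restrict (\<lambda>i. row_labels I \<alpha> ! i) {..<total I \<alpha>} i) (z j))"
    by (rule per_cong) (auto simp: occupation_matrix_def)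
  also have "\<dots> = of_nat (\<Prod>k\<in>supp I \<alpha>. fact (\<alpha> k)) * occupation_sum \<phi> (supp I \<alpha>) (total I \<alpha>) \<alpha> z"
    unfolding occupation_sum_def
    using per_arrangement[OF fin row_labels_arrangement[OF fin], of "\<lambda>a j. \<phi> a (z j)"] by simp
  finally have "cmod (per (total I \<alpha>) (occupation_matrix I \<phi> \<alpha> z)) = 
     ?c * cmod (occupation_sum \<phi> (supp I \<alpha>) (total I \<alpha>) \<alpha> z)"
    by (simp add: norm_mult prod_norm[symmetric])
  moreover have "?c \<noteq> 0" using fin by simp
  ultimately show ?thesis
    by (simp add: occupation_density_def power_mult_distrib power2_eq_square)
qed

section \<open>Marginals of occupation densities\<close>

definition cylinder :: "nat \<Rightarrow> (nat \<Rightarrow> 'a set) \<Rightarrow> (nat \<Rightarrow> 'a) \<Rightarrow> ennreal" where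
  "cylinder k B z = (\<Prod>j<k. indicator (B j) (z j))"

lemma cylinder_eq_if: "cylinder k B z = (if \<forall>j<k. z j \<in> B j then 1 else 0)"
  unfolding cylinder_def by (induction k) (auto simp: less_Suc_eq indicator_def)

lemma norm_mult_le_sum_squares: "norm u * norm v \<le> (norm u)\<^sup>2 + (norm v)\<^sup>2"
  using sum_squares_bound[of "norm u" "norm v"] mult_nonneg_nonneg[OF norm_ge_zero norm_ge_zero, of u v]
  unfolding mult.assoc by linarith

locale orthonormal_family = sigma_finite_measure \<mu> for \<mu> :: "'a measure" +
  fixes I :: "nat set" and \<phi> :: "nat \<Rightarrow> 'a \<Rightarrow> complex"
  assumes orthonormal: "orthonormal_L2 \<mu> I \<phi>"
begin

sublocale product_sigma_finite "\<lambda>_::nat. \<mu>"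
  by (rule product_sigma_finite.intro) (rule sigma_finite_measure_axioms)

lemma phi_measurable: "k \<in> I \<Longrightarrow> \<phi> k \<in> borel_measurable \<mu>"
  using orthonormal by (auto simp: orthonormal_L2_def)

lemma phi_square_integrable: "k \<in> I \<Longrightarrow> integrable \<mu> (\<lambda>x. (cmod (\<phi> k x))\<^sup>2)"
  using orthonormal by (auto simp: orthonormal_L2_def)

lemma phi_mult_integrable:
  assumes "i \<in> I" "j \<in> I"
  shows "integrable \<mu> (\<lambda>x. \<phi> i x * cnj (\<phi> j x))"
proof (rule Bochner_Integration.integrable_bound)
  show "integrable \<mu> (\<lambda>x. (cmod (\<phi> i x))\<^sup>2 + (cmod (\<phi> j x))\<^sup>2)"
    using assms by (intro Bochner_Integration.integrable_add phi_square_integrable)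
  show "(\<lambda>x. \<phi> i x * cnj (\<phi> j x)) \<in> borel_measurable \<mu>"
    using assms[THEN phi_measurable]
    by (intro borel_measurable_times borel_measurable_continuous_on[of cnj]) (auto intro: continuous_intros)
  show "AE x in \<mu>. norm (\<phi> i x * cnj (\<phi> j x)) \<le> norm ((cmod (\<phi> i x))\<^sup>2 + (cmod (\<phi> j x))\<^sup>2)"
    using norm_mult_le_sum_squares[of "\<phi> i _" "\<phi> j _"] by (simp add: norm_mult)
qed

text \<open>
  Pythagoras, as a statement about nonnegative integrals.
\<close>

lemma nn_integral_square_sum:
  assumes A: "finite A" "A \<subseteq> I"
  shows "(\<integral>\<^sup>+y. ennreal ((cmod (\<Sum>a\<in>A. c a * \<phi> a y))\<^sup>2) \<partial>\<mu>) = (\<Sum>a\<in>A. ennreal ((cmod (c a))\<^sup>2))"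
proof -
  have expand: "complex_of_real ((cmod (\<Sum>a\<in>A. c a * \<phi> a y))\<^sup>2)
      = (\<Sum>a\<in>A. \<Sum>b\<in>A. (c a * cnj (c b)) * (\<phi> a y * cnj (\<phi> b y)))" for y
    unfolding complex_norm_square by (simp add: cnj_sum sum_product mult_ac)
  have int: "has_bochner_integral \<mu> (\<lambda>y. (c a * cnj (c b)) * (\<phi> a y * cnj (\<phi> b y)))
      ((c a * cnj (c b)) * (if a = b then 1 else 0))" if "a \<in> A" "b \<in> A" for a b
    using that A orthonormal
    by (intro has_bochner_integral_mult_right)
       (auto simp: has_bochner_integral_iff phi_mult_integrable subset_iff orthonormal_L2_def)
  have "has_bochner_integral \<mu> (\<lambda>y. complex_of_real ((cmod (\<Sum>a\<in>A. c a * \<phi> a y))\<^sup>2))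
     (\<Sum>a\<in>A. \<Sum>b\<in>A. (c a * cnj (c b)) * (if a = b then 1 else 0))"
    unfolding expand by (intro has_bochner_integral_sum int)
  also have "(\<Sum>a\<in>A. \<Sum>b\<in>A. (c a * cnj (c b)) * (if a = b then 1 else 0)) =
     complex_of_real (\<Sum>a\<in>A. (cmod (c a))\<^sup>2)"
    using A(1) by (simp add: complex_norm_square[symmetric] if_distrib[of "\<lambda>x. _ * x"] sum.delta cong: if_cong)
  finally have h: "has_bochner_integral \<mu> (\<lambda>y. complex_of_real ((cmod (\<Sum>a\<in>A. c a * \<phi> a y))\<^sup>2))
     (complex_of_real (\<Sum>a\<in>A. (cmod (c a))\<^sup>2))" .
  have "has_bochner_integral \<mu> (\<lambda>y. (cmod (\<Sum>a\<in>A. c a * \<phi> a y))\<^sup>2) (\<Sum>a\<in>A. (cmod (c a))\<^sup>2)"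
    using has_bochner_integral_Re[OF h] by (simp only: Re_complex_of_real)
  hence "(\<integral>\<^sup>+y. ennreal ((cmod (\<Sum>a\<in>A. c a * \<phi> a y))\<^sup>2) \<partial>\<mu>) = ennreal (\<Sum>a\<in>A. (cmod (c a))\<^sup>2)"
    by (subst nn_integral_eq_integral) (auto simp: has_bochner_integral_iff)
  thus ?thesis by (simp add: sum_nonneg)
qed

lemma measurable_phi_component:
  "a \<in> I \<Longrightarrow> i \<in> J \<Longrightarrow> (\<lambda>z. \<phi> a (z i)) \<in> borel_measurable (Pi\<^sub>M J (\<lambda>_. \<mu>))"
  by (rule measurable_compose[of "\<lambda>z. z i" _ \<mu>, OF measurable_component_singleton phi_measurable])

lemma occupation_sum_measurable:
  assumes "A \<subseteq> I" "{..<l} \<subseteq> J"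
  shows "occupation_sum \<phi> A l \<alpha> \<in> borel_measurable (Pi\<^sub>M J (\<lambda>_. \<mu>))"
  unfolding occupation_sum_def[abs_def] using assms
  by (intro borel_measurable_sum borel_measurable_prod measurable_phi_component)
     (auto simp: arrangements_def PiE_iff)

lemma occupation_sum_Suc:
  assumes "finite A"
  shows "occupation_sum \<phi> A (Suc l) \<alpha> (z(l := y)) =
    (\<Sum>a | a \<in> A \<and> 0 < \<alpha> a. occupation_sum \<phi> A l (\<alpha>(a := \<alpha> a - 1)) z * \<phi> a y)"
  unfolding occupation_sum_def sum_arrangements_Suc[OF assms]
  by (simp add: sum_distrib_right)

text \<open>
  Integrating out one point removes one particle: different labels of the last point do not
  interfere, because their eigenfunctions are orthogonal.
\<close>

lemma nn_integral_occupation_sum_last: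
  assumes "finite A" "A \<subseteq> I"
  shows "(\<integral>\<^sup>+y. ennreal ((cmod (occupation_sum \<phi> A (Suc l) \<alpha> (z(l := y))))\<^sup>2) \<partial>\<mu>) =
    (\<Sum>a | a \<in> A \<and> 0 < \<alpha> a. ennreal ((cmod (occupation_sum \<phi> A l (\<alpha>(a := \<alpha> a - 1)) z))\<^sup>2))"
  unfolding occupation_sum_Suc[OF assms(1)]
  by (rule nn_integral_square_sum) (use assms in auto)

definition amplitude :: "nat \<Rightarrow> (nat \<Rightarrow> nat) \<Rightarrow> (nat \<Rightarrow> 'a) \<Rightarrow> complex" where
  "amplitude k g x = per k (\<lambda>i j. \<phi> (g i) (x j))"

lemma amplitude_arrangement:
  assumes "finite A" "g \<in> arrangements A k \<alpha>"
  shows "amplitude k g x = of_nat (\<Prod>a\<in>A. fact (\<alpha> a)) * occupation_sum \<phi> A k \<alpha> x"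
  unfolding amplitude_def occupation_sum_def
  using per_arrangement[OF assms, of "\<lambda>a j. \<phi> a (x j)"] .

lemma amplitude_measurable:
  assumes "g \<in> {..<k} \<rightarrow> I" "{..<k} \<subseteq> J"
  shows "amplitude k g \<in> borel_measurable (Pi\<^sub>M J (\<lambda>_. \<mu>))"
  unfolding amplitude_def[abs_def] per_def using assms
  by (intro borel_measurable_sum borel_measurable_prod measurable_phi_component)
     (auto dest: permutes_in_image)

lemma cylinder_measurable:
  assumes "\<And>j. j < k \<Longrightarrow> B j \<in> sets \<mu>" "{..<k} \<subseteq> J"
  shows "cylinder k B \<in> borel_measurable (Pi\<^sub>M J (\<lambda>_. \<mu>))"
  unfolding cylinder_def[abs_def] using assms
  by (intro borel_measurable_prod_ennreal
    measurable_compose[OF measurable_component_singleton borel_measurable_indicator]) auto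

text \<open>
  Up to a factor \<open>1/k!\<close>, all factorial moments below are combinations of these weights
  with nonnegative coefficients: the coefficients are \<open>sub_choose\<close> for fixed occupation numbers and products
  of eigenvalues for the permanental process.
\<close>

definition box_weight :: "nat \<Rightarrow> (nat \<Rightarrow> 'a set) \<Rightarrow> (nat \<Rightarrow> nat) \<Rightarrow> ennreal" where
  "box_weight k B g = (\<integral>\<^sup>+x. ennreal ((cmod (amplitude k g x))\<^sup>2) * cylinder k B x \<partial>Pi\<^sub>M {..<k} (\<lambda>_. \<mu>))"

end

text \<open>
  The number of ways to select, from a population with \<open>\<alpha> a\<close> particles of each label \<open>a\<close>, a
  subset in which the labels occur as often as in \<open>g\<close>.
\<close>

definition sub_choose :: "nat set \<Rightarrow> nat \<Rightarrow> (nat \<Rightarrow> nat) \<Rightarrow> (nat \<Rightarrow> nat) \<Rightarrow> nat" where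
  "sub_choose A k \<alpha> g = (\<Prod>a\<in>A. \<alpha> a choose card {i\<in>{..<k}. g i = a})"

text \<open>
  Double counting of pairs of a selected subset and a particle outside it: either the particle
  is removed first, or it is chosen among the \<open>l - k\<close> particles left over.
\<close>

lemma sub_choose_remove_point:
  assumes A: "finite A" and g: "g \<in> {..<k} \<rightarrow>\<^sub>E A" and l: "(\<Sum>a\<in>A. \<alpha> a) = l"
  shows "(\<Sum>a | a \<in> A \<and> 0 < \<alpha> a. \<alpha> a * sub_choose A k (\<alpha>(a := \<alpha> a - 1)) g) = (l - k) * sub_choose A k \<alpha> g"
proof -
  let ?n = "\<lambda>a. card {i\<in>{..<k}. g i = a}"
  have "(\<Sum>a | a \<in> A \<and> 0 < \<alpha> a. \<alpha> a * sub_choose A k (\<alpha>(a := \<alpha> a - 1)) g) =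
    (\<Sum>a\<in>A. \<alpha> a * sub_choose A k (\<alpha>(a := \<alpha> a - 1)) g)"
    by (rule sum.mono_neutral_left) (auto simp: A)
  also have "\<dots> = (\<Sum>a\<in>A. (\<alpha> a - ?n a) * sub_choose A k \<alpha> g)"
  proof (intro sum.cong refl)
    fix a assume a: "a \<in> A"
    let ?R = "\<Prod>b\<in>A-{a}. \<alpha> b choose ?n b"
    have "sub_choose A k (\<alpha>(a := \<alpha> a - 1)) g = (\<alpha> a - 1 choose ?n a) * ?R"
      unfolding sub_choose_def using A a by (simp add: prod.remove[where x=a])
    moreover have "sub_choose A k \<alpha> g = (\<alpha> a choose ?n a) * ?R"
      unfolding sub_choose_def using A a by (simp add: prod.remove[where x=a])
    ultimately show "\<alpha> a * sub_choose A k (\<alpha>(a := \<alpha> a - 1)) g = (\<alpha> a - ?n a) * sub_choose A k \<alpha> g"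
      using binomial_absorb_comp[of "\<alpha> a" "?n a"] by (simp only: mult.assoc[symmetric])
  qed
  also have "\<dots> = (l - k) * sub_choose A k \<alpha> g"
  proof (cases "sub_choose A k \<alpha> g = 0")
    case False
    hence le: "?n a \<le> \<alpha> a" if "a \<in> A" for a
      using that A by (auto simp: sub_choose_def binomial_eq_0_iff not_less)
    show ?thesis
      by (simp only: sum_distrib_right[symmetric] sum_subtractf_nat[OF le] l sum_fibre_card[OF A g])
  qed simp
  finally show ?thesis .
qed

lemma sub_choose_full:
  assumes A: "finite A" and g: "g \<in> {..<k} \<rightarrow>\<^sub>E A" and l: "(\<Sum>a\<in>A. \<alpha> a) = k"
  shows "sub_choose A k \<alpha> g = (if g \<in> arrangements A k \<alpha> then 1 else 0)"
proof (cases "sub_choose A k \<alpha> g = 0")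
  case False
  hence le: "card {i\<in>{..<k}. g i = a} \<le> \<alpha> a" if "a \<in> A" for a
    using that A by (auto simp: sub_choose_def binomial_eq_0_iff not_less)
  have "\<forall>a\<in>A. card {i\<in>{..<k}. g i = a} = \<alpha> a"
  proof (rule ccontr)
    assume "\<not> (\<forall>a\<in>A. card {i\<in>{..<k}. g i = a} = \<alpha> a)"
    hence "(\<Sum>a\<in>A. card {i\<in>{..<k}. g i = a}) < (\<Sum>a\<in>A. \<alpha> a)"
      using le A by (intro sum_strict_mono_ex1) (auto intro: le_neq_implies_less)
    thus False using sum_fibre_card[OF A g] l by simp
  qed
  thus ?thesis using g by (auto simp: arrangements_def sub_choose_def)
next
  case True
  have "g \<notin> arrangements A k \<alpha>"
  proof
    assume "g \<in> arrangements A k \<alpha>"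
    hence "sub_choose A k \<alpha> g = 1" by (auto simp: arrangements_def sub_choose_def)
    with True show False by simp
  qed
  with True show ?thesis by simp
qed

context orthonormal_family begin

text \<open>
  The \<open>k\<close>-point marginal for occupation numbers \<open>\<alpha>\<close> is the average of the occupation
  densities of all \<open>k\<close>-element subsets of the particles. The proof integrates out one point
  at a time. If \<open>l = k\<close>, the only labellings with a nonzero coefficient are those with
  multiplicities \<open>\<alpha>\<close>; in the step, removing a particle and then choosing a subset is counted
  by \<open>sub_choose_remove_point\<close>.
\<close>

lemma occupation_marginal:
  assumes A: "finite A" "A \<subseteq> I" and kl: "k \<le> l" and B: "\<And>j. j < k \<Longrightarrow> B j \<in> sets \<mu>"
  shows "(\<Sum>a\<in>A. \<alpha> a) = l \<Longrightarrow>
    of_nat (fact k * (\<Prod>a\<in>A. fact (\<alpha> a))) *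
      (\<integral>\<^sup>+z. ennreal ((cmod (occupation_sum \<phi> A l \<alpha> z))\<^sup>2) * cylinder k B z \<partial>Pi\<^sub>M {..<l} (\<lambda>_. \<mu>)) =
    of_nat (fact (l - k)) * (\<Sum>g\<in>{..<k} \<rightarrow>\<^sub>E A. of_nat (sub_choose A k \<alpha> g) * box_weight k B g)"
  using kl
proof (induction l arbitrary: \<alpha> rule: dec_induct)
  case base
  let ?c = "(\<Prod>a\<in>A. fact (\<alpha> a)) :: nat"
  let ?J = "\<integral>\<^sup>+z. ennreal ((cmod (occupation_sum \<phi> A k \<alpha> z))\<^sup>2) * cylinder k B z \<partial>Pi\<^sub>M {..<k} (\<lambda>_. \<mu>)"
  have w: "box_weight k B g = of_nat (?c * ?c) * ?J" if g: "g \<in> arrangements A k \<alpha>" for g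
  proof -
    have "box_weight k B g = (\<integral>\<^sup>+z. of_nat (?c * ?c) *
        (ennreal ((cmod (occupation_sum \<phi> A k \<alpha> z))\<^sup>2) * cylinder k B z) \<partial>Pi\<^sub>M {..<k} (\<lambda>_. \<mu>))"
      unfolding box_weight_def amplitude_arrangement[OF A(1) g]
      by (intro nn_integral_cong)
         (simp add: norm_mult power_mult_distrib ennreal_mult power2_eq_square ennreal_of_nat_eq_real_of_nat
            mult_ac del: of_nat_prod)
    also have "\<dots> = of_nat (?c * ?c) * ?J"
      using occupation_sum_measurable[OF A(2) order_refl, of k \<alpha>]
        cylinder_measurable[of k B "{..<k}", OF B order_refl]
      by (intro nn_integral_cmult) measurable
  finally show ?thesis .
  qed
  have "(\<Sum>g\<in>{..<k} \<rightarrow>\<^sub>E A. of_nat (sub_choose A k \<alpha> g) * box_weight k B g) =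
    (\<Sum>g\<in>{..<k} \<rightarrow>\<^sub>E A. if g \<in> arrangements A k \<alpha> then box_weight k B g else 0)"
    by (intro sum.cong refl) (simp add: sub_choose_full[OF A(1) _ base.prems])
  also have "\<dots> = (\<Sum>g\<in>arrangements A k \<alpha>. box_weight k B g)"
    using A(1) by (subst sum.If_cases) (auto intro!: finite_PiE sum.cong simp: arrangements_def)
  also have "\<dots> = of_nat (card (arrangements A k \<alpha>)) * (of_nat (?c * ?c) * ?J)"
    by (simp add: w)
  also have "\<dots> = of_nat (card (arrangements A k \<alpha>) * ?c) * (of_nat ?c * ?J)"
    by (simp only: of_nat_mult mult_ac)
  also have "\<dots> = of_nat (fact k * ?c) * ?J"
    unfolding card_arrangements[OF A(1) base.prems] by (simp only: of_nat_mult mult_ac)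
  finally show ?case by simp
next
  case (step l)
  let ?A = "{a. a \<in> A \<and> 0 < \<alpha> a}"
  let ?\<beta> = "\<lambda>a. \<alpha>(a := \<alpha> a - 1)"
  let ?c = "(\<Prod>a\<in>A. fact (\<alpha> a)) :: nat"
  let ?J = "\<lambda>l \<alpha>. \<integral>\<^sup>+z. ennreal ((cmod (occupation_sum \<phi> A l \<alpha> z))\<^sup>2) * cylinder k B z \<partial>Pi\<^sub>M {..<l} (\<lambda>_. \<mu>)"
  have finA: "finite ?A" using A by auto
  have cyl: "cylinder k B \<in> borel_measurable (Pi\<^sub>M J (\<lambda>_. \<mu>))" if "{..<k} \<subseteq> J" for J
    using that B by (rule cylinder_measurable[rotated])
  have kl': "{..<k} \<subseteq> insert l {..<l}" "{..<k} \<subseteq> {..<l}" using step(1) by auto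
  note m = occupation_sum_measurable[OF A(2)] cyl
  have "?J (Suc l) \<alpha> = (\<integral>\<^sup>+z. (\<integral>\<^sup>+y. ennreal ((cmod (occupation_sum \<phi> A (Suc l) \<alpha> (z(l := y))))\<^sup>2) *
      cylinder k B (z(l := y)) \<partial>\<mu>) \<partial>Pi\<^sub>M {..<l} (\<lambda>_. \<mu>))"
    unfolding lessThan_Suc using kl' m(1)[of "Suc l" "insert l {..<l}" \<alpha>] m(2)[where J="insert l {..<l}"] step(1)
    by (intro product_nn_integral_insert) (auto simp: lessThan_Suc intro!: borel_measurable_times_ennreal)
  also have "\<dots> = (\<integral>\<^sup>+z. (\<Sum>a\<in>?A. ennreal ((cmod (occupation_sum \<phi> A l (?\<beta> a) z))\<^sup>2) *
      cylinder k B z) \<partial>Pi\<^sub>M {..<l} (\<lambda>_. \<mu>))"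
  proof (rule nn_integral_cong)
    fix z assume z: "z \<in> space (Pi\<^sub>M {..<l} (\<lambda>_. \<mu>))"
    have b: "cylinder k B (z(l := y)) = cylinder k B z" for y
      unfolding cylinder_def using step(1) by (intro prod.cong) auto
    have "(\<lambda>y. z(l := y)) \<in> measurable \<mu> (Pi\<^sub>M (insert l {..<l}) (\<lambda>_. \<mu>))"
      using z by (intro measurable_component_update) auto
    hence "(\<lambda>y. occupation_sum \<phi> A (Suc l) \<alpha> (z(l := y))) \<in> borel_measurable \<mu>"
      by (rule measurable_compose[OF _ m(1)]) auto
    thus "(\<integral>\<^sup>+y. ennreal ((cmod (occupation_sum \<phi> A (Suc l) \<alpha> (z(l := y))))\<^sup>2) * cylinder k B (z(l := y)) \<partial>\<mu>)
      = (\<Sum>a\<in>?A. ennreal ((cmod (occupation_sum \<phi> A l (?\<beta> a) z))\<^sup>2) * cylinder k B z)"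
      unfolding b sum_distrib_right[symmetric] nn_integral_occupation_sum_last[OF A, symmetric]
      by (intro nn_integral_multc) measurable
  qed
  also have "\<dots> = (\<Sum>a\<in>?A. ?J l (?\<beta> a))"
    using m(1)[of l "{..<l}"] m(2)[where J="{..<l}"] step(1)
    by (intro nn_integral_sum) (auto intro!: borel_measurable_times_ennreal)
  finally have J: "?J (Suc l) \<alpha> = (\<Sum>a\<in>?A. ?J l (?\<beta> a))" .
  have fact_split: "?c = \<alpha> a * (\<Prod>b\<in>A. fact (?\<beta> a b))"
    and total: "(\<Sum>b\<in>A. ?\<beta> a b) = l" if "a \<in> ?A" for a
    using that prod_fact_decrement[OF A(1), of a \<alpha>] sum_decrement[OF A(1), of a \<alpha>] step.prems
    by (simp_all only: mem_Collect_eq diff_Suc_1)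
  have "of_nat (fact k * ?c) * ?J (Suc l) \<alpha> =
    (\<Sum>a\<in>?A. of_nat (\<alpha> a) * (of_nat (fact k * (\<Prod>b\<in>A. fact (?\<beta> a b))) * ?J l (?\<beta> a)))"
    unfolding J sum_distrib_left
  proof (intro sum.cong refl)
    fix a assume a: "a \<in> ?A"
    show "of_nat (fact k * ?c) * ?J l (?\<beta> a) =
      of_nat (\<alpha> a) * (of_nat (fact k * (\<Prod>b\<in>A. fact (?\<beta> a b))) * ?J l (?\<beta> a))"
      unfolding fact_split[OF a] by (simp only: of_nat_mult mult_ac)
  qed
  also have "\<dots> = (\<Sum>a\<in>?A. of_nat (\<alpha> a) * (of_nat (fact (l - k)) *
     (\<Sum>g\<in>{..<k} \<rightarrow>\<^sub>E A. of_nat (sub_choose A k (?\<beta> a) g) * box_weight k B g)))"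
    by (intro sum.cong refl) (simp only: step.IH[OF total])
  also have "\<dots> = of_nat (fact (l - k)) * (\<Sum>g\<in>{..<k} \<rightarrow>\<^sub>E A.
      of_nat (\<Sum>a\<in>?A. \<alpha> a * sub_choose A k (?\<beta> a) g) * box_weight k B g)"
    unfolding of_nat_sum sum_distrib_right sum_distrib_left
    by (subst sum.swap) (simp only: of_nat_mult mult_ac)
  also have "\<dots> = of_nat (fact (l - k)) * (\<Sum>g\<in>{..<k} \<rightarrow>\<^sub>E A.
      of_nat ((Suc l - k) * sub_choose A k \<alpha> g) * box_weight k B g)"
    by (intro arg_cong2[of _ _ _ _ "(*)"] sum.cong refl)
       (simp only: sub_choose_remove_point[OF A(1) _ step.prems])
  also have "\<dots> = of_nat (fact (Suc l - k)) *
     (\<Sum>g\<in>{..<k} \<rightarrow>\<^sub>E A. of_nat (sub_choose A k \<alpha> g) * box_weight k B g)"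
  proof -
    have "(fact (Suc l - k) :: nat) = (Suc l - k) * fact (l - k)"
      using step(1) by (simp add: Suc_diff_le)
    thus ?thesis unfolding sum_distrib_left
      by (intro sum.cong refl) (simp only: of_nat_mult mult_ac)
  qed
  finally show ?case .
qed

end

section \<open>Factorial moments for fixed occupation numbers\<close>

context product_sigma_finite begin

lemma measurable_PiM_permute:
  assumes \<pi>: "\<pi> permutes J" and M: "\<And>i. M i = N"
  shows "(\<lambda>z. z \<circ> \<pi>) \<in> measurable (Pi\<^sub>M J M) (Pi\<^sub>M J M)"
proof (rule measurable_PiM_single')
  show "(\<lambda>z. (z \<circ> \<pi>) i) \<in> measurable (Pi\<^sub>M J M) (M i)" if "i \<in> J" for i
    using measurable_component_singleton[of "\<pi> i" J M] that permutes_in_image[OF \<pi>] M by (simp add: o_def)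
  show "(\<lambda>z. z \<circ> \<pi>) \<in> space (Pi\<^sub>M J M) \<rightarrow> (\<Pi>\<^sub>E i\<in>J. space (M i))"
    using permutes_in_image[OF \<pi>] permutes_not_in[OF \<pi>] M by (auto simp: space_PiM PiE_iff extensional_def)
qed

lemma PiM_permute:
  assumes fin: "finite J" and \<pi>: "\<pi> permutes J" and M: "\<And>i. M i = N"
  shows "distr (Pi\<^sub>M J M) (Pi\<^sub>M J M) (\<lambda>z. z \<circ> \<pi>) = Pi\<^sub>M J M"
proof (rule PiM_eqI[OF fin])
  have inJ: "\<pi> i \<in> J \<longleftrightarrow> i \<in> J" for i using permutes_in_image[OF \<pi>] .
  note meas = measurable_PiM_permute[of \<pi> J N, OF \<pi> M]
  fix A assume A: "\<And>i. i \<in> J \<Longrightarrow> A i \<in> sets (M i)"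
  have inv: "inv \<pi> permutes J" using permutes_inv[OF \<pi>] .
  have iJ: "inv \<pi> i \<in> J \<longleftrightarrow> i \<in> J" for i using permutes_in_image[OF inv] .
  have "(\<lambda>z. z \<circ> \<pi>) -` (Pi\<^sub>E J A) \<inter> space (Pi\<^sub>M J M) = Pi\<^sub>E J (A \<circ> inv \<pi>)" (is "?L = ?R")
  proof (intro equalityI subsetI)
    fix z assume z: "z \<in> ?L"
    hence "z (\<pi> i) \<in> A i" if "i \<in> J" for i using that by (auto simp: PiE_iff)
    hence "z i \<in> A (inv \<pi> i)" if "i \<in> J" for i
      using that iJ permutes_inverses(1)[OF \<pi>, of i] by metis
    thus "z \<in> ?R" using z by (auto simp: PiE_iff space_PiM)
  next
    fix z assume z: "z \<in> ?R"
    have "z (\<pi> i) \<in> A i" if "i \<in> J" for i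
      using z that inJ permutes_inverses(2)[OF \<pi>, of i] by (force simp: PiE_iff)
    moreover have "z i \<in> space (M i)" if "i \<in> J" for i
      using z that A[of "inv \<pi> i"] iJ sets.sets_into_space M by (force simp: PiE_iff)
    ultimately show "z \<in> ?L"
      using z permutes_not_in[OF \<pi>] inJ by (auto simp: PiE_iff space_PiM extensional_def)
  qed
  moreover have "A (inv \<pi> i) \<in> sets (M i)" if "i \<in> J" for i
    using A[of "inv \<pi> i"] that iJ M by simp
  ultimately have "emeasure (distr (Pi\<^sub>M J M) (Pi\<^sub>M J M) (\<lambda>z. z \<circ> \<pi>)) (Pi\<^sub>E J A) =
     (\<Prod>i\<in>J. emeasure (M i) (A (inv \<pi> i)))"
    using A fin by (subst emeasure_distr[OF meas]) (auto intro!: sets_PiM_I_finite simp: emeasure_PiM)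
  also have "\<dots> = (\<Prod>i\<in>J. emeasure (M i) (A i))"
    using prod.permute[OF inv, of "\<lambda>i. emeasure N (A i)"] M by (simp add: o_def)
  finally show "emeasure (distr (Pi\<^sub>M J M) (Pi\<^sub>M J M) (\<lambda>z. z \<circ> \<pi>)) (Pi\<^sub>E J A) =
     (\<Prod>i\<in>J. emeasure (M i) (A i))" .
qed simp

lemma nn_integral_permute:
  assumes fin: "finite J" and \<pi>: "\<pi> permutes J" and M: "\<And>i. M i = N"
    and F: "F \<in> borel_measurable (Pi\<^sub>M J M)"
  shows "(\<integral>\<^sup>+z. F (z \<circ> \<pi>) \<partial>Pi\<^sub>M J M) = integral\<^sup>N (Pi\<^sub>M J M) F"
proof -
  note meas = measurable_PiM_permute[of \<pi> J N, OF \<pi> M]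
  show ?thesis
    using nn_integral_distr[OF meas, of F] F PiM_permute[OF fin \<pi> M] by simp
qed

end

lemma occupation_sum_permute:
  assumes \<pi>: "\<pi> permutes {..<l}"
  shows "occupation_sum \<phi> A l \<alpha> (z \<circ> \<pi>) = occupation_sum \<phi> A l \<alpha> z"
  unfolding occupation_sum_def
proof (rule sum.reindex_bij_witness[of _ "\<lambda>f. f \<circ> \<pi>" "\<lambda>f. f \<circ> inv \<pi>"])
  fix f
  show "(\<Prod>i<l. \<phi> ((f \<circ> inv \<pi>) i) (z i)) = (\<Prod>i<l. \<phi> (f i) ((z \<circ> \<pi>) i))"
    using prod.permute[OF \<pi>, of "\<lambda>i. \<phi> (f (inv \<pi> i)) (z i)"] permutes_inverses[OF \<pi>] by (simp add: o_def)
  show "(f \<circ> \<pi>) \<circ> inv \<pi> = f" "(f \<circ> inv \<pi>) \<circ> \<pi> = f"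
    by (simp_all add: fun_eq_iff permutes_inverses[OF \<pi>])
qed (intro arrangements_permute \<pi> permutes_inv; assumption)+

text \<open>
  This moves any tuple of distinct indices to the first coordinates, where
  \<open>occupation_marginal\<close> applies.
\<close>

lemma distinct_list_extends_to_permutation:
  assumes "distinct xs" "set xs \<subseteq> {..<l::nat}"
  obtains \<pi> where "\<pi> permutes {..<l}" "\<And>j. j < length xs \<Longrightarrow> \<pi> j = xs ! j"
proof -
  obtain ys where ys: "set ys = {..<l} - set xs" "distinct ys"
    using finite_distinct_list[of "{..<l} - set xs"] by auto
  define zs where "zs = xs @ ys"
  have zs: "distinct zs" "set zs = {..<l}" using assms ys by (auto simp: zs_def)
  have len: "length zs = l" using distinct_card[OF zs(1)] zs(2) by simp
  define \<pi> where "\<pi> j = (if j < l then zs ! j else j)" for j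
  have "bij_betw ((!) zs) {..<l} {..<l}"
    by (intro bij_betw_nth[OF zs(1)]) (simp_all only: len zs(2))
  hence "bij_betw \<pi> {..<l} {..<l}"
    by (rule iffD1[OF bij_betw_cong, rotated]) (simp add: \<pi>_def)
  hence "\<pi> permutes {..<l}" by (rule bij_imp_permutes) (simp add: \<pi>_def)
  moreover have "\<pi> j = xs ! j" if "j < length xs" for j
    using that len by (simp add: \<pi>_def zs_def nth_append)
  ultimately show ?thesis using that by blast
qed

lemma nth_less_of_subset: "set xs \<subseteq> {..<l::nat} \<Longrightarrow> j < length xs \<Longrightarrow> xs ! j < l"
  by (meson lessThan_iff nth_mem subsetD)

text \<open>
  Products of falling factorials of counts are numbers of ordered tuples of distinct indices.
  Tuples are lists, so that they can be extended at the end, in step with \<open>blocks\<close>.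
\<close>

definition point_tuples :: "(nat \<Rightarrow> 'a) \<Rightarrow> nat \<Rightarrow> 'a set list \<Rightarrow> nat list set" where
  "point_tuples z l Bs = {xs. length xs = length Bs \<and> distinct xs \<and> set xs \<subseteq> {..<l} \<and>
      (\<forall>j<length Bs. z (xs ! j) \<in> Bs ! j)}"

lemma finite_point_tuples: "finite (point_tuples z l Bs)"
  by (rule finite_subset[OF _ finite_lists_length_eq[of "{..<l}" "length Bs"]])
     (auto simp: point_tuples_def)

lemma card_point_tuples_snoc:
  assumes "\<And>xs. xs \<in> point_tuples z l Bs \<Longrightarrow> card ({u. u < l \<and> z u \<in> B} - set xs) = c"
  shows "card (point_tuples z l (Bs @ [B])) = card (point_tuples z l Bs) * c"
proof -
  have "bij_betw (\<lambda>(xs,u). xs @ [u])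
    (SIGMA xs:point_tuples z l Bs. {u. u < l \<and> z u \<in> B} - set xs) (point_tuples z l (Bs @ [B]))"
  proof (rule bij_betwI[of _ _ _ "\<lambda>xs. (butlast xs, last xs)"], goal_cases)
    case 1 thus ?case
      by (auto simp: point_tuples_def nth_append less_Suc_eq)
  next
    case 2
    show ?case
    proof
      fix xs assume xs: "xs \<in> point_tuples z l (Bs @ [B])"
      then obtain ys u where ys: "xs = ys @ [u]"
        by (cases xs rule: rev_cases) (auto simp: point_tuples_def)
      have "\<forall>j<length Bs. z (ys ! j) \<in> Bs ! j" "z u \<in> B"
        using xs by (auto simp: point_tuples_def ys nth_append less_Suc_eq all_conj_distrib split: if_splits)
      thus "(butlast xs, last xs) \<in> (SIGMA xs:point_tuples z l Bs. {u. u < l \<and> z u \<in> B} - set xs)"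
        using xs by (auto simp: point_tuples_def ys)
    qed
  next
    case (4 xs)
    hence "xs \<noteq> []" by (auto simp: point_tuples_def)
    thus ?case by simp
  qed auto
  hence "card (point_tuples z l (Bs @ [B])) =
      card (SIGMA xs:point_tuples z l Bs. {u. u < l \<and> z u \<in> B} - set xs)"
    by (simp add: bij_betw_same_card)
  also have "\<dots> = (\<Sum>xs\<in>point_tuples z l Bs. c)"
    by (subst card_SigmaI) (simp_all add: finite_point_tuples assms)
  finally show ?thesis by simp
qed

text \<open>
  As \<open>D\<close> is disjoint from the earlier sets, the entries of a tuple that use up points of
  \<open>D\<close> are exactly those in the last block.
\<close>

lemma card_point_tuples_replicate:
  assumes disj: "\<And>B. B \<in> set Bs \<Longrightarrow> B \<inter> D = {}"
  shows "card (point_tuples z l (Bs @ replicate m D)) =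
    card (point_tuples z l Bs) * (\<Prod>j<m. card {u. u < l \<and> z u \<in> D} - j)"
proof (induction m)
  case (Suc m)
  have "card ({u. u < l \<and> z u \<in> D} - set xs) = card {u. u < l \<and> z u \<in> D} - m"
    if xs: "xs \<in> point_tuples z l (Bs @ replicate m D)" for xs
  proof -
    have in1: "z (xs ! j) \<in> Bs ! j" if "j < length Bs" for j
      using xs that by (auto simp: point_tuples_def nth_append dest: spec[of _ j])
    have in2: "z (xs ! (length Bs + j)) \<in> D" if "j < m" for j
      using xs that by (auto simp: point_tuples_def nth_append dest: spec[of _ "length Bs + j"])
    have len: "length xs = length Bs + m" and d: "distinct xs" and sub: "set xs \<subseteq> {..<l}"
      using xs by (auto simp: point_tuples_def)
    have "{u. u < l \<and> z u \<in> D} \<inter> set xs = set (drop (length Bs) xs)"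
    proof (intro equalityI subsetI)
      fix u assume u: "u \<in> {u. u < l \<and> z u \<in> D} \<inter> set xs"
      then obtain j where j: "j < length xs" "u = xs ! j" by (auto simp: in_set_conv_nth)
      have "\<not> j < length Bs"
        using in1[of j] disj[of "Bs ! j"] u j by auto
      thus "u \<in> set (drop (length Bs) xs)"
        using j len by (auto simp: in_set_conv_nth intro!: exI[of _ "j - length Bs"])
    next
      fix u assume u: "u \<in> set (drop (length Bs) xs)"
      then obtain j where "j < m" "u = xs ! (length Bs + j)" using len by (auto simp: in_set_conv_nth)
      thus "u \<in> {u. u < l \<and> z u \<in> D} \<inter> set xs" using in2[of j] len
        nth_less_of_subset[OF sub, of "length Bs + j"] by auto
    qed
    moreover have "card (set (drop (length Bs) xs)) = m"
      using d len by (simp add: distinct_card)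
    ultimately show ?thesis
      using card_Diff_subset_Int[of "{u. u < l \<and> z u \<in> D}" "set xs"] by simp
  qed
  from card_point_tuples_snoc[OF this]
  have "card (point_tuples z l ((Bs @ replicate m D) @ [D])) =
    card (point_tuples z l (Bs @ replicate m D)) * (card {u. u < l \<and> z u \<in> D} - m)" .
  thus ?case unfolding Suc.IH by (simp add: replicate_append_same[symmetric])
qed simp

lemma blocks_Suc: "blocks (Suc r) D ks = blocks r D ks @ replicate (ks r) (D r)"
  by (simp add: blocks_def)

lemma length_blocks: "length (blocks r D ks) = (\<Sum>i<r. ks i)"
  by (induction r) (simp_all add: blocks_Suc blocks_def[of 0])

lemma set_blocks: "set (blocks r D ks) \<subseteq> D ` {..<r}"
  by (auto simp: blocks_def)

lemma card_point_tuples_blocks: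
  "disjoint_family_on D {..<r} \<Longrightarrow>
    card (point_tuples z l (blocks r D ks)) = (\<Prod>i<r. \<Prod>j<ks i. card {u. u < l \<and> z u \<in> D i} - j)"
proof (induction r)
  case 0
  have "point_tuples z l [] = {[]}" by (auto simp: point_tuples_def)
  thus ?case by (simp add: blocks_def)
next
  case (Suc r)
  have "B \<inter> D r = {}" if B: "B \<in> set (blocks r D ks)" for B
  proof -
    obtain i where "i < r" "B = D i" using B set_blocks[of r D ks] by auto
    thus ?thesis using Suc.prems by (simp add: disjoint_family_on_def)
  qed
  moreover have "disjoint_family_on D {..<r}"
    using Suc.prems by (auto simp: disjoint_family_on_def)
  ultimately show ?case
    using Suc.IH by (simp add: blocks_Suc card_point_tuples_replicate)
qed

lemma falling_of_nat: "falling (of_nat N) k = of_nat (\<Prod>j<k. N - j)"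
proof -
  have "(of_nat N - of_nat j :: ennreal) = of_nat (N - j)" for j
  proof (cases "j \<le> N")
    case True
    then obtain m where "N = j + m" using le_Suc_ex by blast
    thus ?thesis by (simp add: ennreal_add_diff_cancel_left)
  qed (simp add: ennreal_of_nat_eq_real_of_nat ennreal_minus ennreal_neg)
  thus ?thesis by (simp add: falling_def)
qed

lemma prod_falling_config_of:
  assumes "disjoint_family_on D {..<r}" "\<And>i. i < r \<Longrightarrow> D i \<in> sets borel"
  shows "(\<Prod>i<r. falling (emeasure (config_of l z) (D i)) (ks i)) =
    of_nat (card (point_tuples z l (blocks r D ks)))"
  using assms by (simp add: emeasure_config_of falling_of_nat card_point_tuples_blocks)

lemma fact_card_distinct_lists:
  assumes "k \<le> l"
  shows "fact (l - k) * card {xs. length xs = k \<and> distinct xs \<and> set xs \<subseteq> {..<l}} = (fact l :: nat)"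
  using card_lists_distinct_length_eq[of "{..<l}" k] assms fact_div_fact[of "l-k" l]
    dvd_mult_div_cancel[OF fact_dvd[of "l-k" l, where 'a=nat]] by (simp add: Suc_diff_le)

context orthonormal_family begin

lemma of_nat_card_point_tuples:
  "of_nat (card (point_tuples z l Bs)) = (\<Sum>xs | length xs = length Bs \<and> distinct xs \<and> set xs \<subseteq> {..<l}.
     cylinder (length Bs) (\<lambda>j. Bs ! j) (\<lambda>j. z (xs ! j)))"
proof -
  let ?DL = "{xs. length xs = length Bs \<and> distinct xs \<and> set xs \<subseteq> {..<l}}"
  have finDL: "finite ?DL"
    by (rule finite_subset[OF _ finite_lists_length_eq[of "{..<l}" "length Bs"]]) auto
  have "(\<Sum>xs\<in>?DL. cylinder (length Bs) (\<lambda>j. Bs ! j) (\<lambda>j. z (xs ! j))) =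
      (\<Sum>xs\<in>?DL. if xs \<in> point_tuples z l Bs then 1 else 0)"
    by (intro sum.cong refl) (auto simp: cylinder_eq_if point_tuples_def)
  also have "\<dots> = (\<Sum>xs\<in>point_tuples z l Bs. 1)"
    by (rule sum.inter_restrict[OF finDL, symmetric, THEN trans])
       (auto intro!: arg_cong[where f=card] simp: point_tuples_def)
  finally show ?thesis by simp
qed

lemma cylinder_tuple_measurable:
  assumes "\<And>j. j < k \<Longrightarrow> B j \<in> sets \<mu>" "\<And>j. j < k \<Longrightarrow> \<tau> j < l"
  shows "(\<lambda>z. cylinder k B (\<lambda>j. z (\<tau> j))) \<in> borel_measurable (Pi\<^sub>M {..<l} (\<lambda>_. \<mu>))"
  unfolding cylinder_def using assms
  by (intro borel_measurable_prod_ennreal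
     measurable_compose[of "\<lambda>z. z (\<tau> _)" _ \<mu>, OF measurable_component_singleton borel_measurable_indicator]) auto

lemma card_point_tuples_measurable:
  assumes "\<And>B. B \<in> set Bs \<Longrightarrow> B \<in> sets \<mu>"
  shows "(\<lambda>z. of_nat (card (point_tuples z l Bs)) :: ennreal) \<in> borel_measurable (Pi\<^sub>M {..<l} (\<lambda>_. \<mu>))"
  unfolding of_nat_card_point_tuples using assms
  by (intro borel_measurable_sum cylinder_tuple_measurable) (auto simp: nth_less_of_subset)

text \<open>
  By symmetry of the density every tuple of \<open>k\<close> distinct indices contributes as much as the
  first \<open>k\<close> coordinates, and there are \<open>l! / (l - k)!\<close> tuples. If \<open>k > l\<close>, there are none,
  and all coefficients on the right vanish too.
\<close>

lemma integral_point_tuples: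
  assumes A: "finite A" "A \<subseteq> I" and l: "(\<Sum>a\<in>A. \<alpha> a) = l" and B: "\<And>B. B \<in> set Bs \<Longrightarrow> B \<in> sets \<mu>"
    and k: "k = length Bs"
  shows "of_nat (fact k * (\<Prod>a\<in>A. fact (\<alpha> a))) *
     (\<integral>\<^sup>+z. ennreal ((cmod (occupation_sum \<phi> A l \<alpha> z))\<^sup>2) * of_nat (card (point_tuples z l Bs)) \<partial>Pi\<^sub>M {..<l} (\<lambda>_. \<mu>)) =
    of_nat (fact l) * (\<Sum>g\<in>{..<k} \<rightarrow>\<^sub>E A. of_nat (sub_choose A k \<alpha> g) * box_weight k (\<lambda>j. Bs ! j) g)"
    (is "of_nat ?f * ?L = _ * ?R")
proof -
  let ?DL = "{xs. length xs = k \<and> distinct xs \<and> set xs \<subseteq> {..<l}}"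
  let ?S = "\<lambda>z. ennreal ((cmod (occupation_sum \<phi> A l \<alpha> z))\<^sup>2)"
  let ?P = "Pi\<^sub>M {..<l} (\<lambda>_. \<mu>)"
  have finDL: "finite ?DL"
    by (rule finite_subset[OF _ finite_lists_length_eq[of "{..<l}" k]]) auto
  have Bk: "Bs ! j \<in> sets \<mu>" if "j < k" for j using that k B by auto
  note card = of_nat_card_point_tuples[of _ l Bs, folded k]
  have meas_cyl: "(\<lambda>z. cylinder k (\<lambda>j. Bs ! j) (\<lambda>j. z (xs ! j))) \<in> borel_measurable ?P" if "xs \<in> ?DL" for xs
    using that Bk by (intro cylinder_tuple_measurable) (auto simp: nth_less_of_subset)
  have mS: "?S \<in> borel_measurable ?P" using occupation_sum_measurable[OF A(2) order_refl, of l \<alpha>] by measurable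
  show ?thesis
  proof (cases "k \<le> l")
    case True
    have mC: "cylinder k (\<lambda>j. Bs ! j) \<in> borel_measurable ?P"
      by (rule cylinder_measurable) (use True Bk in auto)
    have each: "(\<integral>\<^sup>+z. ?S z * cylinder k (\<lambda>j. Bs ! j) (\<lambda>j. z (xs ! j)) \<partial>?P) = (\<integral>\<^sup>+z. ?S z * cylinder k (\<lambda>j. Bs ! j) z \<partial>?P)"
      if xs: "xs \<in> ?DL" for xs
    proof -
      obtain \<pi> where \<pi>: "\<pi> permutes {..<l}" "\<And>j. j < k \<Longrightarrow> \<pi> j = xs ! j"
        using distinct_list_extends_to_permutation[of xs l] xs by auto
      have "(\<integral>\<^sup>+z. ?S z * cylinder k (\<lambda>j. Bs ! j) (\<lambda>j. z (xs ! j)) \<partial>?P) =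
         (\<integral>\<^sup>+z. ?S (z \<circ> \<pi>) * cylinder k (\<lambda>j. Bs ! j) (z \<circ> \<pi>) \<partial>?P)"
        unfolding occupation_sum_permute[OF \<pi>(1)] cylinder_def
        by (intro nn_integral_cong arg_cong2[of _ _ _ _ "(*)"] prod.cong refl) (simp add: \<pi>(2))
      also have "\<dots> = (\<integral>\<^sup>+z. ?S z * cylinder k (\<lambda>j. Bs ! j) z \<partial>?P)"
        using mS mC by (intro nn_integral_permute[OF _ \<pi>(1)]) (auto intro!: borel_measurable_times_ennreal)
      finally show ?thesis .
    qed
    have "?L = (\<integral>\<^sup>+z. (\<Sum>xs\<in>?DL. ?S z * cylinder k (\<lambda>j. Bs ! j) (\<lambda>j. z (xs ! j))) \<partial>?P)"
      unfolding card sum_distrib_left ..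
    also have "\<dots> = (\<Sum>xs\<in>?DL. \<integral>\<^sup>+z. ?S z * cylinder k (\<lambda>j. Bs ! j) (\<lambda>j. z (xs ! j)) \<partial>?P)"
      using meas_cyl mS by (intro nn_integral_sum borel_measurable_times_ennreal)
    also have "\<dots> = of_nat (card ?DL) * (\<integral>\<^sup>+z. ?S z * cylinder k (\<lambda>j. Bs ! j) z \<partial>?P)"
      by (subst sum.cong[OF refl each]) simp_all
    finally have L: "?L = of_nat (card ?DL) * (\<integral>\<^sup>+z. ?S z * cylinder k (\<lambda>j. Bs ! j) z \<partial>?P)" .
    have "of_nat ?f * ?L = of_nat (card ?DL) * (of_nat ?f * (\<integral>\<^sup>+z. ?S z * cylinder k (\<lambda>j. Bs ! j) z \<partial>?P))"
      unfolding L by (simp only: mult_ac)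
    also have "\<dots> = of_nat (card ?DL) * (of_nat (fact (l - k)) * ?R)"
      by (subst occupation_marginal[OF A True _ l]) (use Bk in auto)
    also have "\<dots> = of_nat (fact (l - k) * card ?DL) * ?R"
      by (simp only: of_nat_mult mult_ac)
    finally show ?thesis unfolding fact_card_distinct_lists[OF True] .
  next
    case False
    have "sub_choose A k \<alpha> g = 0" if g: "g \<in> {..<k} \<rightarrow>\<^sub>E A" for g
    proof (rule ccontr)
      assume "sub_choose A k \<alpha> g \<noteq> 0"
      hence "card {i\<in>{..<k}. g i = a} \<le> \<alpha> a" if "a \<in> A" for a
        using that A by (auto simp: sub_choose_def binomial_eq_0_iff not_less)
      hence "(\<Sum>a\<in>A. card {i\<in>{..<k}. g i = a}) \<le> (\<Sum>a\<in>A. \<alpha> a)" by (rule sum_mono)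
      thus False using sum_fibre_card[OF A(1) g] l False by simp
    qed
    moreover have DL: "?DL = {}"
      using card_mono[of "{..<l}"] False by (auto simp: distinct_card[symmetric])
    ultimately show ?thesis unfolding card DL by simp
  qed
qed

lemma occupation_density_measurable:
  assumes "finite (supp I \<alpha>)"
  shows "occupation_density I \<phi> \<alpha> \<in> borel_measurable (Pi\<^sub>M {..<total I \<alpha>} (\<lambda>_. \<mu>))"
proof -
  have "supp I \<alpha> \<subseteq> I" by (auto simp: supp_def)
  from occupation_sum_measurable[OF this order_refl, of "total I \<alpha>" \<alpha>]
  show ?thesis unfolding occupation_density_eq[OF assms, abs_def] by measurable
qed

end

text \<open>
  For \<open>r = 0\<close> this says that the density is normalised.
\<close>

lemma (in orthonormal_family) Z_law_factorial_moment:
  fixes D :: "nat \<Rightarrow> 'a set"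
  assumes fin: "finite (supp I \<alpha>)" and D: "\<And>i. i < r \<Longrightarrow> D i \<in> sets \<mu>"
    and k: "k = (\<Sum>i<r. ks i)"
  shows "of_nat (fact k) * (\<integral>\<^sup>+z. of_nat (card (point_tuples z (total I \<alpha>) (blocks r D ks))) \<partial>Z_law \<mu> I \<phi> \<alpha>) =
    (\<Sum>g\<in>{..<k} \<rightarrow>\<^sub>E supp I \<alpha>. of_nat (sub_choose (supp I \<alpha>) k \<alpha> g) * box_weight k (\<lambda>j. blocks r D ks ! j) g)"
    (is "_ * (\<integral>\<^sup>+z. ?N z \<partial>_) = ?R")
proof -
  let ?l = "total I \<alpha>" and ?A = "supp I \<alpha>"
  let ?P = "Pi\<^sub>M {..<?l} (\<lambda>_. \<mu>)"
  let ?c = "\<Prod>a\<in>?A. fact (\<alpha> a) :: nat"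
  let ?S = "\<lambda>z. ennreal ((cmod (occupation_sum \<phi> ?A ?l \<alpha> z))\<^sup>2)"
  have sub: "?A \<subseteq> I" by (auto simp: supp_def)
  have B: "B \<in> sets \<mu>" if "B \<in> set (blocks r D ks)" for B
    using that set_blocks[of r D ks] D by auto
  have mN: "?N \<in> borel_measurable ?P" by (rule card_point_tuples_measurable[OF B])
  have "(\<integral>\<^sup>+z. ?N z \<partial>Z_law \<mu> I \<phi> \<alpha>) = (\<integral>\<^sup>+z. ennreal (occupation_density I \<phi> \<alpha> z) * ?N z \<partial>?P)"
    unfolding Z_law_def using occupation_density_measurable[OF fin] mN
    by (intro nn_integral_density) auto
  also have "\<dots> = (\<integral>\<^sup>+z. ennreal (?c / fact ?l) * (?S z * ?N z) \<partial>?P)"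
    unfolding occupation_density_eq[OF fin]
    by (intro nn_integral_cong) (subst ennreal_mult, simp_all add: mult.assoc prod_nonneg)
  also have "\<dots> = ennreal (?c / fact ?l) * (\<integral>\<^sup>+z. ?S z * ?N z \<partial>?P)"
    using mN occupation_sum_measurable[OF sub order_refl, of ?l \<alpha>] by (intro nn_integral_cmult) measurable
  also have "ennreal (?c / fact ?l) = of_nat ?c * ennreal (1 / fact ?l)"
    unfolding ennreal_of_nat_eq_real_of_nat by (subst ennreal_mult[symmetric]) (simp_all add: prod_nonneg)
  finally have "of_nat (fact k) * (\<integral>\<^sup>+z. ?N z \<partial>Z_law \<mu> I \<phi> \<alpha>) =
      ennreal (1 / fact ?l) * (of_nat (fact k * ?c) * (\<integral>\<^sup>+z. ?S z * ?N z \<partial>?P))"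
    by (simp only: of_nat_mult mult_ac)
  also have "\<dots> = ennreal (1 / fact ?l) * (of_nat (fact ?l) * ?R)"
    by (subst integral_point_tuples[OF fin sub total_def[symmetric] B]) (auto simp: length_blocks k)
  also have "\<dots> = ?R"
    by (simp add: mult.assoc[symmetric] ennreal_of_nat_eq_real_of_nat flip: ennreal_mult')
  finally show ?thesis .
qed

section \<open>Binomial moments of independent geometric variables\<close>

lemma nn_integral_count_space_infsum:
  fixes f :: "'b \<Rightarrow> real"
  assumes "f summable_on A" "\<And>x. x \<in> A \<Longrightarrow> 0 \<le> f x"
  shows "(\<integral>\<^sup>+x. ennreal (f x) \<partial>count_space A) = ennreal (infsum f A)"
proof -
  have "(\<lambda>x. norm (f x)) summable_on A \<longleftrightarrow> f summable_on A"
    by (rule summable_on_cong) (use assms(2) in auto)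
  hence a: "Infinite_Set_Sum.abs_summable_on f A" using assms(1) abs_summable_equivalent by blast
  show ?thesis
    using nn_integral_conv_infsetsum[OF a assms(2)] infsetsum_infsum[OF a] by (simp only:)
qed

lemma sums_pmf_nat: "pmf (p :: nat pmf) sums 1"
proof -
  have 1: "(\<Sum>n. ennreal (pmf p n)) = 1"
  proof -
    have "(\<Sum>n. ennreal (pmf p n)) = (\<integral>\<^sup>+n. pmf p n \<partial>count_space UNIV)"
      by (rule nn_integral_count_space_nat[symmetric])
    also have "\<dots> = emeasure p ((\<lambda>n. n) ` UNIV)" by (rule nn_integral_pmf') (rule inj_on_id2)
    also have "\<dots> = 1" using measure_pmf.emeasure_space_1[of p] by (simp only: image_ident space_measure_pmf)
    finally show ?thesis .
  qed
  have s: "summable (pmf p)" by (rule summable_suminf_not_top) (simp_all only: 1 pmf_nonneg ennreal_one_neq_top not_False_eq_True)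
  have "ennreal (suminf (pmf p)) = 1" using suminf_ennreal2[OF pmf_nonneg s] 1 by (simp only:)
  hence "suminf (pmf p) = 1" by (simp only: ennreal_eq_1)
  with s show ?thesis using summable_sums by fastforce
qed

text \<open>
  The weights \<open>(n + b choose b) * p ^ (b + 1) * (1 - p) ^ n\<close> of a negative binomial distribution with
  \<open>p = 1 / (t + 1)\<close> add up to one.
\<close>

lemma geometric_binomial_moment:
  fixes t :: real
  assumes "0 \<le> t"
  shows "(\<lambda>s. real (s choose b) * ((t / (t + 1)) ^ s * (1 / (t + 1)))) sums t ^ b"
proof -
  define p where "p = 1 / (t + 1)"
  have p: "p \<in> {0<..1}" "1 - p = t / (t + 1)" using assms by (auto simp: p_def field_simps)
  have ratio: "(1 - p) / p = t" using assms p by (simp add: p_def)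
  have "(\<lambda>n. (1 - p) ^ b / p ^ b * pmf (neg_binomial_pmf (Suc b) p) n) sums ((1 - p) ^ b / p ^ b * 1)"
    by (intro sums_mult sums_pmf_nat)
  also have "(\<lambda>n. (1 - p) ^ b / p ^ b * pmf (neg_binomial_pmf (Suc b) p) n) =
      (\<lambda>n. real (n + b choose b) * ((1 - p) ^ (n + b) * p))"
  proof
    fix n
    have "n + b choose n = n + b choose b" using binomial_symmetric[of n "n + b"] by simp
    thus "(1 - p) ^ b / p ^ b * pmf (neg_binomial_pmf (Suc b) p) n = real (n + b choose b) * ((1 - p) ^ (n + b) * p)"
      using p by (simp add: pmf_neg_binomial power_add field_simps)
  qed
  finally have "(\<lambda>n. real (n + b choose b) * ((1 - p) ^ (n + b) * p)) sums (t ^ b)"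
    using ratio by (simp add: power_divide[symmetric])
  hence "(\<lambda>s. real (s choose b) * ((1 - p) ^ s * p)) sums (t ^ b)"
    by (subst (asm) sums_iff_shift) (simp add: binomial_eq_0)
  thus ?thesis unfolding p(2) unfolding p_def .
qed

lemma nn_integral_nat_fibres:
  fixes N :: "'v \<Rightarrow> nat" and f :: "nat \<Rightarrow> ennreal"
  assumes [measurable]: "N \<in> measurable Q (count_space UNIV)" "F \<in> borel_measurable Q"
  shows "(\<integral>\<^sup>+\<omega>. f (N \<omega>) * F \<omega> \<partial>Q) =
    (\<integral>\<^sup>+s. f s * (\<integral>\<^sup>+\<omega>. indicator {s} (N \<omega>) * F \<omega> \<partial>Q) \<partial>count_space UNIV)"
proof -
  have [measurable]: "(\<lambda>\<omega>. indicator {s} (N \<omega>) :: ennreal) \<in> borel_measurable Q" for s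
    by (rule measurable_compose[OF assms(1)]) simp
  have "(\<integral>\<^sup>+\<omega>. f (N \<omega>) * F \<omega> \<partial>Q) = (\<integral>\<^sup>+\<omega>. \<integral>\<^sup>+s. f s * (indicator {s} (N \<omega>) * F \<omega>) \<partial>count_space UNIV \<partial>Q)"
    by (intro nn_integral_cong, subst nn_integral_count_space'[of "{N _}"]) (auto simp: indicator_def)
  also have "\<dots> = (\<integral>\<^sup>+s. \<integral>\<^sup>+\<omega>. f s * (indicator {s} (N \<omega>) * F \<omega>) \<partial>Q \<partial>count_space UNIV)"
    by (rule nn_integral_count_space_nn_integral) simp_all
  also have "\<dots> = (\<integral>\<^sup>+s. f s * (\<integral>\<^sup>+\<omega>. indicator {s} (N \<omega>) * F \<omega> \<partial>Q) \<partial>count_space UNIV)"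
    by (intro nn_integral_cong nn_integral_cmult) measurable
  finally show ?thesis .
qed

lemma (in prob_space) nn_integral_geometric_binomial:
  assumes "X \<in> measurable M (count_space UNIV)" "0 \<le> t"
    and "\<And>s. prob {\<omega>\<in>space M. X \<omega> = s} = (t / (t + 1)) ^ s * (1 / (t + 1))"
  shows "(\<integral>\<^sup>+\<omega>. of_nat (X \<omega> choose b) \<partial>M) = ennreal (t ^ b)"
proof -
  have fibre: "(\<integral>\<^sup>+\<omega>. indicator {s} (X \<omega>) \<partial>M) = emeasure M {\<omega>\<in>space M. X \<omega> = s}" for s
  proof -
    have "{\<omega>\<in>space M. X \<omega> = s} \<in> sets M" using assms(1) by measurable
    hence "emeasure M {\<omega>\<in>space M. X \<omega> = s} = (\<integral>\<^sup>+\<omega>. indicator {\<omega>\<in>space M. X \<omega> = s} \<omega> \<partial>M)" by simp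
    also have "\<dots> = (\<integral>\<^sup>+\<omega>. indicator {s} (X \<omega>) \<partial>M)"
      by (intro nn_integral_cong) (auto simp: indicator_def)
    finally show ?thesis ..
  qed
  have "(\<integral>\<^sup>+\<omega>. of_nat (X \<omega> choose b) \<partial>M) =
    (\<integral>\<^sup>+s. ennreal (real (s choose b) * ((t / (t + 1)) ^ s * (1 / (t + 1)))) \<partial>count_space UNIV)"
    unfolding nn_integral_nat_fibres[OF assms(1) borel_measurable_const[of 1],
      of "\<lambda>s. of_nat (s choose b)", unfolded mult_1_right fibre]
    using assms(2)
    by (intro nn_integral_cong)
       (simp only: emeasure_eq_measure assms(3) ennreal_of_nat_eq_real_of_nat ennreal_mult[symmetric]
         of_nat_0_le_iff zero_le_mult_iff zero_le_power divide_nonneg_nonneg add_nonneg_nonneg zero_le_one simp_thms)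
  also have "\<dots> = ennreal (t ^ b)"
    unfolding nn_integral_count_space_nat
    by (rule suminf_ennreal_eq[OF _ geometric_binomial_moment]) (use assms(2) in auto)
  finally show ?thesis .
qed

lemma sub_choose_superset:
  assumes "finite A" "g ` {..<k} \<subseteq> A"
  shows "sub_choose A k \<alpha> g = sub_choose (g ` {..<k}) k \<alpha> g"
proof -
  have z: "\<alpha> a choose card {i\<in>{..<k}. g i = a} = 1" if "a \<notin> g ` {..<k}" for a
  proof -
    have "{i\<in>{..<k}. g i = a} = {}" using that by auto
    thus ?thesis by (simp only: card.empty binomial_n_0)
  qed
  show ?thesis unfolding sub_choose_def
    by (rule prod.mono_neutral_right) (use assms z in auto)
qed

lemma prod_eq_prod_fibres:
  fixes f :: "'b \<Rightarrow> 'c::comm_monoid_mult" and k :: nat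
  shows "(\<Prod>i<k. f (g i)) = (\<Prod>a\<in>g ` {..<k}. f a ^ card {i\<in>{..<k}. g i = a})"
proof -
  have "(\<Prod>i<k. f (g i)) = (\<Prod>a\<in>g ` {..<k}. \<Prod>i | i \<in> {..<k} \<and> g i = a. f (g i))"
    by (rule prod.group[symmetric]) simp_all
  also have "\<dots> = (\<Prod>a\<in>g ` {..<k}. f a ^ card {i\<in>{..<k}. g i = a})"
  proof (intro prod.cong refl)
    fix a
    have "(\<Prod>i | i \<in> {..<k} \<and> g i = a. f (g i)) = (\<Prod>i | i \<in> {..<k} \<and> g i = a. f a)"
      by (intro prod.cong) auto
    thus "(\<Prod>i | i \<in> {..<k} \<and> g i = a. f (g i)) = f a ^ card {i\<in>{..<k}. g i = a}" by simp
  qed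
  finally show ?thesis .
qed

text \<open>
  This is what makes geometric occupation numbers fit the kernel: their binomial moments are powers of their mean, so
  averaging the number of selections yields a product of eigenvalues.
\<close>

lemma (in prob_space) nn_integral_sub_choose:
  fixes \<gamma> :: "nat \<Rightarrow> 'a \<Rightarrow> nat"
  assumes indep: "indep_vars (\<lambda>_. count_space UNIV) \<gamma> I"
    and lam: "\<And>a. a \<in> I \<Longrightarrow> 0 \<le> lam a"
    and law: "\<And>a s. a \<in> I \<Longrightarrow> prob {\<omega>\<in>space M. \<gamma> a \<omega> = s} = (lam a / (lam a + 1)) ^ s * (1 / (lam a + 1))"
    and g: "g \<in> {..<k} \<rightarrow> I"
  shows "(\<integral>\<^sup>+\<omega>. of_nat (sub_choose (g ` {..<k}) k (\<lambda>a. \<gamma> a \<omega>) g) \<partial>M) = ennreal (\<Prod>i<k. lam (g i))"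
proof -
  let ?R = "g ` {..<k}" and ?n = "\<lambda>a. card {i\<in>{..<k}. g i = a}"
  have R: "?R \<subseteq> I" using g by auto
  have rv: "\<gamma> a \<in> measurable M (count_space UNIV)" if "a \<in> I" for a
    using indep that by (auto simp: indep_vars_def)
  have "(\<integral>\<^sup>+\<omega>. of_nat (sub_choose ?R k (\<lambda>a. \<gamma> a \<omega>) g) \<partial>M) =
     (\<integral>\<^sup>+\<omega>. (\<Prod>a\<in>?R. of_nat (\<gamma> a \<omega> choose ?n a)) \<partial>M)"
    by (simp add: sub_choose_def)
  also have "\<dots> = (\<Prod>a\<in>?R. \<integral>\<^sup>+\<omega>. of_nat (\<gamma> a \<omega> choose ?n a) \<partial>M)"
    by (rule indep_vars_nn_integral)
       (simp_all add: indep_vars_compose2[OF indep_vars_subset[OF indep R], where Y="\<lambda>a s. of_nat (s choose ?n a)", simplified])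
  also have "\<dots> = (\<Prod>a\<in>?R. ennreal (lam a ^ ?n a))"
    using R by (intro prod.cong refl nn_integral_geometric_binomial rv lam law) auto
  also have "\<dots> = ennreal (\<Prod>i<k. lam (g i))"
    unfolding prod_eq_prod_fibres[of lam] using R lam by (intro prod_ennreal) auto
  finally show ?thesis .
qed

lemma nn_integral_PiE_prod:
  assumes A: "finite J" and "countable I" and pos: "\<And>a. a \<in> I \<Longrightarrow> 0 \<le> lam a"
  shows "(\<integral>\<^sup>+g. ennreal (\<Prod>i\<in>J. lam (g i)) \<partial>count_space (J \<rightarrow>\<^sub>E I)) =
    (\<integral>\<^sup>+a. ennreal (lam a) \<partial>count_space I) ^ card J"
proof -
  interpret product_sigma_finite "\<lambda>_. count_space I"
    by (rule product_sigma_finite.intro) (rule sigma_finite_measure_count_space_countable[OF assms(2)])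
  have "(\<integral>\<^sup>+g. ennreal (\<Prod>i\<in>J. lam (g i)) \<partial>count_space (J \<rightarrow>\<^sub>E I)) =
     (\<integral>\<^sup>+g. (\<Prod>i\<in>J. ennreal (lam (g i))) \<partial>count_space (J \<rightarrow>\<^sub>E I))"
    using pos by (intro nn_integral_cong prod_ennreal[symmetric]) (auto simp: PiE_iff)
  also have "\<dots> = (\<integral>\<^sup>+g. (\<Prod>i\<in>J. ennreal (lam (g i))) \<partial>Pi\<^sub>M J (\<lambda>_. count_space I))"
    using count_space_PiM_finite[OF A, of "\<lambda>_. I"] assms(2) by simp
  also have "\<dots> = (\<Prod>i\<in>J. \<integral>\<^sup>+a. ennreal (lam a) \<partial>count_space I)"
    by (rule product_nn_integral_prod[OF A]) auto
  finally show ?thesis by simp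
qed

lemma (in orthonormal_family) box_weight_0: "box_weight 0 B g = 1"
proof -
  have "per 0 M = (1::complex)" for M by (simp add: per_def)
  thus ?thesis
    unfolding box_weight_def cylinder_def amplitude_def by (simp add: PiM_empty)
qed

text \<open>
  If the labels in \<open>g\<close> have multiplicities \<open>\<alpha>\<close>, then by \<open>occupation_marginal\<close> with no
  point kept, the squared amplitude has total integral \<open>k! \<Prod>a. \<alpha> a!\<close>; the product of
  factorials divides \<open>k!\<close>.
\<close>

lemma (in orthonormal_family) box_weight_le:
  assumes g: "g \<in> {..<k} \<rightarrow>\<^sub>E I"
  shows "box_weight k B g \<le> of_nat (fact k * fact k)"
proof -
  let ?A = "g ` {..<k}" and ?\<alpha> = "\<lambda>a. card {i\<in>{..<k}. g i = a}"
  let ?c = "(\<Prod>a\<in>?A. fact (?\<alpha> a)) :: nat"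
  let ?S = "\<lambda>z. ennreal ((cmod (occupation_sum \<phi> ?A k ?\<alpha> z))\<^sup>2)"
  have A: "finite ?A" "?A \<subseteq> I" using g by (auto simp: PiE_iff)
  have gA: "g \<in> {..<k} \<rightarrow>\<^sub>E ?A" using g by (auto simp: PiE_iff)
  have arr: "g \<in> arrangements ?A k ?\<alpha>" using gA by (auto simp: arrangements_def)
  have tot: "(\<Sum>a\<in>?A. ?\<alpha> a) = k" by (rule sum_fibre_card[OF A(1) gA])
  have "of_nat ?c * (\<integral>\<^sup>+z. ?S z \<partial>Pi\<^sub>M {..<k} (\<lambda>_. \<mu>)) = of_nat (fact k)"
    using occupation_marginal[OF A, of 0 k "\<lambda>_. {}" ?\<alpha>] tot
    by (simp add: cylinder_def box_weight_0 sub_choose_def)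
  moreover have "box_weight k B g \<le> (\<integral>\<^sup>+z. of_nat (?c * ?c) * ?S z \<partial>Pi\<^sub>M {..<k} (\<lambda>_. \<mu>))"
    unfolding box_weight_def
  proof (rule nn_integral_mono)
    fix z
    have "cylinder k B z \<le> 1"
      unfolding cylinder_def by (intro prod_le_1) (auto simp: indicator_def)
    hence "ennreal ((cmod (amplitude k g z))\<^sup>2) * cylinder k B z \<le> ennreal ((cmod (amplitude k g z))\<^sup>2) * 1"
      by (intro mult_left_mono) auto
    also have "\<dots> = of_nat (?c * ?c) * ?S z"
      unfolding amplitude_arrangement[OF A(1) arr]
      by (simp add: norm_mult power_mult_distrib ennreal_mult power2_eq_square ennreal_of_nat_eq_real_of_nat
            mult_ac del: of_nat_prod)
    finally show "ennreal ((cmod (amplitude k g z))\<^sup>2) * cylinder k B z \<le> of_nat (?c * ?c) * ?S z" .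
  qed
  moreover have "\<dots> = of_nat (?c * ?c) * (\<integral>\<^sup>+z. ?S z \<partial>Pi\<^sub>M {..<k} (\<lambda>_. \<mu>))"
    using occupation_sum_measurable[OF A(2) order_refl, of k ?\<alpha>] by (intro nn_integral_cmult) measurable
  moreover have "?c \<le> fact k"
  proof (rule dvd_imp_le)
    show "?c dvd fact k" unfolding card_arrangements[OF A(1) tot, symmetric] by simp
  qed simp
  hence "of_nat (?c * fact k) \<le> (of_nat (fact k * fact k) :: ennreal)"
    by (intro of_nat_mono mult_right_mono) simp_all
  ultimately show ?thesis
    by (simp only: of_nat_mult mult.assoc)
qed

section \<open>Permanents of the kernel\<close>

lemma summable_on_of_nn_integral_finite:
  fixes f :: "'b \<Rightarrow> real"
  assumes "\<And>a. a \<in> A \<Longrightarrow> 0 \<le> f a" "(\<integral>\<^sup>+a. ennreal (f a) \<partial>count_space A) < \<infinity>"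
  shows "f summable_on A"
proof -
  have "(\<integral>\<^sup>+a. ennreal (norm (f a)) \<partial>count_space A) = (\<integral>\<^sup>+a. ennreal (f a) \<partial>count_space A)"
    using assms(1) by (intro nn_integral_cong) simp
  hence "integrable (count_space A) f"
    using assms(2) by (simp add: integrable_iff_bounded)
  hence "Infinite_Set_Sum.abs_summable_on f A" by (simp add: Infinite_Set_Sum.abs_summable_on_def)
  hence "(\<lambda>x. norm (f x)) summable_on A" using abs_summable_equivalent by blast
  moreover have "(\<lambda>x. norm (f x)) summable_on A \<longleftrightarrow> f summable_on A"
    by (rule summable_on_cong) (use assms(1) in auto)
  ultimately show ?thesis by simp
qed

lemma nn_integral_count_space_measurable:
  fixes f :: "'i::countable \<Rightarrow> 'b \<Rightarrow> ennreal"
  assumes f: "\<And>a. a \<in> I \<Longrightarrow> f a \<in> borel_measurable M"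
  shows "(\<lambda>x. \<integral>\<^sup>+a. f a x \<partial>count_space I) \<in> borel_measurable M"
proof -
  interpret cI: sigma_finite_measure "count_space I"
    by (rule sigma_finite_measure_count_space_countable) simp
  have "(\<lambda>p. f (fst p) (snd p)) \<in> borel_measurable (count_space I \<Otimes>\<^sub>M M)"
    by (rule measurable_pair_measure_countable1) (use f in auto)
  hence "(\<lambda>p. f (snd p) (fst p)) \<in> borel_measurable (M \<Otimes>\<^sub>M count_space I)"
    by (subst measurable_pair_swap_iff) (simp add: split_beta)
  thus ?thesis by (intro cI.borel_measurable_nn_integral) (simp add: split_beta)
qed

lemma has_sum_finite_sum:
  fixes f :: "'b \<Rightarrow> 'c \<Rightarrow> 'd::topological_comm_monoid_add"
  assumes "finite S" "\<And>i. i \<in> S \<Longrightarrow> (f i has_sum s i) A"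
  shows "((\<lambda>x. \<Sum>i\<in>S. f i x) has_sum (\<Sum>i\<in>S. s i)) A"
  using assms by (induction S) (auto intro!: has_sum_add)

lemma (in product_sigma_finite) AE_PiM_component:
  assumes J: "finite J" "j \<in> J" and P: "AE x in M j. P x"
  shows "AE z in Pi\<^sub>M J M. P (z j)"
proof -
  obtain N where N: "N \<in> null_sets (M j)" "{x\<in>space (M j). \<not> P x} \<subseteq> N"
    using P by (auto elim!: AE_E simp: null_sets_def)
  let ?E = "Pi\<^sub>E J (\<lambda>i. if i = j then N else space (M i))"
  have E: "?E \<in> sets (Pi\<^sub>M J M)" using J N by (intro sets_PiM_I_finite) auto
  have "emeasure (Pi\<^sub>M J M) ?E = (\<Prod>i\<in>J. emeasure (M i) (if i = j then N else space (M i)))"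
    using J N by (intro emeasure_PiM) auto
  also have "\<dots> = 0" using J N by (intro prod_zero) (auto intro!: bexI[of _ j])
  finally have "?E \<in> null_sets (Pi\<^sub>M J M)" using E by auto
  thus ?thesis
    by (rule AE_I') (use N J in \<open>force simp: space_PiM PiE_iff\<close>)
qed

locale trace_class_family = orthonormal_family \<mu> I \<phi>
  for \<mu> :: "'a::polish_space measure" and I and \<phi> +
  fixes lam :: "nat \<Rightarrow> real"
  assumes sets_mu: "sets \<mu> = sets borel"
    and lam_nonneg: "a \<in> I \<Longrightarrow> 0 \<le> lam a"
    and lam_summable: "lam summable_on I"
begin

text \<open>
  This is \<open>k!\<close> times a factorial moment with total multiplicity \<open>k\<close>, both of the permanental
  process (\<open>permanental_factorial_moment\<close>) and of the mixture (\<open>mixture_factorial_moment\<close>).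
\<close>

definition box_moment :: "nat \<Rightarrow> (nat \<Rightarrow> 'a set) \<Rightarrow> ennreal" where
  "box_moment k B = (\<integral>\<^sup>+g. ennreal (\<Prod>i<k. lam (g i)) * box_weight k B g \<partial>count_space ({..<k} \<rightarrow>\<^sub>E I))"

lemma nn_integral_lam: "(\<integral>\<^sup>+a. ennreal (lam a) \<partial>count_space I) = ennreal (infsum lam I)"
  by (rule nn_integral_count_space_infsum[OF lam_summable lam_nonneg])

text \<open>
  Division by \<open>k!\<close> shows that the factorial moments are at most \<open>k!\<close> times a power of the trace.
  This growth is slow enough for them to determine the law.
\<close>

lemma box_moment_le: "box_moment k B \<le> of_nat (fact k * fact k) * ennreal (infsum lam I) ^ k"
proof -
  have "box_moment k B \<le> (\<integral>\<^sup>+g. of_nat (fact k * fact k) * ennreal (\<Prod>i<k. lam (g i)) \<partial>count_space ({..<k} \<rightarrow>\<^sub>E I))"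
    unfolding box_moment_def
    by (intro nn_integral_mono) (simp only: mult.commute[of "of_nat _"] space_count_space mult_left_mono[OF box_weight_le] zero_le)
  also have "\<dots> = of_nat (fact k * fact k) * ennreal (infsum lam I) ^ k"
    using nn_integral_PiE_prod[of "{..<k}" I lam] lam_nonneg by (simp add: nn_integral_cmult nn_integral_lam)
  finally show ?thesis .
qed

subsection \<open>CB\<close>

lemma amplitude_permute:
  assumes "g \<in> {..<k} \<rightarrow>\<^sub>E I" "\<sigma> permutes {..<k}"
  shows "amplitude k (g \<circ> \<sigma>) x = amplitude k g x"
proof -
  let ?A = "g ` {..<k}" and ?\<alpha> = "\<lambda>a. card {i\<in>{..<k}. g i = a}"
  have g: "g \<in> arrangements ?A k ?\<alpha>" using assms(1) by (auto simp: arrangements_def PiE_iff)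
  show ?thesis
    using amplitude_arrangement[OF _ g] amplitude_arrangement[OF _ arrangements_permute[OF g assms(2)]] by simp
qed

text \<open>
  The Cauchy--Binet formula for permanents. Expanding every entry of the matrix gives a sum over
  labellings \<open>g\<close> of the tensor of \<open>g\<close> times the conjugate of its amplitude. Replacing \<open>g\<close> by
  \<open>g \<circ> \<sigma>\<close> does not change the sum, nor the amplitude and the product of eigenvalues in
  each term; so summing over all \<open>\<sigma>\<close> turns the tensor into the amplitude.
\<close>

lemma kernel_permanent_expansion:
  assumes x: "\<And>i. i < k \<Longrightarrow> (\<lambda>a. lam a * (cmod (\<phi> a (x i)))\<^sup>2) summable_on I"
  shows "((\<lambda>g. complex_of_real ((\<Prod>i<k. lam (g i)) * (cmod (amplitude k g x))\<^sup>2))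
     has_sum (fact k * per k (\<lambda>i j. eigen_kernel I lam \<phi> (x i) (x j)))) ({..<k} \<rightarrow>\<^sub>E I)"
proof -
  let ?G = "{..<k} \<rightarrow>\<^sub>E I" and ?K = "\<lambda>i j. eigen_kernel I lam \<phi> (x i) (x j)"
  let ?t = "\<lambda>i j a. complex_of_real (lam a) * \<phi> a (x i) * cnj (\<phi> a (x j))"
  define h where "h g = (\<Prod>i<k. complex_of_real (lam (g i))) * (\<Prod>i<k. \<phi> (g i) (x i)) * cnj (amplitude k g x)" for g
  have summ: "(\<lambda>a. norm (?t i j a)) summable_on I" if "i < k" "j < k" for i j
  proof (rule summable_on_comparison_test)
    show "(\<lambda>a. lam a * (cmod (\<phi> a (x i)))\<^sup>2 + lam a * (cmod (\<phi> a (x j)))\<^sup>2) summable_on I"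
      using that x by (intro summable_on_add)
    fix a assume a: "a \<in> I"
    from mult_left_mono[OF norm_mult_le_sum_squares lam_nonneg[OF a]]
    show "norm (?t i j a) \<le> lam a * (cmod (\<phi> a (x i)))\<^sup>2 + lam a * (cmod (\<phi> a (x j)))\<^sup>2"
      using lam_nonneg[OF a] by (simp add: norm_mult mult.assoc distrib_left)
  qed auto
  have prod_sum: "((\<lambda>g. \<Prod>i<k. ?t i (\<pi> i) (g i)) has_sum (\<Prod>i<k. ?K i (\<pi> i))) ?G" if \<pi>: "\<pi> permutes {..<k}" for \<pi>
  proof -
    have s: "(\<lambda>a. norm (?t i (\<pi> i) a)) summable_on I" if "i \<in> {..<k}" for i
      using summ[of i "\<pi> i"] that permutes_in_image[OF \<pi>, of i] by simp
    have "Infinite_Set_Sum.abs_summable_on (\<lambda>g. \<Prod>i<k. ?t i (\<pi> i) (g i)) ?G"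
      by (rule abs_summable_on_prod_PiE[OF finite_lessThan countableI_type iffD1[OF abs_summable_equivalent s]])
    hence "(\<lambda>g. norm (\<Prod>i<k. ?t i (\<pi> i) (g i))) summable_on ?G"
      by (rule iffD2[OF abs_summable_equivalent])
    hence "(\<lambda>g. \<Prod>i<k. ?t i (\<pi> i) (g i)) summable_on ?G"
      by (rule abs_summable_summable)
    note sm = has_sum_infsum[OF this]
    have e: "infsum (\<lambda>g. \<Prod>i<k. ?t i (\<pi> i) (g i)) ?G = (\<Prod>i<k. ?K i (\<pi> i))"
      unfolding eigen_kernel_def by (rule infsum_prod_PiE_abs[OF finite_lessThan]) (erule s)
    show ?thesis using sm unfolding e .
  qed
  have "((\<lambda>g. \<Sum>\<pi> | \<pi> permutes {..<k}. \<Prod>i<k. ?t i (\<pi> i) (g i)) has_sum per k ?K) ?G"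
    unfolding per_def by (rule has_sum_finite_sum) (use prod_sum in \<open>auto simp: finite_permutations\<close>)
  also have "(\<lambda>g. \<Sum>\<pi> | \<pi> permutes {..<k}. \<Prod>i<k. ?t i (\<pi> i) (g i)) = h"
    by (auto simp: h_def amplitude_def per_def prod.distrib sum_distrib_left mult.assoc cnj_sum cnj_prod)
  finally have hsum: "(h has_sum per k ?K) ?G" .
  have perm: "((\<lambda>g. h (g \<circ> \<sigma>)) has_sum per k ?K) ?G" if \<sigma>: "\<sigma> permutes {..<k}" for \<sigma>
  proof -
    have *: "g \<circ> \<pi> \<in> ?G" if "g \<in> ?G" "\<pi> permutes {..<k}" for g \<pi>
      using that(1) permutes_in_image[OF that(2)] permutes_not_in[OF that(2)]
      by (auto simp: PiE_iff extensional_def)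
    have "bij_betw (\<lambda>g. g \<circ> \<sigma>) ?G ?G"
    proof (rule bij_betwI[of _ _ _ "\<lambda>g. g \<circ> inv \<sigma>"])
      show "(\<lambda>g. g \<circ> \<sigma>) \<in> ?G \<rightarrow> ?G" "(\<lambda>g. g \<circ> inv \<sigma>) \<in> ?G \<rightarrow> ?G"
        using * \<sigma> permutes_inv[OF \<sigma>] by auto
    qed (auto simp: fun_eq_iff permutes_inverses[OF \<sigma>])
    from has_sum_reindex_bij_betw[OF this, of h] hsum show ?thesis by simp
  qed
  have avg: "((\<lambda>g. \<Sum>\<sigma> | \<sigma> permutes {..<k}. h (g \<circ> \<sigma>)) has_sum (\<Sum>\<sigma> | \<sigma> permutes {..<k}. per k ?K)) ?G"
    by (rule has_sum_finite_sum) (use perm in \<open>auto simp: finite_permutations\<close>)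
  have card: "(\<Sum>\<sigma> | \<sigma> permutes {..<k}. per k ?K) = fact k * per k ?K"
    by (simp add: card_permutations[of "{..<k}" k])
  have square: "(\<Sum>\<sigma> | \<sigma> permutes {..<k}. h (g \<circ> \<sigma>)) =
      complex_of_real ((\<Prod>i<k. lam (g i)) * (cmod (amplitude k g x))\<^sup>2)" if g: "g \<in> ?G" for g
  proof -
    have "(\<Sum>\<sigma> | \<sigma> permutes {..<k}. h (g \<circ> \<sigma>)) = (\<Sum>\<sigma> | \<sigma> permutes {..<k}.
      (\<Prod>i<k. complex_of_real (lam (g i))) * (\<Prod>i<k. \<phi> (g (\<sigma> i)) (x i)) * cnj (amplitude k g x))"
    proof (intro sum.cong refl)
      fix \<sigma> assume "\<sigma> \<in> {\<sigma>. \<sigma> permutes {..<k}}"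
      hence \<sigma>: "\<sigma> permutes {..<k}" by simp
      show "h (g \<circ> \<sigma>) = (\<Prod>i<k. complex_of_real (lam (g i))) * (\<Prod>i<k. \<phi> (g (\<sigma> i)) (x i)) * cnj (amplitude k g x)"
        unfolding h_def amplitude_permute[OF g \<sigma>]
        using prod.permute[OF \<sigma>, of "\<lambda>i. complex_of_real (lam (g i))"] by (simp add: o_def)
    qed
    also have "\<dots> = (\<Prod>i<k. complex_of_real (lam (g i))) * (amplitude k g x * cnj (amplitude k g x))"
    proof -
      have "amplitude k g x = (\<Sum>\<sigma> | \<sigma> permutes {..<k}. \<Prod>i<k. \<phi> (g (\<sigma> i)) (x i))"
        unfolding amplitude_def by (rule per_alt)
      thus ?thesis by (simp only: sum_distrib_left[symmetric] sum_distrib_right[symmetric] mult.assoc)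
    qed
    finally show ?thesis by (simp add: complex_norm_square[symmetric])
  qed
  show ?thesis using avg unfolding card
    by (rule iffD1[OF has_sum_cong, rotated]) (rule square)
qed

text \<open>
  The integral of the kernel along the diagonal is the sum of the eigenvalues. The expansion of
  the kernel converges absolutely at all pairs of points where its diagonal is finite.
\<close>

lemma AE_kernel_diagonal: "AE x in \<mu>. (\<lambda>a. lam a * (cmod (\<phi> a x))\<^sup>2) summable_on I"
proof -
  have m: "(\<lambda>x. ennreal (lam a * (cmod (\<phi> a x))\<^sup>2)) \<in> borel_measurable \<mu>" if "a \<in> I" for a
    using phi_measurable[OF that] by measurable
  have "(\<integral>\<^sup>+x. \<integral>\<^sup>+a. ennreal (lam a * (cmod (\<phi> a x))\<^sup>2) \<partial>count_space I \<partial>\<mu>) =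
    (\<integral>\<^sup>+a. \<integral>\<^sup>+x. ennreal (lam a * (cmod (\<phi> a x))\<^sup>2) \<partial>\<mu> \<partial>count_space I)"
    by (rule nn_integral_count_space_nn_integral) (use m in auto)
  also have "\<dots> = (\<integral>\<^sup>+a. ennreal (lam a) \<partial>count_space I)"
  proof (rule nn_integral_cong)
    fix a assume "a \<in> space (count_space I)"
    hence a: "a \<in> I" by simp
    have "(\<integral>\<^sup>+x. ennreal (lam a * (cmod (\<phi> a x))\<^sup>2) \<partial>\<mu>) = ennreal (lam a) * (\<integral>\<^sup>+x. ennreal ((cmod (\<phi> a x))\<^sup>2) \<partial>\<mu>)"
      using phi_measurable[OF a] lam_nonneg[OF a]
      by (subst nn_integral_cmult[symmetric]) (auto simp: ennreal_mult)
    thus "(\<integral>\<^sup>+x. ennreal (lam a * (cmod (\<phi> a x))\<^sup>2) \<partial>\<mu>) = ennreal (lam a)"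
      using nn_integral_square_sum[of "{a}" "\<lambda>_. 1"] a by simp
  qed
  finally have "AE x in \<mu>. (\<integral>\<^sup>+a. ennreal (lam a * (cmod (\<phi> a x))\<^sup>2) \<partial>count_space I) \<noteq> \<infinity>"
    by (intro nn_integral_PInf_AE nn_integral_count_space_measurable m) (simp_all add: nn_integral_lam)
  thus ?thesis
  proof eventually_elim
    case (elim x)
    show ?case
      by (rule summable_on_of_nn_integral_finite) (use elim lam_nonneg in \<open>auto simp: less_top\<close>)
  qed
qed

lemma box_moment_eq_integral_permanent:
  assumes \<rho>: "\<rho> \<in> borel_measurable (Pi\<^sub>M {..<k} (\<lambda>_. \<mu>))" "\<And>x. 0 \<le> \<rho> x"
    and AE_per: "AE x in Pi\<^sub>M {..<k} (\<lambda>_. \<mu>).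
       complex_of_real (\<rho> x) = per k (\<lambda>i j. eigen_kernel I lam \<phi> (x i) (x j))"
    and B: "\<And>j. j < k \<Longrightarrow> B j \<in> sets \<mu>"
  shows "of_nat (fact k) * (\<integral>\<^sup>+x. ennreal (\<rho> x) * indicator (Pi\<^sub>E {..<k} B) x \<partial>Pi\<^sub>M {..<k} (\<lambda>_. \<mu>)) = box_moment k B"
proof -
  let ?P = "Pi\<^sub>M {..<k} (\<lambda>_. \<mu>)" and ?G = "{..<k} \<rightarrow>\<^sub>E I"
  let ?w = "\<lambda>g x. ennreal (\<Prod>i<k. lam (g i)) * (ennreal ((cmod (amplitude k g x))\<^sup>2) * cylinder k B x)"
  have "AE x in ?P. \<forall>i\<in>{..<k}. (\<lambda>a. lam a * (cmod (\<phi> a (x i)))\<^sup>2) summable_on I"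
    using AE_PiM_component[of "{..<k}" _ "\<lambda>x. (\<lambda>a. lam a * (cmod (\<phi> a x))\<^sup>2) summable_on I"] AE_kernel_diagonal
    by (intro AE_finite_allI) auto
  with AE_per have AE: "AE x in ?P. of_nat (fact k) * (ennreal (\<rho> x) * indicator (Pi\<^sub>E {..<k} B) x) =
      (\<integral>\<^sup>+g. ?w g x \<partial>count_space ?G)"
    using AE_space
  proof eventually_elim
    case (elim x)
    have lam_g: "0 \<le> (\<Prod>i<k. lam (g i))" if "g \<in> ?G" for g
      using that lam_nonneg by (intro prod_nonneg) (auto simp: PiE_iff)
    have "((\<lambda>g. complex_of_real ((\<Prod>i<k. lam (g i)) * (cmod (amplitude k g x))\<^sup>2)) has_sum complex_of_real (fact k * \<rho> x)) ?G"
      using kernel_permanent_expansion[of k x] elim by simp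
    hence hs: "((\<lambda>g. (\<Prod>i<k. lam (g i)) * (cmod (amplitude k g x))\<^sup>2) has_sum (fact k * \<rho> x)) ?G"
      by (simp only: has_sum_of_real_iff)
    have "(\<integral>\<^sup>+g. ennreal ((\<Prod>i<k. lam (g i)) * (cmod (amplitude k g x))\<^sup>2) \<partial>count_space ?G) = ennreal (fact k * \<rho> x)"
      using nn_integral_count_space_infsum[OF has_sum_imp_summable[OF hs]] lam_g infsumI[OF hs] by simp
    moreover have "indicator (Pi\<^sub>E {..<k} B) x = cylinder k B x"
      using elim(3) by (auto simp: cylinder_eq_if indicator_def PiE_iff space_PiM)
    moreover have "(\<integral>\<^sup>+g. ?w g x \<partial>count_space ?G) =
      (\<integral>\<^sup>+g. ennreal ((\<Prod>i<k. lam (g i)) * (cmod (amplitude k g x))\<^sup>2) * cylinder k B x \<partial>count_space ?G)"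
      using lam_g by (intro nn_integral_cong) (simp add: ennreal_mult mult.assoc)
    ultimately show ?case
      using \<rho>(2)[of x] by (simp add: nn_integral_multc ennreal_mult ennreal_of_nat_eq_real_of_nat mult.assoc)
  qed
  have mw: "(\<lambda>x. ennreal ((cmod (amplitude k g x))\<^sup>2) * cylinder k B x) \<in> borel_measurable ?P" if "g \<in> ?G" for g
  proof -
    have "amplitude k g \<in> borel_measurable ?P" using that by (intro amplitude_measurable) auto
    moreover have "cylinder k B \<in> borel_measurable ?P" by (rule cylinder_measurable) (use B in auto)
    ultimately show ?thesis by measurable
  qed
  have ind: "Pi\<^sub>E {..<k} B \<in> sets ?P" using B by (intro sets_PiM_I_finite) auto
  have "of_nat (fact k) * (\<integral>\<^sup>+x. ennreal (\<rho> x) * indicator (Pi\<^sub>E {..<k} B) x \<partial>?P) =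
      (\<integral>\<^sup>+x. of_nat (fact k) * (ennreal (\<rho> x) * indicator (Pi\<^sub>E {..<k} B) x) \<partial>?P)"
    using \<rho>(1) ind by (intro nn_integral_cmult[symmetric]) (auto intro!: borel_measurable_times_ennreal)
  also have "\<dots> = (\<integral>\<^sup>+x. \<integral>\<^sup>+g. ?w g x \<partial>count_space ?G \<partial>?P)"
    by (rule nn_integral_cong_AE[OF AE])
  also have "\<dots> = (\<integral>\<^sup>+g. \<integral>\<^sup>+x. ?w g x \<partial>?P \<partial>count_space ?G)"
    by (rule nn_integral_count_space_nn_integral) (use mw in \<open>auto intro!: countable_PiE borel_measurable_times_ennreal\<close>)
  also have "\<dots> = box_moment k B"
    unfolding box_moment_def box_weight_def
    by (intro nn_integral_cong nn_integral_cmult) (use mw in auto)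
  finally show ?thesis .
qed

end

section \<open>The moment problem for vectors of counts\<close>

text \<open>
  The sums over \<open>m\<close> are the Taylor coefficients at \<open>1\<close> of the power series with coefficients
  \<open>c\<close>, which therefore vanishes near \<open>1\<close>. As it converges in a disc of radius larger than
  \<open>1\<close>, it also vanishes near \<open>0\<close>, by the identity theorem.
\<close>

lemma binomial_sums_determine_coefficients:
  fixes c :: "nat \<Rightarrow> real"
  assumes \<delta>: "0 < \<delta>" and summ: "(\<lambda>m. \<bar>c m\<bar> * (1 + \<delta>) ^ m) summable_on UNIV"
    and zero: "\<And>k. ((\<lambda>m. c m * real (m choose k)) has_sum 0) UNIV"
  shows "c m = 0"
proof -
  define h where "h z = infsum (\<lambda>m. complex_of_real (c m) * z ^ m) UNIV" for z
  have abs: "(\<lambda>m. norm (complex_of_real (c m) * z ^ m)) summable_on UNIV" if "norm z < 1 + \<delta>" for z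
  proof (rule summable_on_comparison_test[OF summ])
    fix m show "norm (complex_of_real (c m) * z ^ m) \<le> \<bar>c m\<bar> * (1 + \<delta>) ^ m"
      using that by (simp add: norm_mult norm_power mult_left_mono power_mono)
  qed simp
  have sums: "(\<lambda>m. complex_of_real (c m) * (z - 0) ^ m) sums h z" if "norm (z - 0) < 1 + \<delta>" for z
    unfolding h_def using has_sum_infsum[OF abs_summable_summable[OF abs]] that
    by (intro has_sum_imp_sums) simp
  \<comment> \<open>The disc contains \<open>1\<close>, where the Taylor coefficients are known.\<close>
  have hol: "h holomorphic_on ball 0 (1 + \<delta>)"
    by (rule power_series_holomorphic[where a="\<lambda>m. complex_of_real (c m)"])
       (use sums in \<open>simp add: dist_norm norm_minus_commute\<close>)
  \<comment> \<open>Expand \<open>(1 + t)\<^sup>m\<close> and exchange the sums over \<open>m\<close> and \<open>k\<close>.\<close>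
  have near1: "h z = 0" if z: "z \<in> ball 1 \<delta>" for z
  proof -
    define t where "t = z - 1"
    have t: "norm t < \<delta>" "z = t + 1" using z by (auto simp: t_def dist_norm norm_minus_commute)
    define f where "f m k = complex_of_real (c m) * (of_nat (m choose k) * t ^ k)" for m k
    have row: "((\<lambda>k. u * (of_nat (m choose k) * s ^ k)) has_sum (u * (s + 1) ^ m)) UNIV"
      for m and u s :: "'x::{real_normed_field}"
    proof -
      have "((\<lambda>k. u * (of_nat (m choose k) * s ^ k)) has_sum (\<Sum>k\<le>m. u * (of_nat (m choose k) * s ^ k))) {..m}"
        by (rule has_sum_finite) simp
      moreover have "(\<Sum>k\<le>m. u * (of_nat (m choose k) * s ^ k)) = u * (s + 1) ^ m"
        by (simp add: binomial_ring sum_distrib_left)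
      ultimately show ?thesis
        by (subst has_sum_cong_neutral[of "{..m}" UNIV]) (auto simp: binomial_eq_0)
    qed
    have normf: "norm (f m k) = \<bar>c m\<bar> * (of_nat (m choose k) * norm t ^ k)" for m k
      by (simp add: f_def norm_mult norm_power)
    have "(\<lambda>p. norm (case p of (m, k) \<Rightarrow> f m k)) summable_on (UNIV \<times> UNIV)"
    proof (subst Infinite_Sum.abs_summable_on_Sigma_iff, intro conjI ballI)
      fix m
      show "(\<lambda>k. norm (case (m, k) of (m, k) \<Rightarrow> f m k)) summable_on UNIV"
        using has_sum_imp_summable[OF row[of "\<bar>c m\<bar>" m "norm t"]] by (simp add: normf)
    next
      have "infsum (\<lambda>k. norm (f m k)) UNIV = \<bar>c m\<bar> * (norm t + 1) ^ m" for m
        using infsumI[OF row[of "\<bar>c m\<bar>" m "norm t"]] by (simp add: normf)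
      moreover have "(\<lambda>m. \<bar>c m\<bar> * (norm t + 1) ^ m) summable_on UNIV"
        by (rule summable_on_comparison_test[OF summ]) (use t \<delta> in \<open>auto intro!: mult_left_mono power_mono\<close>)
      ultimately show "(\<lambda>m. norm (infsum (\<lambda>k. norm (case (m, k) of (m, k) \<Rightarrow> f m k)) UNIV)) summable_on UNIV"
        by simp
    qed
    hence prod: "(\<lambda>(m, k). f m k) summable_on UNIV \<times> UNIV" by (rule abs_summable_summable)
    have inner: "infsum (\<lambda>m. f m k) UNIV = 0" for k
    proof -
      have "((\<lambda>m. t ^ k * complex_of_real (c m * real (m choose k))) has_sum (t ^ k * complex_of_real 0)) UNIV"
        by (intro has_sum_cmult_right has_sum_of_real zero)
      thus ?thesis by (simp add: f_def infsumI mult_ac)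
    qed
    have "h z = infsum (\<lambda>m. infsum (\<lambda>k. f m k) UNIV) UNIV"
      unfolding h_def f_def t(2) by (simp only: infsumI[OF row])
    also have "\<dots> = infsum (\<lambda>k. infsum (\<lambda>m. f m k) UNIV) UNIV"
      by (rule infsum_swap_banach[OF prod])
    also have "\<dots> = 0" by (simp add: inner)
    finally show ?thesis .
  qed
  have all: "h z = 0" if "z \<in> ball 0 (1 + \<delta>)" for z
  proof (rule analytic_continuation[OF hol, of "ball 1 \<delta>" 1])
    show "ball 1 \<delta> \<subseteq> ball (0::complex) (1 + \<delta>)"
    proof
      fix z :: complex assume "z \<in> ball 1 \<delta>"
      hence "norm (z - 1) < \<delta>" by (simp add: dist_norm norm_minus_commute)
      thus "z \<in> ball 0 (1 + \<delta>)" using norm_triangle_ineq[of "z - 1" 1] by simp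
    qed
    show "(1::complex) islimpt ball 1 \<delta>" using \<delta> by (simp add: islimpt_ball)
  qed (use \<delta> that near1 in auto)
  have c0: "c 0 = 0"
  proof -
    have "h 0 = complex_of_real (c 0)"
    proof (rule sums_unique2)
      show "(\<lambda>m. complex_of_real (c m) * 0 ^ m) sums h 0" using sums[of 0] \<delta> by simp
      show "(\<lambda>m. complex_of_real (c m) * 0 ^ m) sums complex_of_real (c 0)" by (rule powser_sums_zero)
    qed
    thus ?thesis using all[of 0] \<delta> by simp
  qed
  show "c m = 0"
  proof (rule ccontr)
    assume m: "c m \<noteq> 0"
    hence "m > 0" using c0 by (cases m) auto
    have h0: "h 0 = 0" using all[of 0] \<delta> by simp
    obtain s where s: "0 < s" "\<And>z. z \<in> cball 0 s - {0} \<Longrightarrow> h z \<noteq> 0"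
      using powser_0_nonzero[of "1 + \<delta>" 0 "\<lambda>m. complex_of_real (c m)" h m] sums h0 m \<open>m > 0\<close> \<delta> by auto
    define z where "z = complex_of_real (min s \<delta>)"
    have "norm z = min s \<delta>" "z \<noteq> 0" using s \<delta> by (auto simp: z_def)
    thus False using s(2)[of z] all[of z] by auto
  qed
qed

lemma choose_mult_power_le:
  fixes \<delta> :: real
  assumes "0 < \<delta>"
  shows "real (m choose k) * \<delta> ^ k \<le> (1 + \<delta>) ^ m"
proof (cases "k \<le> m")
  case True
  have "real (m choose k) * \<delta> ^ k \<le> (\<Sum>j\<le>m. real (m choose j) * \<delta> ^ j)"
    by (rule member_le_sum[where f="\<lambda>j. real (m choose j) * \<delta> ^ j"]) (use True assms in auto)
  also have "\<dots> = (1 + \<delta>) ^ m" using binomial_ring[of \<delta> 1 m] by (simp add: add.commute)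
  finally show ?thesis .
qed (use assms in \<open>simp add: binomial_eq_0\<close>)

lemma binomial_moments_determine_weights:
  fixes w v :: "nat \<Rightarrow> ennreal"
  assumes \<delta>: "0 < \<delta>"
    and w: "(\<integral>\<^sup>+m. ennreal ((1 + \<delta>) ^ m) * w m \<partial>count_space UNIV) < \<infinity>"
    and v: "(\<integral>\<^sup>+m. ennreal ((1 + \<delta>) ^ m) * v m \<partial>count_space UNIV) < \<infinity>"
    and eq: "\<And>k. (\<integral>\<^sup>+m. of_nat (m choose k) * w m \<partial>count_space UNIV) =
                 (\<integral>\<^sup>+m. of_nat (m choose k) * v m \<partial>count_space UNIV)"
  shows "w m = v m"
proof -
  have main: "\<exists>u'. (\<forall>m. 0 \<le> u' m \<and> u m = ennreal (u' m)) \<and> (\<lambda>m. u' m * (1 + \<delta>) ^ m) summable_on UNIV \<and>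
    (\<forall>k. (\<lambda>m. u' m * real (m choose k)) summable_on UNIV \<and>
      (\<integral>\<^sup>+m. of_nat (m choose k) * u m \<partial>count_space UNIV) = ennreal (infsum (\<lambda>m. u' m * real (m choose k)) UNIV))"
    if u: "(\<integral>\<^sup>+m. ennreal ((1 + \<delta>) ^ m) * u m \<partial>count_space UNIV) < \<infinity>" for u :: "nat \<Rightarrow> ennreal"
  proof -
    have fin: "u m < \<infinity>" for m
    proof -
      have "ennreal ((1 + \<delta>) ^ m) * u m \<le> (\<integral>\<^sup>+m. ennreal ((1 + \<delta>) ^ m) * u m \<partial>count_space UNIV)"
        using nn_integral_ge_point[of m UNIV "\<lambda>m. ennreal ((1 + \<delta>) ^ m) * u m"] by simp
      hence "ennreal ((1 + \<delta>) ^ m) * u m < \<infinity>" using u by (rule le_less_trans)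
      thus ?thesis using \<delta> by (auto simp: ennreal_mult_less_top)
    qed
    define u' where "u' m = enn2real (u m)" for m
    have u': "0 \<le> u' m" "u m = ennreal (u' m)" for m using fin[of m] by (auto simp: u'_def)
    have s: "(\<lambda>m. u' m * (1 + \<delta>) ^ m) summable_on UNIV"
    proof (rule summable_on_of_nn_integral_finite)
      have "(\<integral>\<^sup>+m. ennreal (u' m * (1 + \<delta>) ^ m) \<partial>count_space UNIV) = (\<integral>\<^sup>+m. ennreal ((1 + \<delta>) ^ m) * u m \<partial>count_space UNIV)"
        using u' \<delta> by (intro nn_integral_cong) (simp add: ennreal_mult mult.commute)
      thus "(\<integral>\<^sup>+m. ennreal (u' m * (1 + \<delta>) ^ m) \<partial>count_space UNIV) < \<infinity>" using u by simp
    qed (use u' \<delta> in auto)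
    have sk: "(\<lambda>m. u' m * real (m choose k)) summable_on UNIV" for k
    proof (rule summable_on_comparison_test)
      show "(\<lambda>m. u' m * (1 + \<delta>) ^ m * (1 / \<delta> ^ k)) summable_on UNIV" using s by (rule summable_on_cmult_left)
      fix m
      show "u' m * real (m choose k) \<le> u' m * (1 + \<delta>) ^ m * (1 / \<delta> ^ k)"
        using choose_mult_power_le[OF \<delta>, of m k] \<delta> u'(1)[of m]
        by (simp add: field_simps mult_left_mono)
    qed (use u' in auto)
    have "(\<integral>\<^sup>+m. of_nat (m choose k) * u m \<partial>count_space UNIV) = ennreal (infsum (\<lambda>m. u' m * real (m choose k)) UNIV)" for k
      using nn_integral_count_space_infsum[OF sk[of k]] u'
      by (simp add: ennreal_mult ennreal_of_nat_eq_real_of_nat mult.commute)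
    with u' s sk show ?thesis by (intro exI[of _ u']) auto
  qed
  from main[OF w] obtain w' where w': "\<And>m. 0 \<le> w' m" "\<And>m. w m = ennreal (w' m)" 
    "(\<lambda>m. w' m * (1 + \<delta>) ^ m) summable_on UNIV" "\<And>k. (\<lambda>m. w' m * real (m choose k)) summable_on UNIV"
    "\<And>k. (\<integral>\<^sup>+m. of_nat (m choose k) * w m \<partial>count_space UNIV) = ennreal (infsum (\<lambda>m. w' m * real (m choose k)) UNIV)"
    by blast
  from main[OF v] obtain v' where v': "\<And>m. 0 \<le> v' m" "\<And>m. v m = ennreal (v' m)" 
    "(\<lambda>m. v' m * (1 + \<delta>) ^ m) summable_on UNIV" "\<And>k. (\<lambda>m. v' m * real (m choose k)) summable_on UNIV"
    "\<And>k. (\<integral>\<^sup>+m. of_nat (m choose k) * v m \<partial>count_space UNIV) = ennreal (infsum (\<lambda>m. v' m * real (m choose k)) UNIV)"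
    by blast
  have "w' m - v' m = 0"
  proof (rule binomial_sums_determine_coefficients[OF \<delta>, of "\<lambda>m. w' m - v' m"])
    show "(\<lambda>m. \<bar>w' m - v' m\<bar> * (1 + \<delta>) ^ m) summable_on UNIV"
    proof (rule summable_on_comparison_test)
      show "(\<lambda>m. w' m * (1 + \<delta>) ^ m + v' m * (1 + \<delta>) ^ m) summable_on UNIV"
        by (intro summable_on_add w' v')
      fix m
      have "\<bar>w' m - v' m\<bar> \<le> w' m + v' m" using w'(1)[of m] v'(1)[of m] by linarith
      from mult_right_mono[OF this, of "(1 + \<delta>) ^ m"]
      show "\<bar>w' m - v' m\<bar> * (1 + \<delta>) ^ m \<le> w' m * (1 + \<delta>) ^ m + v' m * (1 + \<delta>) ^ m"
        using \<delta> by (simp add: distrib_right)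
    qed (use \<delta> in auto)
    fix k
    have "infsum (\<lambda>m. w' m * real (m choose k)) UNIV = infsum (\<lambda>m. v' m * real (m choose k)) UNIV"
      using eq[of k] unfolding w'(5) v'(5)
      by (subst (asm) ennreal_inj) (auto intro!: infsum_nonneg simp: w'(1) v'(1))
    moreover have "((\<lambda>m. - (v' m * real (m choose k))) has_sum - infsum (\<lambda>m. v' m * real (m choose k)) UNIV) UNIV"
      unfolding has_sum_uminus minus_minus by (rule has_sum_infsum[OF v'(4)])
    from has_sum_add[OF has_sum_infsum[OF w'(4)[of k]] this] calculation
    show "((\<lambda>m. (w' m - v' m) * real (m choose k)) has_sum 0) UNIV"
      by (simp add: left_diff_distrib)
  qed
  thus ?thesis using w'(2) v'(2) by simp
qed

text \<open>
  Binomial factors are replaced by indicators one coordinate at a time. With the factors of the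
  other coordinates kept as a weight, \<open>binomial_moments_determine_weights\<close> handles the
  coordinate at hand; the exponential moment dominates all binomial factors.
\<close>

lemma joint_binomial_moments_determine_law:
  fixes M1 M2 :: "('i \<Rightarrow> nat) measure"
  assumes R: "finite R" and \<delta>: "0 < \<delta>"
    and sets: "sets M1 = sets (count_space (R \<rightarrow>\<^sub>E UNIV))" "sets M2 = sets (count_space (R \<rightarrow>\<^sub>E UNIV))"
    and e1: "(\<integral>\<^sup>+x. ennreal ((1 + \<delta>) ^ (\<Sum>i\<in>R. x i)) \<partial>M1) < \<infinity>"
    and e2: "(\<integral>\<^sup>+x. ennreal ((1 + \<delta>) ^ (\<Sum>i\<in>R. x i)) \<partial>M2) < \<infinity>"
    and eq: "\<And>ks. (\<integral>\<^sup>+x. (\<Prod>i\<in>R. of_nat (x i choose ks i)) \<partial>M1) =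
                 (\<integral>\<^sup>+x. (\<Prod>i\<in>R. of_nat (x i choose ks i)) \<partial>M2)"
  shows "M1 = M2"
proof -
  have meas1: "f \<in> measurable M1 N \<longleftrightarrow> f \<in> (R \<rightarrow>\<^sub>E UNIV) \<rightarrow> space N"
   and meas2: "f \<in> measurable M2 N \<longleftrightarrow> f \<in> (R \<rightarrow>\<^sub>E UNIV) \<rightarrow> space N" for f and N :: "'x measure"
    using measurable_cong_sets[OF sets(1) refl, of N] measurable_cong_sets[OF sets(2) refl, of N]
    by (simp_all add: measurable_count_space_eq1)
  define f where "f m J ks i s = (if i \<in> J then indicator {m i} s else of_nat (s choose ks i) :: ennreal)"
    for m :: "'i \<Rightarrow> nat" and J :: "'i set" and ks i s
  have "J \<subseteq> R \<Longrightarrow> (\<integral>\<^sup>+x. (\<Prod>i\<in>R. f m J ks i (x i)) \<partial>M1) = (\<integral>\<^sup>+x. (\<Prod>i\<in>R. f m J ks i (x i)) \<partial>M2)"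
    if "finite J" for J ks m
    using that
  proof (induction J arbitrary: ks)
    case empty thus ?case using eq[of ks] by (simp add: f_def)
  next
    case (insert j J)
    hence j: "j \<in> R" "J \<subseteq> R" "j \<notin> J" by auto
    define F where "F x = (\<Prod>i\<in>R-{j}. f m J ks i (x i))" for x
    define w where "w P s = (\<integral>\<^sup>+x. indicator {s} (x j) * F x \<partial>P)" for P s
    have split: "(\<Prod>i\<in>R. f m J (ks(j := k)) i (x i)) = of_nat (x j choose k) * F x" for k x
    proof -
      have "(\<Prod>i\<in>R-{j}. f m J (ks(j := k)) i (x i)) = F x"
        unfolding F_def by (intro prod.cong) (auto simp: f_def)
      thus ?thesis using prod.remove[OF R j(1), of "\<lambda>i. f m J (ks(j := k)) i (x i)"] j by (simp add: f_def)
    qed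
    have ins: "(\<Prod>i\<in>R. f m (insert j J) ks i (x i)) = indicator {m j} (x j) * F x" for x
    proof -
      have "(\<Prod>i\<in>R-{j}. f m (insert j J) ks i (x i)) = F x"
        unfolding F_def by (intro prod.cong) (auto simp: f_def)
      thus ?thesis using prod.remove[OF R j(1), of "\<lambda>i. f m (insert j J) ks i (x i)"] by (simp add: f_def)
    qed
    have f_le: "f m J ks i s \<le> ennreal (max 1 (1 / \<delta> ^ ks i)) * ennreal ((1 + \<delta>) ^ s)" for i s
    proof -
      have 1: "1 \<le> (1 + \<delta>) ^ s" using \<delta> by simp
      have "real (s choose ks i) \<le> 1 / \<delta> ^ ks i * (1 + \<delta>) ^ s"
        using choose_mult_power_le[OF \<delta>, of s "ks i"] \<delta> by (simp add: field_simps)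
      also have "\<dots> \<le> max 1 (1 / \<delta> ^ ks i) * (1 + \<delta>) ^ s"
        using \<delta> by (intro mult_right_mono) auto
      finally have 2: "real (s choose ks i) \<le> max 1 (1 / \<delta> ^ ks i) * (1 + \<delta>) ^ s" .
      have 3: "1 \<le> max 1 (1 / \<delta> ^ ks i) * (1 + \<delta>) ^ s"
        using mult_mono[OF max.cobounded1[of 1 "1 / \<delta> ^ ks i"] 1] by simp
      have "f m J ks i s \<le> ennreal (max 1 (1 / \<delta> ^ ks i) * (1 + \<delta>) ^ s)"
        using 2 3 by (auto simp: f_def indicator_def ennreal_of_nat_eq_real_of_nat intro!: ennreal_leI simp flip: ennreal_1)
      thus ?thesis using \<delta> by (simp add: ennreal_mult)
    qed
    \<comment> \<open>The factor at an index in \<open>J\<close> is at most \<open>1\<close>, hence the maximum with \<open>1\<close>.\<close>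
    define C where "C = (\<Prod>i\<in>R-{j}. ennreal (max 1 (1 / \<delta> ^ ks i)))"
    have bound: "ennreal ((1 + \<delta>) ^ x j) * F x \<le> C * ennreal ((1 + \<delta>) ^ (\<Sum>i\<in>R. x i))" for x
    proof -
      have "F x \<le> (\<Prod>i\<in>R-{j}. ennreal (max 1 (1 / \<delta> ^ ks i)) * ennreal ((1 + \<delta>) ^ x i))"
        unfolding F_def by (intro prod_mono_ennreal f_le)
      also have "\<dots> = C * ennreal (\<Prod>i\<in>R-{j}. (1 + \<delta>) ^ x i)"
        unfolding C_def prod.distrib using \<delta> by (simp add: prod_ennreal)
      finally have "ennreal ((1 + \<delta>) ^ x j) * F x \<le> ennreal ((1 + \<delta>) ^ x j) * (C * ennreal (\<Prod>i\<in>R-{j}. (1 + \<delta>) ^ x i))"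
        by (rule mult_left_mono) simp
      also have "\<dots> = C * ennreal ((1 + \<delta>) ^ x j * (\<Prod>i\<in>R-{j}. (1 + \<delta>) ^ x i))"
        using \<delta> by (simp add: ennreal_mult prod_nonneg mult_ac)
      also have "(1 + \<delta>) ^ x j * (\<Prod>i\<in>R-{j}. (1 + \<delta>) ^ x i) = (1 + \<delta>) ^ (\<Sum>i\<in>R. x i)"
        using prod.remove[OF R j(1), of "\<lambda>i. (1 + \<delta>) ^ x i"] by (simp add: power_sum)
      finally show ?thesis .
    qed
    have C: "C < \<infinity>" unfolding C_def by (simp add: ennreal_prod_eq_top less_top[symmetric])
    have main: "(\<integral>\<^sup>+s. g s * w P s \<partial>count_space UNIV) = (\<integral>\<^sup>+x. g (x j) * F x \<partial>P)"
      if "P \<in> {M1, M2}" for g P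
      unfolding w_def using that
      by (intro nn_integral_nat_fibres[symmetric]) (auto simp: meas1 meas2)
    have fin: "(\<integral>\<^sup>+s. ennreal ((1 + \<delta>) ^ s) * w P s \<partial>count_space UNIV) < \<infinity>" if P: "P \<in> {M1, M2}" for P
    proof -
      have "(\<integral>\<^sup>+x. ennreal ((1 + \<delta>) ^ x j) * F x \<partial>P) \<le> (\<integral>\<^sup>+x. C * ennreal ((1 + \<delta>) ^ (\<Sum>i\<in>R. x i)) \<partial>P)"
        by (intro nn_integral_mono bound)
      also have "\<dots> = C * (\<integral>\<^sup>+x. ennreal ((1 + \<delta>) ^ (\<Sum>i\<in>R. x i)) \<partial>P)"
        using P by (intro nn_integral_cmult) (auto simp: meas1 meas2)
      also have "\<dots> < \<infinity>" using C P e1 e2 by (auto simp: ennreal_mult_less_top)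
      finally show ?thesis unfolding main[OF P] .
    qed
    have "w M1 (m j) = w M2 (m j)"
    proof (rule binomial_moments_determine_weights[OF \<delta>])
      fix k
      show "(\<integral>\<^sup>+s. of_nat (s choose k) * w M1 s \<partial>count_space UNIV) = (\<integral>\<^sup>+s. of_nat (s choose k) * w M2 s \<partial>count_space UNIV)"
        using insert.IH[of "ks(j := k)"] j unfolding split
        by (subst (1 2) main) auto
    qed (rule fin, simp)+
    thus ?case unfolding ins w_def .
  qed
  from this[of R] R have ind: "(\<integral>\<^sup>+x. (\<Prod>i\<in>R. indicator {m i} (x i)) \<partial>M1) = (\<integral>\<^sup>+x. (\<Prod>i\<in>R. indicator {m i} (x i)) \<partial>M2)" for m
    by (simp add: f_def)
  have space: "space M1 = R \<rightarrow>\<^sub>E UNIV" "space M2 = R \<rightarrow>\<^sub>E UNIV"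
    using sets_eq_imp_space_eq[OF sets(1)] sets_eq_imp_space_eq[OF sets(2)] by auto
  have pt: "emeasure M {m} = (\<integral>\<^sup>+x. (\<Prod>i\<in>R. indicator {m i} (x i)) \<partial>M)"
    if "M \<in> {M1, M2}" "m \<in> R \<rightarrow>\<^sub>E UNIV" for M m
  proof -
    have "(\<integral>\<^sup>+x. (\<Prod>i\<in>R. indicator {m i} (x i)) \<partial>M) = (\<integral>\<^sup>+x. indicator {m} x \<partial>M)"
    proof (intro nn_integral_cong)
      fix x assume "x \<in> space M"
      hence x: "x \<in> R \<rightarrow>\<^sub>E UNIV" using that space by auto
      have "(\<Prod>i\<in>R. indicator {m i} (x i) :: ennreal) = (if \<forall>i\<in>R. x i = m i then 1 else 0)"
        using R by (auto simp: indicator_def intro!: prod.neutral prod_zero)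
      also have "(\<forall>i\<in>R. x i = m i) \<longleftrightarrow> x = m" using PiE_ext[OF x that(2)] by auto
      finally show "(\<Prod>i\<in>R. indicator {m i} (x i) :: ennreal) = indicator {m} x" by (simp add: indicator_def)
    qed
    also have "\<dots> = emeasure M {m}" using that sets by (intro nn_integral_indicator) auto
    finally show ?thesis ..
  qed
  show ?thesis
  proof (rule measure_eqI_countable'[of _ "R \<rightarrow>\<^sub>E UNIV"])
    show "countable (R \<rightarrow>\<^sub>E (UNIV :: nat set))" using R by (intro countable_PiE) auto
    fix a assume "a \<in> R \<rightarrow>\<^sub>E (UNIV :: nat set)"
    thus "emeasure M1 {a} = emeasure M2 {a}" using pt ind by simp
  qed (use space sets in auto)
qed

section \<open>Laws of point processes determined by factorial moments\<close>

text \<open>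
  Since \<open>enn2real \<infinity> = 0\<close>, sets with infinitely many points get the value \<open>0\<close>.
\<close>

definition point_count :: "'a::topological_space measure \<Rightarrow> 'a set \<Rightarrow> nat" where
  "point_count m D = nat \<lfloor>enn2real (emeasure m D)\<rfloor>"

lemma emeasure_eq_point_count:
  assumes "m \<in> configurations" "D \<in> sets borel" "emeasure m D \<noteq> \<infinity>"
  shows "emeasure m D = of_nat (point_count m D)"
proof -
  obtain j :: nat where "emeasure m D = of_nat j" using assms by (auto simp: configurations_def)
  thus ?thesis by (simp add: point_count_def ennreal_of_nat_eq_real_of_nat)
qed

lemma sets_configuration: "m \<in> configurations \<Longrightarrow> sets m = sets borel"
  by (simp add: configurations_def radon_measure_def)

lemma emeasure_config_finite:
  assumes "m \<in> configurations" "emeasure m UNIV \<noteq> \<infinity>"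
  shows "emeasure m D \<noteq> \<infinity>"
  using emeasure_mono[of D UNIV m] assms sets_configuration[OF assms(1)]
  by (auto simp: top_unique)

lemma emeasure_eq_count_of_finite_config:
  assumes "m \<in> configurations \<and> emeasure m UNIV \<noteq> \<infinity>" "D \<in> sets borel"
  shows "emeasure m D = of_nat (point_count m D)"
  using assms emeasure_eq_point_count emeasure_config_finite by blast

lemma point_count_measurable:
  assumes "D \<in> sets borel"
  shows "(\<lambda>m. point_count m D) \<in> measurable config_space (count_space UNIV)"
proof -
  note [measurable] = measurable_emeasure_config[OF assms]
  show ?thesis unfolding point_count_def by measurable
qed

lemma falling_eq_binomial: "falling (of_nat N) k = of_nat (fact k) * of_nat (N choose k)"
proof -
  have "(\<Prod>j<k. N - j) = fact k * (N choose k)"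
  proof (induction k)
    case (Suc k)
    have "(\<Prod>j<Suc k. N - j) = fact k * ((N choose k) * (N - k))" by (simp add: Suc)
    also have "(N choose k) * (N - k) = Suc k * (N choose Suc k)"
      using binomial_absorb_comp[of N k] binomial_absorption[of k "N"] by (cases N) (simp_all add: mult.commute)
    finally show ?case by (simp add: algebra_simps)
  qed simp
  thus ?thesis by (simp only: falling_of_nat of_nat_mult)
qed

lemma of_nat_mult_cancel_ennreal:
  "n \<noteq> 0 \<Longrightarrow> of_nat n * a = of_nat n * (b::ennreal) \<Longrightarrow> a = b"
  by (simp add: ennreal_mult_cancel_left ennreal_of_nat_eq_real_of_nat)

lemma falling_measurable:
  assumes "D \<in> sets borel"
  shows "(\<lambda>m. falling (emeasure m D) k) \<in> borel_measurable config_space"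
proof -
  note [measurable] = measurable_emeasure_config[OF assms]
  show ?thesis unfolding falling_def by measurable
qed

lemma falling_1: "falling x 1 = x" "falling x (Suc 0) = x"
  by (simp_all add: falling_def)

lemma AE_config_finite:
  assumes sets: "sets M = sets config_space" and b: "(\<integral>\<^sup>+m. falling (emeasure m UNIV) 1 \<partial>M) < \<infinity>"
  shows "AE m in M. m \<in> configurations \<and> emeasure m UNIV \<noteq> \<infinity>"
proof -
  have "(\<lambda>m. emeasure m UNIV) \<in> borel_measurable M"
    using measurable_emeasure_config[of UNIV] measurable_cong_sets[OF sets refl] by auto
  hence "AE m in M. emeasure m UNIV \<noteq> \<infinity>"
    using b by (intro nn_integral_PInf_AE) (auto simp: falling_1)
  moreover have "AE m in M. m \<in> configurations"
    unfolding space_config_space[symmetric] sets_eq_imp_space_eq[OF sets, symmetric] by (rule AE_space)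
  ultimately show ?thesis by eventually_elim simp
qed

text \<open>
  By the binomial theorem, the expectation of \<open>(1 + \<delta>)\<^sup>N\<close> is the sum of the expectations of
  \<open>\<delta>\<^sup>k (N choose k)\<close>, which are at most \<open>(\<delta> T)\<^sup>k\<close>; \<open>\<delta>\<close> is chosen so that this is a
  convergent geometric series.
\<close>

lemma exponential_moment_finite:
  fixes T :: real
  assumes sets: "sets M = sets config_space" and T: "0 \<le> T"
    and bound: "\<And>k. (\<integral>\<^sup>+m. falling (emeasure m UNIV) k \<partial>M) \<le> of_nat (fact k) * ennreal T ^ k"
  defines "\<delta> \<equiv> 1 / (2 * (T + 1))"
  shows "(\<integral>\<^sup>+m. ennreal ((1 + \<delta>) ^ point_count m UNIV) \<partial>M) < \<infinity>"
proof -
  have \<delta>: "0 < \<delta>" "\<delta> * T \<le> 1 / 2" using T by (auto simp: \<delta>_def field_simps)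
  have fin: "AE m in M. m \<in> configurations \<and> emeasure m UNIV \<noteq> \<infinity>"
    by (rule AE_config_finite[OF sets])
       (use bound[of 1] in \<open>auto intro: le_less_trans[OF _ ennreal_less_top[of T]]\<close>)
  have [measurable]: "(\<lambda>m. point_count m UNIV) \<in> measurable M (count_space UNIV)"
    using point_count_measurable[of UNIV] measurable_cong_sets[OF sets refl] by auto
  have expand: "ennreal ((1 + \<delta>) ^ N) = (\<Sum>k. ennreal (\<delta> ^ k) * of_nat (N choose k))" for N
  proof -
    have "(\<Sum>k. ennreal (\<delta> ^ k) * of_nat (N choose k)) = (\<Sum>k\<le>N. ennreal (\<delta> ^ k) * of_nat (N choose k))"
      by (rule suminf_finite) (auto simp: binomial_eq_0)
    also have "\<dots> = (\<Sum>k\<le>N. ennreal (real (N choose k) * \<delta> ^ k))"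
      using \<delta> by (intro sum.cong refl) (simp add: ennreal_mult ennreal_of_nat_eq_real_of_nat mult.commute)
    also have "\<dots> = ennreal (\<Sum>k\<le>N. real (N choose k) * \<delta> ^ k)"
      using \<delta> by (intro sum_ennreal) auto
    also have "(\<Sum>k\<le>N. real (N choose k) * \<delta> ^ k) = (1 + \<delta>) ^ N"
      using binomial_ring[of \<delta> 1 N] by (simp add: add.commute)
    finally show ?thesis ..
  qed
  have binom: "(\<integral>\<^sup>+m. of_nat (point_count m UNIV choose k) \<partial>M) \<le> ennreal T ^ k" for k
  proof -
    have "of_nat (fact k) * (\<integral>\<^sup>+m. of_nat (point_count m UNIV choose k) \<partial>M) =
        (\<integral>\<^sup>+m. of_nat (fact k) * of_nat (point_count m UNIV choose k) \<partial>M)"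
      by (intro nn_integral_cmult[symmetric]) measurable
    also have "\<dots> = (\<integral>\<^sup>+m. falling (emeasure m UNIV) k \<partial>M)"
      using fin by (intro nn_integral_cong_AE) (auto simp: emeasure_eq_point_count falling_eq_binomial)
    also have "\<dots> \<le> of_nat (fact k) * ennreal T ^ k" by (rule bound)
    finally show ?thesis
      by (simp add: ennreal_mult_le_mult_iff ennreal_of_nat_eq_real_of_nat)
  qed
  have "(\<integral>\<^sup>+m. ennreal ((1 + \<delta>) ^ point_count m UNIV) \<partial>M) =
      (\<Sum>k. \<integral>\<^sup>+m. ennreal (\<delta> ^ k) * of_nat (point_count m UNIV choose k) \<partial>M)"
    unfolding expand by (rule nn_integral_suminf) measurable
  also have "\<dots> \<le> (\<Sum>k. ennreal ((1 / 2) ^ k))"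
  proof (rule suminf_le)
    fix k
    have "(\<integral>\<^sup>+m. ennreal (\<delta> ^ k) * of_nat (point_count m UNIV choose k) \<partial>M) =
        ennreal (\<delta> ^ k) * (\<integral>\<^sup>+m. of_nat (point_count m UNIV choose k) \<partial>M)"
      by (intro nn_integral_cmult) measurable
    also have "\<dots> \<le> ennreal (\<delta> ^ k) * ennreal T ^ k" by (intro mult_left_mono binom) simp
    also have "\<dots> = ennreal ((\<delta> * T) ^ k)"
      using \<delta> T by (simp add: ennreal_power ennreal_mult power_mult_distrib)
    also have "\<dots> \<le> ennreal ((1 / 2) ^ k)"
      using \<delta> T by (intro ennreal_leI power_mono) auto
    finally show "(\<integral>\<^sup>+m. ennreal (\<delta> ^ k) * of_nat (point_count m UNIV choose k) \<partial>M) \<le> ennreal ((1 / 2) ^ k)" .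
  qed auto
  also have "\<dots> = ennreal 2"
    by (rule suminf_ennreal_eq) (use geometric_sums[of "1/2::real"] in auto)
  also have "\<dots> < \<infinity>" by simp
  finally show ?thesis .
qed

text \<open>
  The sigma-algebra on configurations is the pullback of a product sigma-algebra under
  \<open>m \<mapsto> (m(D))\<^sub>D\<close>, and a finite measure on a product is determined by its values on
  cylinder sets.
\<close>

lemma config_measure_eqI:
  fixes M1 M2 :: "'a::topological_space measure measure"
  assumes fm: "finite_measure M1" and sets: "sets M1 = sets config_space" "sets M2 = sets config_space"
    and joint: "\<And>J A. finite J \<Longrightarrow> J \<subseteq> sets borel \<Longrightarrow> (\<And>D. D \<in> J \<Longrightarrow> A D \<in> sets borel) \<Longrightarrow>
      emeasure M1 {m\<in>configurations. \<forall>D\<in>J. emeasure m D \<in> A D} =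
      emeasure M2 {m\<in>configurations. \<forall>D\<in>J. emeasure m D \<in> A D}"
  shows "M1 = M2"
proof -
  have space: "space M1 = configurations" "space M2 = configurations"
    using sets[THEN sets_eq_imp_space_eq] by (simp_all add: space_config_space)
  have meas: "f \<in> measurable M N" if "M \<in> {M1, M2}" "f \<in> measurable config_space N" for f M and N :: "'x measure"
    using that sets measurable_cong_sets[OF _ refl] by blast
  let ?Y = "\<lambda>m. \<lambda>D\<in>sets borel. emeasure m D :: ennreal"
  let ?PB = "Pi\<^sub>M (sets borel) (\<lambda>_. borel :: ennreal measure) :: ('a set \<Rightarrow> ennreal) measure"
  have Y: "?Y \<in> measurable config_space ?PB"
    by (intro measurable_restrict measurable_emeasure_config)
  have "distr M1 ?PB ?Y = distr M2 ?PB ?Y"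
  proof (rule measure_eqI_PiM_infinite)
    fix A J assume J: "finite J" "J \<subseteq> sets (borel :: 'a measure)" "\<And>D. D \<in> J \<Longrightarrow> A D \<in> sets (borel :: ennreal measure)"
    have "emeasure (distr M ?PB ?Y) (prod_emb (sets borel) (\<lambda>_. borel) J (Pi\<^sub>E J A)) =
       emeasure M {m\<in>configurations. \<forall>D\<in>J. emeasure m D \<in> A D}" if M: "M \<in> {M1, M2}" for M
    proof -
      have "emeasure (distr M ?PB ?Y) (prod_emb (sets borel) (\<lambda>_. borel) J (Pi\<^sub>E J A)) =
        emeasure M (?Y -` prod_emb (sets borel) (\<lambda>_. borel) J (Pi\<^sub>E J A) \<inter> space M)"
        using J by (intro emeasure_distr meas[OF M Y] sets_PiM_I) auto
      also have "?Y -` prod_emb (sets borel) (\<lambda>_. borel) J (Pi\<^sub>E J A) \<inter> space M = {m\<in>configurations. \<forall>D\<in>J. emeasure m D \<in> A D}"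
        using M space J(2) by (auto simp: prod_emb_def PiE_iff subset_iff restrict_def extensional_def)
      finally show ?thesis .
    qed
    thus "emeasure (distr M1 ?PB ?Y) (prod_emb (sets borel) (\<lambda>_. borel) J (Pi\<^sub>E J A)) =
          emeasure (distr M2 ?PB ?Y) (prod_emb (sets borel) (\<lambda>_. borel) J (Pi\<^sub>E J A))"
      using joint[OF J] by simp
  next
    show "finite_measure (distr M1 ?PB ?Y)"
      by (rule finite_measure.finite_measure_distr[OF fm]) (use meas[OF _ Y] in auto)
  qed simp_all
  note laws = this
  have id: "(\<lambda>m. m) \<in> measurable (vimage_algebra configurations ?Y ?PB) config_space"
  proof (rule measurable_config_space)
    fix D assume D: "D \<in> sets (borel :: 'a measure)"
    have Yv: "?Y \<in> measurable (vimage_algebra configurations ?Y ?PB) ?PB"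
      by (rule measurable_vimage_algebra1) (auto simp: space_PiM)
    have "(\<lambda>m. ?Y m D) \<in> borel_measurable (vimage_algebra configurations ?Y ?PB)"
      by (rule measurable_compose[OF Yv measurable_component_singleton[OF D]])
    thus "(\<lambda>m. emeasure m D) \<in> borel_measurable (vimage_algebra configurations ?Y ?PB)"
      using D by simp
  qed simp
  show ?thesis
  proof (rule measure_eqI)
    fix E assume E: "E \<in> sets M1"
    hence Ec: "E \<in> sets config_space" using sets by simp
    have "E \<subseteq> configurations" using sets.sets_into_space[OF E] space by simp
    hence "E \<in> sets (vimage_algebra configurations ?Y ?PB)"
      using measurable_sets[OF id Ec] by (simp add: Int_absorb2)
    then obtain B where B: "B \<in> sets ?PB" "E = ?Y -` B \<inter> configurations"
      by (subst (asm) sets_vimage_algebra2) (auto simp: space_PiM)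
    have "emeasure M E = emeasure (distr M ?PB ?Y) B" if "M \<in> {M1, M2}" for M
      using emeasure_distr[OF meas[OF that Y] B(1)] B(2) that space by auto
    thus "emeasure M1 E = emeasure M2 E" using laws by simp
  qed (simp add: sets)
qed

text \<open>
  For disjoint sets the vector of counts has an exponential moment and is therefore determined
  by its binomial moments. Finitely many arbitrary sets are unions of the disjoint atoms of the
  algebra that they generate.
\<close>

lemma config_law_eqI:
  fixes M1 M2 :: "'a::topological_space measure measure" and T :: real
  assumes fm: "finite_measure M1"
    and sets: "sets M1 = sets config_space" "sets M2 = sets config_space" and T: "0 \<le> T"
    and bound: "\<And>k. (\<integral>\<^sup>+m. falling (emeasure m UNIV) k \<partial>M1) \<le> of_nat (fact k) * ennreal T ^ k"
    and eq: "\<And>(r::nat) D ks. (\<And>i. i < r \<Longrightarrow> D i \<in> sets borel) \<Longrightarrow> disjoint_family_on D {..<r} \<Longrightarrow>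
       (\<integral>\<^sup>+m. (\<Prod>i<r. falling (emeasure m (D i)) (ks i)) \<partial>M1) =
       (\<integral>\<^sup>+m. (\<Prod>i<r. falling (emeasure m (D i)) (ks i)) \<partial>M2)"
  shows "M1 = M2"
proof -
  define \<delta> where "\<delta> = 1 / (2 * (T + 1))"
  have \<delta>: "0 < \<delta>" using T by (simp add: \<delta>_def)
  have bound2: "(\<integral>\<^sup>+m. falling (emeasure m UNIV) k \<partial>M2) \<le> of_nat (fact k) * ennreal T ^ k" for k
    using bound[of k] eq[of 1 "\<lambda>_. UNIV" "\<lambda>_. k"] by (simp add: disjoint_family_on_def)
  have space: "space M1 = configurations" "space M2 = configurations"
    using sets[THEN sets_eq_imp_space_eq] by (simp_all add: space_config_space)
  have meas: "f \<in> measurable M N" if "M \<in> {M1, M2}" "f \<in> measurable config_space N" for f M and N :: "'x measure"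
    using that sets measurable_cong_sets[OF _ refl] by blast
  have fin: "AE m in M. m \<in> configurations \<and> emeasure m UNIV \<noteq> \<infinity>" if "M \<in> {M1, M2}" for M
    using that bound[of 1] bound2[of 1] sets
    by (intro AE_config_finite) (auto intro: le_less_trans[OF _ ennreal_less_top[of T]])
  have expo: "(\<integral>\<^sup>+m. ennreal ((1 + \<delta>) ^ point_count m UNIV) \<partial>M) < \<infinity>" if "M \<in> {M1, M2}" for M
    using that exponential_moment_finite[OF sets(1) T bound] exponential_moment_finite[OF sets(2) T bound2]
    unfolding \<delta>_def by auto
  have counts: "distr M1 (count_space ({..<r} \<rightarrow>\<^sub>E UNIV)) (\<lambda>m. \<lambda>i\<in>{..<r}. point_count m (D i)) =
      distr M2 (count_space ({..<r} \<rightarrow>\<^sub>E UNIV)) (\<lambda>m. \<lambda>i\<in>{..<r}. point_count m (D i))"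
    and counts_meas: "(\<lambda>m. \<lambda>i\<in>{..<r}. point_count m (D i)) \<in> measurable config_space (count_space ({..<r} \<rightarrow>\<^sub>E UNIV))"
    if D: "\<And>i. i < r \<Longrightarrow> D i \<in> sets borel" and disj: "disjoint_family_on D {..<r}" for r and D :: "nat \<Rightarrow> 'a set"
  proof -
    let ?X = "\<lambda>m. \<lambda>i\<in>{..<r}. point_count m (D i)"
    have "?X \<in> measurable config_space (Pi\<^sub>M {..<r} (\<lambda>_. count_space UNIV))"
      using D by (intro measurable_restrict point_count_measurable) auto
    thus X: "?X \<in> measurable config_space (count_space ({..<r} \<rightarrow>\<^sub>E UNIV))"
      by (simp add: count_space_PiM_finite)
    note XM = meas[OF _ X]
    have distr: "(\<integral>\<^sup>+x. f x \<partial>distr M (count_space ({..<r} \<rightarrow>\<^sub>E UNIV)) ?X) = (\<integral>\<^sup>+m. f (?X m) \<partial>M)"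
      if "M \<in> {M1, M2}" for f :: "(nat \<Rightarrow> nat) \<Rightarrow> ennreal" and M
      using XM[OF that] by (intro nn_integral_distr) auto
    show "distr M1 (count_space ({..<r} \<rightarrow>\<^sub>E UNIV)) ?X = distr M2 (count_space ({..<r} \<rightarrow>\<^sub>E UNIV)) ?X"
    proof (rule joint_binomial_moments_determine_law[OF _ \<delta>])
      have le: "(\<integral>\<^sup>+m. ennreal ((1 + \<delta>) ^ (\<Sum>i<r. ?X m i)) \<partial>M) < \<infinity>" if M: "M \<in> {M1, M2}" for M
      proof -
        have "(\<integral>\<^sup>+m. ennreal ((1 + \<delta>) ^ (\<Sum>i<r. ?X m i)) \<partial>M) \<le> (\<integral>\<^sup>+m. ennreal ((1 + \<delta>) ^ point_count m UNIV) \<partial>M)"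
          using fin[OF M]
        proof (intro nn_integral_mono_AE, eventually_elim)
          case (elim m)
          have "of_nat (\<Sum>i<r. point_count m (D i)) = (\<Sum>i<r. emeasure m (D i))"
            by (simp add: emeasure_eq_count_of_finite_config[OF elim(2) D])
          also have "\<dots> = emeasure m (\<Union>i<r. D i)"
            using elim D disj by (intro sum_emeasure) (auto simp: sets_configuration)
          also have "\<dots> \<le> emeasure m UNIV" using elim by (intro emeasure_mono) (auto simp: sets_configuration)
          also have "\<dots> = of_nat (point_count m UNIV)" using elim by (intro emeasure_eq_point_count) auto
          finally have "(\<Sum>i<r. point_count m (D i)) \<le> point_count m UNIV"
            by (simp only: of_nat_le_iff)
          thus ?case using \<delta> by (intro ennreal_leI power_increasing) auto
        qed
        also have "\<dots> < \<infinity>" by (rule expo[OF M])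
        finally show ?thesis .
      qed
      show "(\<integral>\<^sup>+x. ennreal ((1 + \<delta>) ^ (\<Sum>i<r. x i)) \<partial>distr M1 (count_space ({..<r} \<rightarrow>\<^sub>E UNIV)) ?X) < \<infinity>"
        "(\<integral>\<^sup>+x. ennreal ((1 + \<delta>) ^ (\<Sum>i<r. x i)) \<partial>distr M2 (count_space ({..<r} \<rightarrow>\<^sub>E UNIV)) ?X) < \<infinity>"
        by (subst distr; use le in blast)+
      fix ks :: "nat \<Rightarrow> nat"
      let ?c = "\<Prod>i<r. fact (ks i) :: nat"
      have b: "of_nat ?c * (\<integral>\<^sup>+m. (\<Prod>i<r. of_nat (?X m i choose ks i)) \<partial>M) =
          (\<integral>\<^sup>+m. (\<Prod>i<r. falling (emeasure m (D i)) (ks i)) \<partial>M)" if M: "M \<in> {M1, M2}" for M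
      proof -
        have "(\<lambda>x. \<Prod>i<r. of_nat (x i choose ks i) :: ennreal) \<in> borel_measurable (count_space ({..<r} \<rightarrow>\<^sub>E UNIV))"
          by simp
        from measurable_compose[OF XM[OF M] this]
        have "of_nat ?c * (\<integral>\<^sup>+m. (\<Prod>i<r. of_nat (?X m i choose ks i)) \<partial>M) =
            (\<integral>\<^sup>+m. of_nat ?c * (\<Prod>i<r. of_nat (?X m i choose ks i)) \<partial>M)"
          by (intro nn_integral_cmult[symmetric])
        also have "\<dots> = (\<integral>\<^sup>+m. (\<Prod>i<r. falling (emeasure m (D i)) (ks i)) \<partial>M)"
          using fin[OF M]
        proof (intro nn_integral_cong_AE, eventually_elim)
          case (elim m)
          have "(\<Prod>i<r. falling (emeasure m (D i)) (ks i)) = (\<Prod>i<r. of_nat (fact (ks i)) * of_nat (?X m i choose ks i))"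
            by (intro prod.cong refl) (simp add: emeasure_eq_count_of_finite_config[OF elim(2) D] falling_eq_binomial)
          thus ?case by (simp only: prod.distrib of_nat_prod)
        qed
        finally show ?thesis .
      qed
      have "of_nat ?c * (\<integral>\<^sup>+m. (\<Prod>i<r. of_nat (?X m i choose ks i)) \<partial>M1) =
          of_nat ?c * (\<integral>\<^sup>+m. (\<Prod>i<r. of_nat (?X m i choose ks i)) \<partial>M2)"
        by (subst (1 2) b) (use eq[OF D disj] in auto)
      moreover have "?c \<noteq> 0" by simp
      ultimately have "(\<integral>\<^sup>+m. (\<Prod>i<r. of_nat (?X m i choose ks i)) \<partial>M1) = (\<integral>\<^sup>+m. (\<Prod>i<r. of_nat (?X m i choose ks i)) \<partial>M2)"
        by (rule of_nat_mult_cancel_ennreal[rotated])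
      thus "(\<integral>\<^sup>+x. (\<Prod>i<r. of_nat (x i choose ks i)) \<partial>distr M1 (count_space ({..<r} \<rightarrow>\<^sub>E UNIV)) ?X) =
            (\<integral>\<^sup>+x. (\<Prod>i<r. of_nat (x i choose ks i)) \<partial>distr M2 (count_space ({..<r} \<rightarrow>\<^sub>E UNIV)) ?X)"
        by (subst (1 2) distr) auto
    qed auto
  qed
  have joint: "emeasure M1 {m\<in>configurations. \<forall>D\<in>J. emeasure m D \<in> A D} = emeasure M2 {m\<in>configurations. \<forall>D\<in>J. emeasure m D \<in> A D}"
    if J: "finite J" "J \<subseteq> sets borel" and A: "\<And>D. D \<in> J \<Longrightarrow> A D \<in> sets borel" for J :: "'a set set" and A
  proof -
    obtain S where S: "bij_betw S {..<card (Pow J)} (Pow J)"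
      using ex_bij_betw_nat_finite[of "Pow J"] J by (auto simp: atLeast0LessThan)
    define r where "r = card (Pow J)"
    \<comment> \<open>The atom \<open>i\<close> consists of the points that lie in exactly the members \<open>S i\<close> of \<open>J\<close>.\<close>
    define atom where "atom i = {x. \<forall>D\<in>J. x \<in> D \<longleftrightarrow> D \<in> S i}" for i
    have Sinj: "S i = S j \<Longrightarrow> i < r \<Longrightarrow> j < r \<Longrightarrow> i = j" and Ssub: "i < r \<Longrightarrow> S i \<subseteq> J" for i j
      using S by (auto simp: bij_betw_def inj_on_def r_def)
    have Ssurj: "\<exists>i<r. S i = s" if "s \<subseteq> J" for s
    proof -
      have "s \<in> S ` {..<r}" using S that by (auto simp: bij_betw_def r_def)
      thus ?thesis by auto
    qed
    have atom_sets: "atom i \<in> sets borel" for i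
    proof -
      have "atom i = (\<Inter>D\<in>J. if D \<in> S i then D else - D) \<inter> UNIV"
        by (auto simp: atom_def split: if_splits)
      also have "\<dots> \<in> sets borel"
      proof (cases "J = {}")
        case False
        have "(\<Inter>D\<in>J. if D \<in> S i then D else - D) \<in> sets borel"
          by (rule sets.finite_INT[OF J(1) False]) (use J in auto)
        thus ?thesis by (simp only: Int_UNIV_right)
      qed simp
      finally show ?thesis .
    qed
    have disj: "disjoint_family_on atom {..<r}"
      unfolding disjoint_family_on_def
    proof (intro ballI impI)
      fix i j assume ij: "i \<in> {..<r}" "j \<in> {..<r}" "i \<noteq> j"
      hence "S i \<noteq> S j" using Sinj by auto
      then obtain D where "D \<in> J" "(D \<in> S i) \<noteq> (D \<in> S j)" using Ssub ij by blast
      thus "atom i \<inter> atom j = {}" by (auto simp: atom_def)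
    qed
    have D_eq: "D = (\<Union>i\<in>{i. i < r \<and> D \<in> S i}. atom i)" if "D \<in> J" for D
    proof (intro equalityI subsetI)
      fix x assume "x \<in> D"
      obtain i where "i < r" "S i = {D\<in>J. x \<in> D}" using Ssurj[of "{D\<in>J. x \<in> D}"] by auto
      thus "x \<in> (\<Union>i\<in>{i. i < r \<and> D \<in> S i}. atom i)"
        using \<open>x \<in> D\<close> that by (auto simp: atom_def intro!: exI[of _ i])
    qed (use that in \<open>auto simp: atom_def\<close>)
    let ?X = "\<lambda>m. \<lambda>i\<in>{..<r}. point_count m (atom i)"
    define V where "V = {v \<in> {..<r} \<rightarrow>\<^sub>E UNIV. \<forall>D\<in>J. of_nat (\<Sum>i | i < r \<and> D \<in> S i. v i) \<in> A D}"
    note X = counts_meas[OF atom_sets disj]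
    have em: "emeasure M {m\<in>configurations. \<forall>D\<in>J. emeasure m D \<in> A D} =
       emeasure (distr M (count_space ({..<r} \<rightarrow>\<^sub>E UNIV)) ?X) V" if M: "M \<in> {M1, M2}" for M
    proof -
      have sM: "space M = configurations" using M space by auto
      have V: "V \<in> sets (count_space ({..<r} \<rightarrow>\<^sub>E UNIV))" by (auto simp: V_def)
      have "emeasure (distr M (count_space ({..<r} \<rightarrow>\<^sub>E UNIV)) ?X) V = emeasure M (?X -` V \<inter> space M)"
        by (rule emeasure_distr[OF meas[OF M X] V])
      also have "\<dots> = emeasure M {m\<in>configurations. \<forall>D\<in>J. emeasure m D \<in> A D}"
      proof (rule emeasure_eq_AE)
        show "AE m in M. m \<in> ?X -` V \<inter> space M \<longleftrightarrow> m \<in> {m\<in>configurations. \<forall>D\<in>J. emeasure m D \<in> A D}"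
          using fin[OF M]
        proof eventually_elim
          case (elim m)
          have "emeasure m D = of_nat (\<Sum>i | i < r \<and> D \<in> S i. ?X m i)" if "D \<in> J" for D
          proof -
            have "emeasure m D = emeasure m (\<Union>i\<in>{i. i < r \<and> D \<in> S i}. atom i)" using D_eq[OF that] by simp
            also have "\<dots> = (\<Sum>i | i < r \<and> D \<in> S i. emeasure m (atom i))"
              using elim disj atom_sets
              by (intro sum_emeasure[symmetric]) (auto simp: sets_configuration disjoint_family_on_def)
            also have "\<dots> = (\<Sum>i | i < r \<and> D \<in> S i. of_nat (?X m i))"
              by (intro sum.cong refl) (simp add: emeasure_eq_count_of_finite_config[OF elim atom_sets])
            finally show ?thesis by simp
          qed
          hence "(\<forall>D\<in>J. emeasure m D \<in> A D) \<longleftrightarrow> ?X m \<in> V" by (auto simp: V_def)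
          thus ?case using elim sM by auto
        qed
        show "?X -` V \<inter> space M \<in> sets M" by (rule measurable_sets[OF meas[OF M X] V])
        have "{m\<in>space M. \<forall>D\<in>J. emeasure m D \<in> A D} \<in> sets M"
        proof (rule sets.sets_Collect_finite_All)
          fix D assume D: "D \<in> J"
          have "(\<lambda>m. emeasure m D) \<in> borel_measurable M"
            using D J by (intro meas[OF M] measurable_emeasure_config) auto
          from measurable_sets[OF this A[OF D]]
          show "{m \<in> space M. emeasure m D \<in> A D} \<in> sets M" by (simp add: vimage_def Int_def conj_commute)
        qed (rule J)
        thus "{m\<in>configurations. \<forall>D\<in>J. emeasure m D \<in> A D} \<in> sets M" by (simp add: sM)
      qed
      finally show ?thesis ..
    qed
    show ?thesis
      by (subst (1 2) em) (use counts[OF atom_sets disj] in auto)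
  qed
  show ?thesis by (rule config_measure_eqI[OF fm sets joint])
qed

section \<open>The mixture over occupation numbers\<close>

lemma countable_finitely_supported: "countable {f :: nat \<Rightarrow> nat. finite {k. f k \<noteq> 0}}"
proof (rule countable_subset)
  show "{f :: nat \<Rightarrow> nat. finite {k. f k \<noteq> 0}} \<subseteq> range (\<lambda>xs k. if k < length xs then xs ! k else 0)"
  proof
    fix f :: "nat \<Rightarrow> nat" assume "f \<in> {f. finite {k. f k \<noteq> 0}}"
    then obtain n where n: "\<And>k. f k \<noteq> 0 \<Longrightarrow> k < n"
      by (auto simp: finite_nat_iff_bounded)
    have "f = (\<lambda>k. if k < length (map f [0..<n]) then map f [0..<n] ! k else 0)"
      using n by (auto simp: fun_eq_iff)
    thus "f \<in> range (\<lambda>xs k. if k < length xs then xs ! k else 0)" by blast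
  qed
qed simp

lemma occupation_law_cong:
  assumes "\<And>k. k \<in> I \<Longrightarrow> \<alpha> k = \<beta> k"
  shows "occupation_law \<mu> I \<phi> \<alpha> = occupation_law \<mu> I \<phi> \<beta>"
proof -
  have supp: "supp I \<alpha> = supp I \<beta>" using assms by (auto simp: supp_def)
  have eq: "\<alpha> k = \<beta> k" if "k \<in> supp I \<beta>" for k using assms that by (auto simp: supp_def)
  have total: "total I \<alpha> = total I \<beta>" unfolding total_def supp by (intro sum.cong refl eq)
  show ?thesis
  proof (cases "finite (supp I \<beta>)")
    case True
    have "row_labels I \<alpha> = row_labels I \<beta>"
      unfolding row_labels_def supp using True by (intro arg_cong[where f=concat] map_cong refl) (simp add: eq)
    moreover have "(\<Prod>k\<in>supp I \<beta>. fact (\<alpha> k)) = (\<Prod>k\<in>supp I \<beta>. fact (\<beta> k) :: real)"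
      by (intro prod.cong refl) (simp add: eq)
    ultimately have "occupation_density I \<phi> \<alpha> = occupation_density I \<phi> \<beta>"
      by (simp add: fun_eq_iff occupation_density_def occupation_matrix_def[abs_def] supp total)
    thus ?thesis by (simp add: occupation_law_def Z_law_def supp total)
  qed (simp add: occupation_law_def supp)
qed

lemma null_measure_configuration: "null_measure borel \<in> configurations"
  by (auto simp: configurations_def radon_measure_def intro!: exI[of _ 0])

context trace_class_family begin

lemma config_of_measurable: "config_of l \<in> measurable (Pi\<^sub>M {..<l} (\<lambda>_. \<mu>)) config_space"
proof (rule measurable_config_space)
  fix D :: "'a set" assume D: "D \<in> sets borel"
  have "(\<lambda>z. \<Sum>j<l. indicator D (z j) :: ennreal) \<in> borel_measurable (Pi\<^sub>M {..<l} (\<lambda>_. \<mu>))"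
  proof (rule borel_measurable_sum)
    fix j assume "j \<in> {..<l}"
    thus "(\<lambda>z. indicator D (z j) :: ennreal) \<in> borel_measurable (Pi\<^sub>M {..<l} (\<lambda>_. \<mu>))"
      using D sets_mu by (intro measurable_compose[OF measurable_component_singleton borel_measurable_indicator]) auto
  qed
  moreover have "emeasure (config_of l z) D = (\<Sum>j<l. indicator D (z j))" for z
  proof -
    have "(\<Sum>j<l. indicator D (z j) :: ennreal) = (\<Sum>j | j < l \<and> z j \<in> D. 1)"
      by (rule sum.mono_neutral_cong_right) (auto simp: indicator_def)
    thus ?thesis using D by (simp add: emeasure_config_of)
  qed
  ultimately show "(\<lambda>z. emeasure (config_of l z) D) \<in> borel_measurable (Pi\<^sub>M {..<l} (\<lambda>_. \<mu>))" by simp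
qed (rule config_of_in_configurations)

lemma config_of_measurable_Z: "config_of (total I \<alpha>) \<in> measurable (Z_law \<mu> I \<phi> \<alpha>) config_space"
  using config_of_measurable by (simp add: Z_law_def)

lemma prob_space_Z_law:
  assumes "finite (supp I \<alpha>)"
  shows "prob_space (Z_law \<mu> I \<phi> \<alpha>)"
proof
  have "point_tuples z l [] = {[]}" for z :: "nat \<Rightarrow> 'a" and l by (auto simp: point_tuples_def)
  thus "emeasure (Z_law \<mu> I \<phi> \<alpha>) (space (Z_law \<mu> I \<phi> \<alpha>)) = 1"
    using Z_law_factorial_moment[OF assms, of 0 "\<lambda>_. {}" 0 "\<lambda>_. 0"]
    by (simp add: blocks_def box_weight_0 sub_choose_def)
qed

lemma prob_space_occupation_law: "prob_space (occupation_law \<mu> I \<phi> \<alpha>)"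
  unfolding occupation_law_def
  using prob_space.prob_space_distr[OF prob_space_Z_law config_of_measurable_Z]
  by (auto intro!: prob_space_return simp: space_config_space null_measure_configuration)

lemma sets_occupation_law: "sets (occupation_law \<mu> I \<phi> \<alpha>) = sets config_space"
  by (simp add: occupation_law_def)

lemma occupation_law_in_subprob_algebra:
  "occupation_law \<mu> I \<phi> \<alpha> \<in> space (subprob_algebra config_space)"
  using prob_space_imp_subprob_space[OF prob_space_occupation_law]
  by (simp add: space_subprob_algebra sets_occupation_law)

lemma prod_falling_measurable:
  assumes "\<And>i. i < r \<Longrightarrow> D i \<in> sets borel"
  shows "(\<lambda>m. \<Prod>i<r. falling (emeasure m (D i)) (ks i)) \<in> borel_measurable config_space"
  using assms by (intro borel_measurable_prod_ennreal falling_measurable) auto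

lemma occupation_law_factorial_moment:
  assumes fin: "finite (supp I \<alpha>)" and D: "\<And>i. i < r \<Longrightarrow> D i \<in> sets borel"
    and disj: "disjoint_family_on D {..<r}" and k: "k = (\<Sum>i<r. ks i)"
  shows "of_nat (fact k) * (\<integral>\<^sup>+m. (\<Prod>i<r. falling (emeasure m (D i)) (ks i)) \<partial>occupation_law \<mu> I \<phi> \<alpha>) =
    (\<integral>\<^sup>+g. of_nat (sub_choose (g ` {..<k}) k \<alpha> g) * box_weight k (\<lambda>j. blocks r D ks ! j) g
       \<partial>count_space ({..<k} \<rightarrow>\<^sub>E I))"
proof -
  let ?A = "supp I \<alpha>" and ?w = "box_weight k (\<lambda>j. blocks r D ks ! j)"
  have "(\<integral>\<^sup>+m. (\<Prod>i<r. falling (emeasure m (D i)) (ks i)) \<partial>occupation_law \<mu> I \<phi> \<alpha>) =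
    (\<integral>\<^sup>+z. of_nat (card (point_tuples z (total I \<alpha>) (blocks r D ks))) \<partial>Z_law \<mu> I \<phi> \<alpha>)"
    using fin prod_falling_measurable[of r D ks, OF D]
    by (simp add: occupation_law_def nn_integral_distr[OF config_of_measurable_Z] prod_falling_config_of[OF disj D])
  hence "of_nat (fact k) * (\<integral>\<^sup>+m. (\<Prod>i<r. falling (emeasure m (D i)) (ks i)) \<partial>occupation_law \<mu> I \<phi> \<alpha>) =
    (\<Sum>g\<in>{..<k} \<rightarrow>\<^sub>E ?A. of_nat (sub_choose ?A k \<alpha> g) * ?w g)"
    using Z_law_factorial_moment[OF fin _ k, of D] D sets_mu by simp
  also have "\<dots> = (\<Sum>g\<in>{..<k} \<rightarrow>\<^sub>E ?A. of_nat (sub_choose (g ` {..<k}) k \<alpha> g) * ?w g)"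
  proof (intro sum.cong refl)
    fix g assume "g \<in> {..<k} \<rightarrow>\<^sub>E ?A"
    hence "g ` {..<k} \<subseteq> ?A" by (auto simp: PiE_iff)
    from sub_choose_superset[OF fin this]
    show "of_nat (sub_choose ?A k \<alpha> g) * ?w g = of_nat (sub_choose (g ` {..<k}) k \<alpha> g) * ?w g" by simp
  qed
  also have "\<dots> = (\<integral>\<^sup>+g. of_nat (sub_choose (g ` {..<k}) k \<alpha> g) * ?w g \<partial>count_space ({..<k} \<rightarrow>\<^sub>E I))"
  proof (rule nn_integral_count_space'[symmetric])
    show "finite ({..<k} \<rightarrow>\<^sub>E ?A)" using fin by (intro finite_PiE) auto
    show "({..<k} \<rightarrow>\<^sub>E ?A) \<subseteq> ({..<k} \<rightarrow>\<^sub>E I)" by (intro PiE_mono) (auto simp: supp_def)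
    fix g assume g: "g \<in> {..<k} \<rightarrow>\<^sub>E I" "g \<notin> {..<k} \<rightarrow>\<^sub>E ?A"
    then obtain i where i: "i < k" "\<alpha> (g i) = 0" by (auto simp: PiE_iff supp_def)
    have "card {j\<in>{..<k}. g j = g i} \<noteq> 0" using i by auto
    hence "\<alpha> (g i) choose card {j\<in>{..<k}. g j = g i} = 0"
      unfolding i(2) by (simp only: binomial_eq_0_iff neq0_conv)
    hence "sub_choose (g ` {..<k}) k \<alpha> g = 0"
      unfolding sub_choose_def using i by (intro prod_zero bexI[of _ "g i"]) simp_all
    thus "of_nat (sub_choose (g ` {..<k}) k \<alpha> g) * ?w g = 0" by simp
  qed
  finally show ?thesis .
qed

text \<open>
  As a function of the occupation numbers the law takes countably many values: one for each
  finitely supported vector, and one for all vectors of infinite support.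
\<close>

lemma occupation_law_measurable:
  fixes \<gamma> :: "nat \<Rightarrow> 'v \<Rightarrow> nat"
  assumes rv: "\<And>a. a \<in> I \<Longrightarrow> \<gamma> a \<in> measurable Q (count_space UNIV)"
  shows "(\<lambda>\<omega>. occupation_law \<mu> I \<phi> (\<lambda>k. \<gamma> k \<omega>)) \<in> measurable Q (subprob_algebra config_space)"
proof -
  define F where "F = {f :: nat \<Rightarrow> nat. finite {k. f k \<noteq> 0}}"
  \<comment> \<open>\<open>None\<close> encodes an infinite support; the values outside \<open>I\<close> are normalised to \<open>0\<close>.\<close>
  define enc where "enc \<omega> = (if finite (supp I (\<lambda>k. \<gamma> k \<omega>)) then Some (\<lambda>k. if k \<in> I then \<gamma> k \<omega> else 0) else None)" for \<omega>
  define dec where "dec = case_option (return config_space (null_measure borel)) (occupation_law \<mu> I \<phi>)"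
  let ?S = "insert None (Some ` F)"
  have F: "countable F" unfolding F_def by (rule countable_finitely_supported)
  have encF: "enc \<omega> \<in> ?S" for \<omega>
  proof -
    have "{k. (if k \<in> I then \<gamma> k \<omega> else 0) \<noteq> 0} = supp I (\<lambda>k. \<gamma> k \<omega>)" by (auto simp: supp_def)
    thus ?thesis by (auto simp: enc_def F_def simp del: if_split)
  qed
  have some: "enc -` {Some f} \<inter> space Q \<in> sets Q" if f: "f \<in> F" for f
  proof (cases "\<forall>k. k \<notin> I \<longrightarrow> f k = 0")
    case True
    have "enc -` {Some f} \<inter> space Q = {\<omega>\<in>space Q. \<forall>k. k \<in> I \<longrightarrow> \<gamma> k \<omega> = f k}"
    proof (intro equalityI subsetI)
      fix \<omega> assume \<omega>: "\<omega> \<in> {\<omega>\<in>space Q. \<forall>k. k \<in> I \<longrightarrow> \<gamma> k \<omega> = f k}"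
      hence "supp I (\<lambda>k. \<gamma> k \<omega>) \<subseteq> {k. f k \<noteq> 0}" by (auto simp: supp_def)
      hence "finite (supp I (\<lambda>k. \<gamma> k \<omega>))" using f finite_subset by (auto simp: F_def)
      thus "\<omega> \<in> enc -` {Some f} \<inter> space Q" using \<omega> True by (auto simp: enc_def fun_eq_iff)
    qed (auto simp: enc_def split: if_splits)
    also have "\<dots> \<in> sets Q"
    proof (rule sets.sets_Collect_countable_All)
      fix k
      show "{\<omega>\<in>space Q. k \<in> I \<longrightarrow> \<gamma> k \<omega> = f k} \<in> sets Q"
      proof (cases "k \<in> I")
        case True
        from measurable_sets[OF rv[OF True], of "{f k}"] show ?thesis
          using True by (simp add: vimage_def Int_def conj_commute)
      qed simp
    qed
    finally show ?thesis .
  next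
    case False
    hence "enc -` {Some f} \<inter> space Q = {}" by (auto simp: enc_def split: if_splits)
    thus ?thesis by simp
  qed
  have none: "enc -` {None} \<inter> space Q \<in> sets Q"
  proof -
    have "enc -` {None} \<inter> space Q = space Q - (\<Union>f\<in>F. enc -` {Some f} \<inter> space Q)"
      using encF by fastforce
    also have "\<dots> \<in> sets Q" using F some by (intro sets.Diff sets.countable_UN') auto
    finally show ?thesis .
  qed
  have "enc \<in> measurable Q (count_space ?S)"
    using F encF some none by (subst measurable_count_space_eq_countable) auto
  moreover have "dec \<in> measurable (count_space ?S) (subprob_algebra config_space)"
    using occupation_law_in_subprob_algebra
    by (auto simp: measurable_count_space_eq1 dec_def space_subprob_algebra space_config_space
        null_measure_configuration intro!: prob_space_imp_subprob_space prob_space_return split: option.splits)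
  ultimately have "(\<lambda>\<omega>. dec (enc \<omega>)) \<in> measurable Q (subprob_algebra config_space)"
    by (rule measurable_compose)
  moreover have "dec (enc \<omega>) = occupation_law \<mu> I \<phi> (\<lambda>k. \<gamma> k \<omega>)" for \<omega>
  proof (cases "finite (supp I (\<lambda>k. \<gamma> k \<omega>))")
    case True
    thus ?thesis by (simp add: dec_def enc_def) (rule occupation_law_cong, simp)
  qed (simp add: dec_def enc_def occupation_law_def)
  ultimately show ?thesis by simp
qed

lemma box_moment_0: "box_moment 0 B = 1"
  by (simp add: box_moment_def box_weight_0 nn_integral_count_space_finite)

end

locale geometric_occupation = trace_class_family \<mu> I \<phi> lam + Q: prob_space Q
  for \<mu> :: "'a::polish_space measure" and I \<phi> lam and Q :: "'v measure" +
  fixes \<gamma> :: "nat \<Rightarrow> 'v \<Rightarrow> nat"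
  assumes indep: "Q.indep_vars (\<lambda>_. count_space UNIV) \<gamma> I"
    and geometric: "\<And>k s. k \<in> I \<Longrightarrow>
      measure Q {\<omega>\<in>space Q. \<gamma> k \<omega> = s} = (lam k / (lam k + 1)) ^ s * (1 / (lam k + 1))"
begin

lemma gamma_measurable: "a \<in> I \<Longrightarrow> \<gamma> a \<in> measurable Q (count_space UNIV)"
  using indep by (auto simp: Q.indep_vars_def)

lemma mixture_kernel_measurable:
  "(\<lambda>\<omega>. occupation_law \<mu> I \<phi> (\<lambda>k. \<gamma> k \<omega>)) \<in> measurable Q (subprob_algebra config_space)"
  by (rule occupation_law_measurable[OF gamma_measurable])

abbreviation mixture :: "'a measure measure" where
  "mixture \<equiv> Q \<bind> (\<lambda>\<omega>. occupation_law \<mu> I \<phi> (\<lambda>k. \<gamma> k \<omega>))"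

text \<open>
  The expected total number of particles is the sum of the eigenvalues, which is finite.
\<close>

lemma AE_finite_supp: "AE \<omega> in Q. finite (supp I (\<lambda>k. \<gamma> k \<omega>))"
proof -
  have m: "(\<lambda>\<omega>. of_nat (\<gamma> k \<omega>) :: ennreal) \<in> borel_measurable Q" if "k \<in> I" for k
    using gamma_measurable[OF that] by measurable
  have "(\<integral>\<^sup>+\<omega>. \<integral>\<^sup>+k. of_nat (\<gamma> k \<omega>) \<partial>count_space I \<partial>Q) = (\<integral>\<^sup>+k. \<integral>\<^sup>+\<omega>. of_nat (\<gamma> k \<omega>) \<partial>Q \<partial>count_space I)"
    by (rule nn_integral_count_space_nn_integral) (use m in auto)
  also have "\<dots> = (\<integral>\<^sup>+k. ennreal (lam k) \<partial>count_space I)"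
  proof (rule nn_integral_cong)
    fix k assume "k \<in> space (count_space I)"
    hence k: "k \<in> I" by simp
    show "(\<integral>\<^sup>+\<omega>. of_nat (\<gamma> k \<omega>) \<partial>Q) = ennreal (lam k)"
      using Q.nn_integral_geometric_binomial[OF gamma_measurable[OF k] lam_nonneg[OF k] geometric[OF k], of 1] by simp
  qed
  finally have "AE \<omega> in Q. (\<integral>\<^sup>+k. of_nat (\<gamma> k \<omega>) \<partial>count_space I) \<noteq> \<infinity>"
    by (intro nn_integral_PInf_AE nn_integral_count_space_measurable m) (simp_all add: nn_integral_lam)
  thus ?thesis
  proof eventually_elim
    case (elim \<omega>)
    show ?case
    proof (rule ccontr)
      let ?A = "supp I (\<lambda>k. \<gamma> k \<omega>)"
      assume inf: "infinite ?A"
      have "(\<integral>\<^sup>+k. indicator ?A k \<partial>count_space I) \<le> (\<integral>\<^sup>+k. of_nat (\<gamma> k \<omega>) \<partial>count_space I)"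
      proof (rule nn_integral_mono)
        fix k
        have "of_nat 1 \<le> (of_nat (\<gamma> k \<omega>) :: ennreal)" if "k \<in> ?A"
          using that by (intro of_nat_mono) (auto simp: supp_def)
        thus "indicator ?A k \<le> (of_nat (\<gamma> k \<omega>) :: ennreal)" by (auto simp: indicator_def)
      qed
      moreover have "(\<integral>\<^sup>+k. indicator ?A k \<partial>count_space I) = \<infinity>"
        using inf by (subst nn_integral_indicator) (auto simp: supp_def emeasure_count_space)
      ultimately show False using elim by (simp add: top_unique)
    qed
  qed
qed

lemma mixture_factorial_moment:
  assumes D: "\<And>i. i < r \<Longrightarrow> D i \<in> sets borel"
    and disj: "disjoint_family_on D {..<r}" and k: "k = (\<Sum>i<r. ks i)"
  shows "of_nat (fact k) * (\<integral>\<^sup>+m. (\<Prod>i<r. falling (emeasure m (D i)) (ks i)) \<partial>mixture) =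
    box_moment k (\<lambda>j. blocks r D ks ! j)"
proof -
  let ?f = "\<lambda>m. \<Prod>i<r. falling (emeasure m (D i)) (ks i)"
  let ?L = "\<lambda>\<omega>. occupation_law \<mu> I \<phi> (\<lambda>k. \<gamma> k \<omega>)"
  let ?w = "box_weight k (\<lambda>j. blocks r D ks ! j)"
  have f: "?f \<in> borel_measurable config_space" by (rule prod_falling_measurable[OF D])
  note L = mixture_kernel_measurable
  have choose_measurable: "(\<lambda>\<omega>. of_nat (\<gamma> a \<omega> choose c) :: ennreal) \<in> borel_measurable Q" if "a \<in> I" for a c
    by (rule measurable_compose[OF gamma_measurable[OF that], of "\<lambda>s. of_nat (s choose c)"]) simp
  have gm: "(\<lambda>\<omega>. of_nat (sub_choose (g ` {..<k}) k (\<lambda>a. \<gamma> a \<omega>) g) :: ennreal) \<in> borel_measurable Q"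
    if "g \<in> {..<k} \<rightarrow>\<^sub>E I" for g
    unfolding sub_choose_def of_nat_prod using that
    by (intro borel_measurable_prod_ennreal choose_measurable) (auto simp: PiE_iff)
  have "of_nat (fact k) * (\<integral>\<^sup>+m. ?f m \<partial>mixture) = (\<integral>\<^sup>+\<omega>. of_nat (fact k) * (\<integral>\<^sup>+m. ?f m \<partial>?L \<omega>) \<partial>Q)"
    unfolding nn_integral_bind[OF f L]
    by (intro nn_integral_cmult[symmetric] measurable_compose[OF L nn_integral_measurable_subprob_algebra[OF f]])
  also have "\<dots> = (\<integral>\<^sup>+\<omega>. \<integral>\<^sup>+g. of_nat (sub_choose (g ` {..<k}) k (\<lambda>a. \<gamma> a \<omega>) g) * ?w g \<partial>count_space ({..<k} \<rightarrow>\<^sub>E I) \<partial>Q)"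
    using AE_finite_supp
    by (intro nn_integral_cong_AE, eventually_elim) (rule occupation_law_factorial_moment[OF _ D disj k])
  also have "\<dots> = (\<integral>\<^sup>+g. \<integral>\<^sup>+\<omega>. of_nat (sub_choose (g ` {..<k}) k (\<lambda>a. \<gamma> a \<omega>) g) * ?w g \<partial>Q \<partial>count_space ({..<k} \<rightarrow>\<^sub>E I))"
    using gm by (intro nn_integral_count_space_nn_integral countable_PiE borel_measurable_times_ennreal) auto
  also have "\<dots> = box_moment k (\<lambda>j. blocks r D ks ! j)"
    unfolding box_moment_def
  proof (rule nn_integral_cong)
    fix g assume "g \<in> space (count_space ({..<k} \<rightarrow>\<^sub>E I))"
    hence g: "g \<in> {..<k} \<rightarrow>\<^sub>E I" by simp
    hence "g \<in> {..<k} \<rightarrow> I" by auto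
    from Q.nn_integral_sub_choose[OF indep lam_nonneg geometric this]
    show "(\<integral>\<^sup>+\<omega>. of_nat (sub_choose (g ` {..<k}) k (\<lambda>a. \<gamma> a \<omega>) g) * ?w g \<partial>Q) = ennreal (\<Prod>i<k. lam (g i)) * ?w g"
      by (simp add: nn_integral_multc gm[OF g])
  qed
  finally show ?thesis .
qed

lemma sets_mixture: "sets mixture = sets config_space"
  by (rule sets_bind) (simp_all add: sets_occupation_law Q.not_empty)

lemma infsum_gamma_measurable:
  "(\<lambda>\<omega>. \<Sum>\<^sub>\<infinity>k\<in>I. of_nat (\<gamma> k \<omega>) :: ennreal) \<in> borel_measurable Q"
proof -
  have "(\<lambda>\<omega>. \<Sum>\<^sub>\<infinity>k\<in>I. of_nat (\<gamma> k \<omega>) :: ennreal) = (\<lambda>\<omega>. SUP F\<in>{F. finite F \<and> F \<subseteq> I}. \<Sum>k\<in>F. of_nat (\<gamma> k \<omega>))"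
    by (intro ext nonneg_infsum_complete) auto
  also have "\<dots> \<in> borel_measurable Q"
    using measurable_compose[OF gamma_measurable, of _ of_nat borel]
    by (intro borel_measurable_SUP countable_Collect_finite_subset borel_measurable_sum) auto
  finally show ?thesis .
qed

text \<open>
  Given the occupation numbers, the number of points is not random.
\<close>

lemma mixture_total_mass:
  "distr mixture borel (\<lambda>m. emeasure m UNIV) = distr Q borel (\<lambda>\<omega>. \<Sum>\<^sub>\<infinity>k\<in>I. of_nat (\<gamma> k \<omega>))"
proof (rule measure_eqI)
  fix B assume "B \<in> sets (distr mixture borel (\<lambda>m. emeasure m UNIV))"
  hence B: "B \<in> sets borel" by simp
  let ?L = "\<lambda>\<omega>. occupation_law \<mu> I \<phi> (\<lambda>k. \<gamma> k \<omega>)"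
  let ?e = "\<lambda>m :: 'a measure. emeasure m UNIV"
  note L = mixture_kernel_measurable
  have e: "?e \<in> borel_measurable config_space" by (intro measurable_emeasure_config) simp
  have "emeasure (distr mixture borel ?e) B = (\<integral>\<^sup>+\<omega>. emeasure (distr (?L \<omega>) borel ?e) B \<partial>Q)"
    by (subst distr_bind[OF L Q.not_empty e]) (rule emeasure_bind[OF Q.not_empty measurable_compose[OF L measurable_distr[OF e]] B])
  also have "\<dots> = (\<integral>\<^sup>+\<omega>. indicator B (\<Sum>\<^sub>\<infinity>k\<in>I. of_nat (\<gamma> k \<omega>) :: ennreal) \<partial>Q)"
    using AE_finite_supp
  proof (intro nn_integral_cong_AE, eventually_elim)
    fix \<omega> assume fin: "finite (supp I (\<lambda>k. \<gamma> k \<omega>))"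
    let ?\<alpha> = "\<lambda>k. \<gamma> k \<omega>"
    interpret Z: prob_space "Z_law \<mu> I \<phi> ?\<alpha>" by (rule prob_space_Z_law[OF fin])
    have "(\<Sum>\<^sub>\<infinity>k\<in>I. of_nat (\<gamma> k \<omega>) :: ennreal) = (\<Sum>\<^sub>\<infinity>k\<in>supp I ?\<alpha>. of_nat (\<gamma> k \<omega>))"
      by (rule infsum_cong_neutral) (auto simp: supp_def)
    also have "\<dots> = of_nat (total I ?\<alpha>)" using fin by (simp add: total_def)
    finally have tot: "(\<Sum>\<^sub>\<infinity>k\<in>I. of_nat (\<gamma> k \<omega>) :: ennreal) = of_nat (total I ?\<alpha>)" .
    have "emeasure (config_of l z) UNIV = of_nat l" for l and z :: "nat \<Rightarrow> 'a"
      by (simp add: emeasure_config_of)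
    hence "distr (?L \<omega>) borel ?e = distr (Z_law \<mu> I \<phi> ?\<alpha>) borel (\<lambda>_. of_nat (total I ?\<alpha>))"
      using fin by (simp add: occupation_law_def distr_distr[OF e config_of_measurable_Z] o_def)
    also have "emeasure \<dots> B = indicator B (of_nat (total I ?\<alpha>) :: ennreal)"
      using B Z.emeasure_space_1 by (subst emeasure_distr) (auto simp: indicator_def)
    finally show "emeasure (distr (?L \<omega>) borel ?e) B = indicator B (\<Sum>\<^sub>\<infinity>k\<in>I. of_nat (\<gamma> k \<omega>) :: ennreal)"
      unfolding tot .
  qed
  also have "\<dots> = (\<integral>\<^sup>+x. indicator B x \<partial>distr Q borel (\<lambda>\<omega>. \<Sum>\<^sub>\<infinity>k\<in>I. of_nat (\<gamma> k \<omega>)))"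
    using B infsum_gamma_measurable by (intro nn_integral_distr[symmetric]) auto
  also have "\<dots> = emeasure (distr Q borel (\<lambda>\<omega>. \<Sum>\<^sub>\<infinity>k\<in>I. of_nat (\<gamma> k \<omega>))) B"
    using B by (intro nn_integral_indicator) simp
  finally show "emeasure (distr mixture borel ?e) B = emeasure (distr Q borel (\<lambda>\<omega>. \<Sum>\<^sub>\<infinity>k\<in>I. of_nat (\<gamma> k \<omega>))) B" .
qed simp

end

section \<open>Permanental processes\<close>

text \<open>
  By local compactness the relatively compact open sets cover the space, and countably many of
  them suffice by Lindelof's theorem.
\<close>

lemma radon_measure_sigma_finite:
  fixes \<mu> :: "'a::polish_space measure"
  assumes lc: "locally compact (UNIV :: 'a set)" and radon: "radon_measure \<mu>"
  shows "sigma_finite_measure \<mu>"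
proof -
  define \<C> where "\<C> = {U :: 'a set. open U \<and> (\<exists>C. compact C \<and> U \<subseteq> C)}"
  have cover: "\<Union>\<C> = UNIV"
  proof (intro equalityI subsetI)
    fix x :: 'a
    obtain U C where "open U" "compact C" "x \<in> U" "U \<subseteq> C"
      using lc unfolding locally_def by (metis UNIV_I open_UNIV openin_open_eq inf_top_left openin_subtopology_self subtopology_UNIV open_openin)
    thus "x \<in> \<Union>\<C>" by (auto simp: \<C>_def)
  qed simp
  obtain \<D> where \<D>: "\<D> \<subseteq> \<C>" "countable \<D>" "\<Union>\<D> = \<Union>\<C>"
    using Lindelof[of \<C>] by (auto simp: \<C>_def)
  have sets: "sets \<mu> = sets borel" using radon by (simp add: radon_measure_def)
  show ?thesis
  proof
    show "\<exists>A. countable A \<and> A \<subseteq> sets \<mu> \<and> \<Union>A = space \<mu> \<and> (\<forall>a\<in>A. emeasure \<mu> a \<noteq> \<infinity>)"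
    proof (intro exI[of _ \<D>] conjI ballI)
      show "\<D> \<subseteq> sets \<mu>" using \<D> by (auto simp: \<C>_def sets)
      show "\<Union>\<D> = space \<mu>" using \<D> cover sets_eq_imp_space_eq[OF sets] by simp
      fix U assume "U \<in> \<D>"
      then obtain C where C: "compact C" "U \<subseteq> C" using \<D> by (auto simp: \<C>_def)
      have "emeasure \<mu> U \<le> emeasure \<mu> C"
        using C by (intro emeasure_mono) (auto simp: sets compact_imp_closed)
      also have "\<dots> < \<infinity>" using radon C by (auto simp: radon_measure_def)
      finally show "emeasure \<mu> U \<noteq> \<infinity>" by simp
    qed (rule \<D>)
  qed
qed

lemma concat_replicate_filter:
  "concat (map (\<lambda>i. replicate (ks i) (D i)) (filter (\<lambda>i. 1 \<le> ks i) xs)) = concat (map (\<lambda>i. replicate (ks i) (D i)) xs)"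
  by (induction xs) (auto simp: not_le)

text \<open>
  Joint intensities concern multiplicities that are at least \<open>1\<close>. Sets with multiplicity
  \<open>0\<close> contribute neither to the product nor to \<open>blocks\<close>, so they can be left out.
\<close>

lemma (in trace_class_family) permanental_factorial_moment:
  fixes D :: "nat \<Rightarrow> 'a set" and X :: "'w \<Rightarrow> 'a measure"
  assumes X: "permanental_process P X \<mu> (eigen_kernel I lam \<phi>)"
    and D: "\<And>i. i < r \<Longrightarrow> D i \<in> sets borel" and disj: "disjoint_family_on D {..<r}"
    and k: "k = (\<Sum>i<r. ks i)"
  shows "of_nat (fact k) * (\<integral>\<^sup>+\<omega>. (\<Prod>i<r. falling (emeasure (X \<omega>) (D i)) (ks i)) \<partial>P) =
    box_moment k (\<lambda>j. blocks r D ks ! j)"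
proof (cases "k = 0")
  case True
  have P: "prob_space P" using X by (simp add: permanental_process_def point_process_def)
  have "(\<Prod>i<r. falling (emeasure (X \<omega>) (D i)) (ks i)) = 1" for \<omega>
    using True k by (intro prod.neutral) (auto simp: falling_def)
  thus ?thesis using prob_space.emeasure_space_1[OF P] True by (simp add: box_moment_0)
next
  case False
  obtain \<rho> where J: "joint_intensities P X \<mu> \<rho>"
    and AE_per: "\<And>k. 1 \<le> k \<Longrightarrow> AE x in Pi\<^sub>M {..<k} (\<lambda>_. \<mu>).
       complex_of_real (\<rho> k x) = per k (\<lambda>i j. eigen_kernel I lam \<phi> (x i) (x j))"
    using X by (auto simp: permanental_process_def)
  define js where "js = filter (\<lambda>i. 1 \<le> ks i) [0..<r]"
  let ?r = "length js" and ?D = "\<lambda>i. D (js ! i)" and ?ks = "\<lambda>i. ks (js ! i)"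
  have js: "distinct js" "set js = {i. i < r \<and> 1 \<le> ks i}" by (auto simp: js_def)
  have bij: "bij_betw ((!) js) {..<?r} {i. i < r \<and> 1 \<le> ks i}"
    using bij_betw_nth[OF js(1)] js(2) by simp
  have nth: "js ! i < r" "1 \<le> ks (js ! i)" if "i < ?r" for i
    using nth_mem[OF that] js(2) by auto
  have blk: "blocks ?r ?D ?ks = blocks r D ks"
  proof -
    have "map (\<lambda>i. replicate (?ks i) (?D i)) [0..<?r] = map (\<lambda>i. replicate (ks i) (D i)) (map ((!) js) [0..<?r])"
      by simp
    thus ?thesis unfolding blocks_def map_nth by (simp only: js_def concat_replicate_filter)
  qed
  have prod: "(\<Prod>i<?r. falling (emeasure (X \<omega>) (?D i)) (?ks i)) = (\<Prod>i<r. falling (emeasure (X \<omega>) (D i)) (ks i))" for \<omega>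
  proof -
    have "(\<Prod>i<?r. falling (emeasure (X \<omega>) (?D i)) (?ks i)) = (\<Prod>i | i < r \<and> 1 \<le> ks i. falling (emeasure (X \<omega>) (D i)) (ks i))"
      by (rule prod.reindex_bij_betw[OF bij])
    also have "\<dots> = (\<Prod>i<r. falling (emeasure (X \<omega>) (D i)) (ks i))"
    proof (rule prod.mono_neutral_left)
      have "falling x (ks i) = 1" if "\<not> 1 \<le> ks i" for i x
        using that by (cases "ks i") (simp_all add: falling_def)
      thus "\<forall>i\<in>{..<r} - {i. i < r \<and> 1 \<le> ks i}. falling (emeasure (X \<omega>) (D i)) (ks i) = 1" by blast
    qed auto
    finally show ?thesis .
  qed
  have sum: "(\<Sum>i<?r. ?ks i) = k"
  proof -
    have "(\<Sum>i<?r. ?ks i) = (\<Sum>i | i < r \<and> 1 \<le> ks i. ks i)"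
      by (rule sum.reindex_bij_betw[OF bij])
    also have "\<dots> = k" unfolding k by (rule sum.mono_neutral_left) auto
    finally show ?thesis .
  qed
  have r1: "1 \<le> ?r" using sum False by (cases js) auto
  have disj': "disjoint_family_on ?D {..<?r}"
    using disj nth js(1) by (auto simp: disjoint_family_on_def nth_eq_iff_index_eq)
  have "(\<integral>\<^sup>+\<omega>. (\<Prod>i<?r. falling (emeasure (X \<omega>) (?D i)) (?ks i)) \<partial>P) =
      (\<integral>\<^sup>+x. ennreal (\<rho> k x) * indicator (Pi\<^sub>E {..<k} (\<lambda>j. blocks ?r ?D ?ks ! j)) x \<partial>(Pi\<^sub>M {..<k} (\<lambda>_. \<mu>)))"
    using J r1 disj' D nth sum unfolding joint_intensities_def by auto
  hence "of_nat (fact k) * (\<integral>\<^sup>+\<omega>. (\<Prod>i<r. falling (emeasure (X \<omega>) (D i)) (ks i)) \<partial>P) =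
     of_nat (fact k) * (\<integral>\<^sup>+x. ennreal (\<rho> k x) * indicator (Pi\<^sub>E {..<k} (\<lambda>j. blocks r D ks ! j)) x \<partial>(Pi\<^sub>M {..<k} (\<lambda>_. \<mu>)))"
    by (simp only: prod blk)
  also have "\<dots> = box_moment k (\<lambda>j. blocks r D ks ! j)"
  proof (rule box_moment_eq_integral_permanent)
    show "\<rho> k \<in> borel_measurable (Pi\<^sub>M {..<k} (\<lambda>_. \<mu>))" "\<And>x. 0 \<le> \<rho> k x"
      using J False by (auto simp: joint_intensities_def)
    show "AE x in Pi\<^sub>M {..<k} (\<lambda>_. \<mu>). complex_of_real (\<rho> k x) = per k (\<lambda>i j. eigen_kernel I lam \<phi> (x i) (x j))"
      using False by (intro AE_per) simp
    fix j assume "j < k"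
    hence "blocks r D ks ! j \<in> set (blocks r D ks)" by (intro nth_mem) (simp add: length_blocks k)
    thus "blocks r D ks ! j \<in> sets \<mu>" using set_blocks[of r D ks] D sets_mu by auto
  qed
  finally show ?thesis .
qed

theorem theorem10:
  fixes \<mu> :: "'a::polish_space measure"
    and P :: "'w measure" and X :: "'w \<Rightarrow> 'a measure"
    and Q :: "'v measure" and \<gamma> :: "nat \<Rightarrow> 'v \<Rightarrow> nat"
    and n :: enat and lam :: "nat \<Rightarrow> real" and \<phi> :: "nat \<Rightarrow> 'a \<Rightarrow> complex"
  assumes "locally compact (UNIV :: 'a set)"
    and "radon_measure \<mu>"
    and "1 \<le> n"
    and "orthonormal_L2 \<mu> (idx n) \<phi>"
    and "\<And>k. k \<in> idx n \<Longrightarrow> 0 \<le> lam k"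
    and "lam summable_on idx n"
    and "permanental_process P X \<mu> (eigen_kernel (idx n) lam \<phi>)"
    and "prob_space Q"
    and "prob_space.indep_vars Q (\<lambda>_. count_space UNIV) \<gamma> (idx n)"
    and "\<And>k s. k \<in> idx n \<Longrightarrow>
           measure Q {\<omega>\<in>space Q. \<gamma> k \<omega> = s} = (lam k / (lam k + 1)) ^ s * (1 / (lam k + 1))"
  shows "distr P config_space X = Q \<bind> (\<lambda>\<omega>. occupation_law \<mu> (idx n) \<phi> (\<lambda>k. \<gamma> k \<omega>)) \<and>
         distr P borel (\<lambda>\<omega>. emeasure (X \<omega>) UNIV) =
         distr Q borel (\<lambda>\<omega>. \<Sum>\<^sub>\<infinity>k\<in>idx n. (of_nat (\<gamma> k \<omega>) :: ennreal))"
proof -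
  interpret sigma_finite_measure \<mu> by (rule radon_measure_sigma_finite[OF assms(1,2)])
  interpret prob_space Q by (rule assms(8))
  interpret geometric_occupation \<mu> "idx n" \<phi> lam Q \<gamma>
  proof
    show "sets \<mu> = sets borel" using assms(2) by (simp add: radon_measure_def)
  qed (use assms in auto)
  have PX: "prob_space P" "X \<in> measurable P config_space"
    using assms(7) by (auto simp: permanental_process_def point_process_def)
  let ?M = "distr P config_space X"
  have T: "0 \<le> infsum lam (idx n)" using lam_nonneg by (rule infsum_nonneg)
  have moment: "of_nat (fact (\<Sum>i<r. ks i)) * (\<integral>\<^sup>+m. (\<Prod>i<r. falling (emeasure m (D i)) (ks i)) \<partial>?M) =
      box_moment (\<Sum>i<r. ks i) (\<lambda>j. blocks r D ks ! j)"
    if "\<And>i. i < r \<Longrightarrow> D i \<in> sets borel" "disjoint_family_on D {..<r}" for r D ks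
    using permanental_factorial_moment[OF assms(7) that refl]
    by (subst nn_integral_distr[OF PX(2)]) (auto intro: prod_falling_measurable that)
  have law: "?M = mixture"
  proof (rule config_law_eqI[OF _ _ sets_mixture T])
    show "finite_measure ?M"
      using prob_space.prob_space_distr[OF PX] by (rule prob_space.finite_measure)
    show "(\<integral>\<^sup>+m. falling (emeasure m UNIV) k \<partial>?M) \<le> of_nat (fact k) * ennreal (infsum lam (idx n)) ^ k" for k
    proof -
      have "of_nat (fact k) * (\<integral>\<^sup>+m. falling (emeasure m UNIV) k \<partial>?M) \<le> of_nat (fact k) * (of_nat (fact k) * ennreal (infsum lam (idx n)) ^ k)"
        using moment[of 1 "\<lambda>_. UNIV" "\<lambda>_. k"] box_moment_le[of k "\<lambda>j. blocks 1 (\<lambda>_. UNIV) (\<lambda>_. k) ! j"]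
        by (simp add: disjoint_family_on_def mult.assoc)
      thus ?thesis by (simp add: ennreal_mult_le_mult_iff ennreal_of_nat_eq_real_of_nat)
    qed
    fix r :: nat and D :: "nat \<Rightarrow> 'a set" and ks
    assume D: "\<And>i. i < r \<Longrightarrow> D i \<in> sets borel" "disjoint_family_on D {..<r}"
    have "(fact (\<Sum>i<r. ks i) :: nat) \<noteq> 0" by simp
    moreover have "of_nat (fact (\<Sum>i<r. ks i)) * (\<integral>\<^sup>+m. (\<Prod>i<r. falling (emeasure m (D i)) (ks i)) \<partial>?M) =
        of_nat (fact (\<Sum>i<r. ks i)) * (\<integral>\<^sup>+m. (\<Prod>i<r. falling (emeasure m (D i)) (ks i)) \<partial>mixture)"
      by (simp only: moment[OF D] mixture_factorial_moment[OF D refl])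
    ultimately show "(\<integral>\<^sup>+m. (\<Prod>i<r. falling (emeasure m (D i)) (ks i)) \<partial>?M) =
       (\<integral>\<^sup>+m. (\<Prod>i<r. falling (emeasure m (D i)) (ks i)) \<partial>mixture)"
      by (rule of_nat_mult_cancel_ennreal)
  qed simp
  moreover have "distr P borel (\<lambda>\<omega>. emeasure (X \<omega>) UNIV) = distr ?M borel (\<lambda>m. emeasure m UNIV)"
    by (subst distr_distr[OF _ PX(2)]) (auto simp: o_def intro: measurable_emeasure_config)
  ultimately show ?thesis using mixture_total_mass by simp
qed

end
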